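(* Let $\mathcal{A}_d$ be the set of all measure preserving $\mathbb{Z}^d$-actions on a Lebesgue probability space $(X,\mu)$, and let $\mathcal{WA}_d$ be the set of all weak mixing $T\in\mathcal{A}_d$ that are weak mixing in all directions $L\in\mathbb{G}_{e,d}$, $1\le e\le d$. Then $\mathcal{WA}_d$ is a dense $G_\delta$ subset of $\mathcal{A}_d$ in the weak topology.
   Context: $(X,\mu)$ is a fixed Lebesgue (standard nonatomic) probability space; elements of $\mathcal{A}_d$ are not required to be free, and actions are identified if they agree a.e. The weak topology on $\mathcal{A}_d$ is the (completely metrizable, separable) topology in which $T_n\to T$ iff $\|f\circ T_n^{\vec n}-f\circ T^{\vec n}\|_2\to0$ for all $\vec n\in\mathbb{Z}^d$ and $f\in L^2(X,\mu)$, equivalently $\mu(T_n^{\vec n}E\,\triangle\,T^{\vec n}E)\to0$ for all $\vec n\in\mathbb{Z}^d$ and all measurable $E\subseteq X$. An action is weak mixing if the only $L^2$ eigenfunctions are constants. $\mathbb{G}_{e,d}$ is the set of $e$-dimensional linear subspaces of $\mathbb{R}^d$. Directional weak mixing. For a $\mathbb{Z}^d$-action $T$, let $\widetilde T$ be the unit suspension, i.e. the $\mathbb{R}^d$-action on $(\widetilde X,\tilde\mu)=(X\times[0,1)^d,\mu\times\lambda)$, $\lambda$ Lebesgue measure, given by $\widetilde T^{\vec t}(x,\vec r)=(T^{\lfloor\vec t+\vec r\rfloor}x,\{\vec t+\vec r\})$, with componentwise integer part $\lfloor\cdot\rfloor$ and fractional part $\{\cdot\}$. Let $\mathcal{O}=\{F(x,\vec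 s)=f(\vec s): f\in L^2([0,1)^d,\lambda)\}$ and $L^2_{\mathcal{O}}(\widetilde X,\tilde\mu)=\mathcal{O}^\perp\subseteq L^2(\widetilde X,\tilde\mu)$. $T$ is weak mixing in the direction $L$ if there is no nonzero $F\in L^2_{\mathcal{O}}(\widetilde X,\tilde\mu)$ such that, for some $\vec\ell\in L$, $F(\widetilde T^{\vec t}y)=e^{2\pi i\vec\ell\cdot\vec t}F(y)$ for all $\vec t\in L$ and a.e. $y$. *)

theory Defs
  imports "HOL-Probability.Probability"
begin

definition nonatomic :: "'a measure \<Rightarrow> bool" where
  "nonatomic M \<longleftrightarrow>
     (\<forall>A\<in>sets M. 0 < measure M A \<longrightarrow>
        (\<exists>B\<in>sets M. B \<subseteq> A \<and> 0 < measure M B \<and> measure M B < measure M A))"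

(* The sigma-algebra is that of a standard Borel space, or its completion with respect to the
   measure: both conventions for "Lebesgue space" are covered. *)
definition lebesgue_probability_space :: "'a::polish_space measure \<Rightarrow> bool" where
  "lebesgue_probability_space M \<longleftrightarrow>
     prob_space M \<and> nonatomic M \<and>
     (\<exists>N. sets N = sets borel \<and> (M = N \<or> M = completion N))"

definition measure_preserving :: "'a measure \<Rightarrow> ('a \<Rightarrow> 'a) \<Rightarrow> bool" where
  "measure_preserving M f \<longleftrightarrow> f \<in> M \<rightarrow>\<^sub>M M \<and> distr M M f = M"

type_synonym ('a, 'd) zd_map = "int ^ 'd \<Rightarrow> 'a \<Rightarrow> 'a"

definition mp_actions :: "'a measure \<Rightarrow> ('a, 'd::finite) zd_map set" where
  "mp_actions M =
     {T. (\<forall>n. measure_preserving M (T n)) \<and>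
         (\<forall>x\<in>space M. T 0 x = x) \<and>
         (\<forall>m n. \<forall>x\<in>space M. T (m + n) x = T m (T n x))}"

definition ae_equal :: "'a measure \<Rightarrow> (('a, 'd::finite) zd_map \<times> ('a, 'd) zd_map) set" where
  "ae_equal M =
     {(S, T). S \<in> mp_actions M \<and> T \<in> mp_actions M \<and> (\<forall>n. AE x in M. S n x = T n x)}"

definition action_space :: "'a measure \<Rightarrow> ('a, 'd::finite) zd_map set set" where
  "action_space M = mp_actions M // ae_equal M"

definition L2_fun :: "'a measure \<Rightarrow> ('a \<Rightarrow> complex) set" where
  "L2_fun M = {f \<in> borel_measurable M. integrable M (\<lambda>x. (cmod (f x))\<^sup>2)}"

definition L2_dist :: "'a measure \<Rightarrow> ('a \<Rightarrow> complex) \<Rightarrow> ('a \<Rightarrow> complex) \<Rightarrow> real" where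
  "L2_dist M f g = sqrt (\<integral>x. (cmod (f x - g x))\<^sup>2 \<partial>M)"

(* The subbasic sets are the balls of the pseudometrics L2_dist M (f o S n) (f o T n); a point of
   action_space M is a class C, on whose representatives these do not depend.  That convergence
   of sequences is the intended one is proved as limitin_weak_topology_iff below. *)
definition weak_topology :: "'a measure \<Rightarrow> ('a, 'd::finite) zd_map set topology" where
  "weak_topology M = topology_generated_by
     {{C \<in> action_space M. \<exists>T\<in>C. L2_dist M (f \<circ> T n) (f \<circ> S n) < \<epsilon>} | f S n \<epsilon>.
        f \<in> L2_fun M \<and> S \<in> mp_actions M \<and> \<epsilon> > 0}"

lemma action_space_cases:
  assumes "C \<in> action_space M"
  obtains T where "T \<in> mp_actions M" "C = ae_equal M `` {T}"
  using assms by (auto simp: action_space_def elim: quotientE)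

lemma action_class_mem: "T \<in> mp_actions M \<Longrightarrow> T \<in> ae_equal M `` {T}"
  by (auto simp: ae_equal_def)

lemma action_class_in: "T \<in> mp_actions M \<Longrightarrow> ae_equal M `` {T} \<in> action_space M"
  by (auto simp: action_space_def intro: quotientI)

lemma L2_fun_comp:
  assumes f: "f \<in> L2_fun M" and T: "T \<in> mp_actions M"
  shows "f \<circ> T n \<in> L2_fun M"
proof -
  from T have mp: "T n \<in> M \<rightarrow>\<^sub>M M" "distr M M (T n) = M"
    by (auto simp: mp_actions_def measure_preserving_def)
  from f have fm: "f \<in> borel_measurable M" and fi: "integrable M (\<lambda>x. (cmod (f x))\<^sup>2)"
    by (auto simp: L2_fun_def)
  have "integrable M (\<lambda>x. (cmod (f (T n x)))\<^sup>2)"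
    using integrable_distr[of "T n" M M "\<lambda>x. (cmod (f x))\<^sup>2"] mp fi by simp
  then show ?thesis
    using fm mp by (auto simp: L2_fun_def intro!: measurable_comp)
qed

lemma L2_dist_cong:
  assumes "f \<in> borel_measurable M" "f' \<in> borel_measurable M" "g \<in> borel_measurable M"
    and "AE x in M. f x = f' x"
  shows "L2_dist M f g = L2_dist M f' g"
proof -
  have "(\<integral>x. (cmod (f x - g x))\<^sup>2 \<partial>M) = (\<integral>x. (cmod (f' x - g x))\<^sup>2 \<partial>M)"
  proof (rule integral_cong_AE)
    show "(\<lambda>x. (cmod (f x - g x))\<^sup>2) \<in> borel_measurable M"
      "(\<lambda>x. (cmod (f' x - g x))\<^sup>2) \<in> borel_measurable M"
      using assms(1-3) by measurable
    show "AE x in M. (cmod (f x - g x))\<^sup>2 = (cmod (f' x - g x))\<^sup>2"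
      using assms(4) by eventually_elim simp
  qed
  then show ?thesis by (simp add: L2_dist_def)
qed

lemma L2_fun_diff_integrable:
  assumes "f \<in> L2_fun M" "g \<in> L2_fun M"
  shows "integrable M (\<lambda>x. (cmod (f x - g x))\<^sup>2)"
proof (rule Bochner_Integration.integrable_bound)
  show "integrable M (\<lambda>x. 2 * (cmod (f x))\<^sup>2 + 2 * (cmod (g x))\<^sup>2)"
    using assms by (auto simp: L2_fun_def)
  show "(\<lambda>x. (cmod (f x - g x))\<^sup>2) \<in> borel_measurable M"
    using assms by (auto simp: L2_fun_def)
  have "(cmod (a - b))\<^sup>2 \<le> 2 * (cmod a)\<^sup>2 + 2 * (cmod b)\<^sup>2" for a b :: complex
  proof -
    have "(cmod (a - b))\<^sup>2 \<le> (cmod a + cmod b)\<^sup>2"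
      by (intro power_mono norm_triangle_ineq4) auto
    also have "\<dots> \<le> 2 * (cmod a)\<^sup>2 + 2 * (cmod b)\<^sup>2"
      using zero_le_power2[of "cmod a - cmod b"] by (simp add: power2_eq_square algebra_simps)
    finally show ?thesis .
  qed
  then show "AE x in M. norm ((cmod (f x - g x))\<^sup>2)
      \<le> norm (2 * (cmod (f x))\<^sup>2 + 2 * (cmod (g x))\<^sup>2)"
    by auto
qed

lemma L2_dist_triangle:
  assumes "f \<in> L2_fun M" "g \<in> L2_fun M" "h \<in> L2_fun M"
  shows "L2_dist M f h \<le> L2_dist M f g + L2_dist M g h"
proof -
  let ?a = "L2_dist M f g" and ?b = "L2_dist M g h" and ?c = "L2_dist M f h"
  have sq: "(L2_dist M u v)\<^sup>2 = (\<integral>x. (cmod (u x - v x))\<^sup>2 \<partial>M)" for u v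
    by (simp add: L2_dist_def)
  have nn: "0 \<le> ?a" "0 \<le> ?b"
    by (auto simp: L2_dist_def)
  have pw: "(cmod (u + v))\<^sup>2 \<le> (1 + s) * (cmod u)\<^sup>2 + (1 + 1 / s) * (cmod v)\<^sup>2"
    if "s > 0" for u v :: complex and s :: real
  proof -
    have "(cmod (u + v))\<^sup>2 \<le> (cmod u + cmod v)\<^sup>2"
      by (intro power_mono norm_triangle_ineq) auto
    also have "\<dots> = (cmod u)\<^sup>2 + (cmod v)\<^sup>2 + 2 * cmod u * cmod v"
      by (simp add: power2_eq_square algebra_simps)
    also have "2 * cmod u * cmod v \<le> s * (cmod u)\<^sup>2 + (cmod v)\<^sup>2 / s"
    proof -
      have "0 \<le> (s * cmod u - cmod v)\<^sup>2 / s" using that by simp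
      also have "\<dots> = s * (cmod u)\<^sup>2 + (cmod v)\<^sup>2 / s - 2 * cmod u * cmod v"
        using that by (simp add: power2_eq_square field_simps)
      finally show ?thesis by simp
    qed
    finally show ?thesis by (simp add: algebra_simps)
  qed
  have main: "?c\<^sup>2 \<le> (1 + s) * ?a\<^sup>2 + (1 + 1 / s) * ?b\<^sup>2" if "s > 0" for s
  proof -
    have "?c\<^sup>2 \<le> (\<integral>x. (1 + s) * (cmod (f x - g x))\<^sup>2 + (1 + 1 / s) * (cmod (g x - h x))\<^sup>2 \<partial>M)"
      unfolding sq
    proof (rule integral_mono)
      show "(cmod (f x - h x))\<^sup>2
          \<le> (1 + s) * (cmod (f x - g x))\<^sup>2 + (1 + 1 / s) * (cmod (g x - h x))\<^sup>2" for x
        using pw[OF that, of "f x - g x" "g x - h x"] by simp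
    qed (use assms in \<open>auto intro!: L2_fun_diff_integrable\<close>)
    also have "\<dots> = (1 + s) * ?a\<^sup>2 + (1 + 1 / s) * ?b\<^sup>2"
      unfolding sq using assms by (simp add: L2_fun_diff_integrable)
    finally show ?thesis .
  qed
  have "?c \<le> ?a + ?b + 2 * \<delta>" if "\<delta> > 0" for \<delta>
  proof -
    let ?u = "?a + \<delta>" and ?v = "?b + \<delta>"
    have uv: "?u > 0" "?v > 0" using nn that by auto
    have "?c\<^sup>2 \<le> (1 + ?v / ?u) * ?a\<^sup>2 + (1 + 1 / (?v / ?u)) * ?b\<^sup>2"
      by (rule main) (use uv in simp)
    also have "\<dots> \<le> (1 + ?v / ?u) * ?u\<^sup>2 + (1 + 1 / (?v / ?u)) * ?v\<^sup>2"
      using uv nn that by (intro add_mono mult_left_mono power_mono) auto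
    also have "\<dots> = (?u + ?v)\<^sup>2"
    proof -
      have "(1 + v / u) * u\<^sup>2 + (1 + 1 / (v / u)) * v\<^sup>2 = (u + v)\<^sup>2"
        if "u > 0" "v > 0" for u v :: real
        using that by (simp add: power2_eq_square field_simps)
      then show ?thesis using uv by blast
    qed
    finally have "?c\<^sup>2 \<le> (?u + ?v)\<^sup>2" .
    moreover have "0 \<le> ?u + ?v" using uv by linarith
    ultimately have "?c \<le> ?u + ?v"
      by (rule power2_le_imp_le)
    then show ?thesis by simp
  qed
  note le = this
  show ?thesis
  proof (rule field_le_epsilon)
    fix e :: real assume "0 < e"
    then show "?c \<le> ?a + ?b + e" using le[of "e / 2"] by simp
  qed
qed

lemma L2_dist_class:
  assumes f: "f \<in> L2_fun M" and T: "T \<in> mp_actions M" and S: "S \<in> mp_actions M"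
  shows "(\<exists>T'\<in>ae_equal M `` {T}. L2_dist M (f \<circ> T' n) (f \<circ> S n) < \<epsilon>)
           \<longleftrightarrow> L2_dist M (f \<circ> T n) (f \<circ> S n) < \<epsilon>"
proof -
  have "L2_dist M (f \<circ> T' n) (f \<circ> S n) = L2_dist M (f \<circ> T n) (f \<circ> S n)"
    if "(T, T') \<in> ae_equal M" for T'
  proof (rule L2_dist_cong)
    from that have T': "T' \<in> mp_actions M" and eq: "AE x in M. T n x = T' n x"
      by (auto simp: ae_equal_def)
    show "f \<circ> T' n \<in> borel_measurable M" "f \<circ> T n \<in> borel_measurable M"
      "f \<circ> S n \<in> borel_measurable M"
      using L2_fun_comp[OF f] T T' S by (auto simp: L2_fun_def)
    show "AE x in M. (f \<circ> T' n) x = (f \<circ> T n) x"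
      using eq by eventually_elim simp
  qed
  then show ?thesis
    using action_class_mem[OF T] by (metis Image_singleton_iff)
qed

lemma openin_weak_subbasic:
  assumes "f \<in> L2_fun M" "S \<in> mp_actions M" "\<epsilon> > 0"
  shows "openin (weak_topology M)
    {C \<in> action_space M. \<exists>T\<in>C. L2_dist M (f \<circ> T n) (f \<circ> S n) < \<epsilon>}"
  unfolding weak_topology_def
  by (rule topology_generated_by_Basis, rule CollectI, intro exI conjI, rule refl) (rule assms)+

lemma topspace_weak_topology:
  "topspace (weak_topology M) = (action_space M :: ('a, 'd::finite) zd_map set set)"
proof -
  have "C \<in> topspace (weak_topology M)" if "C \<in> action_space M" for C :: "('a, 'd) zd_map set"
  proof -
    from that obtain T where T: "T \<in> mp_actions M" "C = ae_equal M `` {T}"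
      by (rule action_space_cases)
    have z: "(\<lambda>_. 0) \<in> L2_fun M" by (simp add: L2_fun_def)
    let ?U = "{C \<in> action_space M :: ('a, 'd) zd_map set set.
      \<exists>T'\<in>C. L2_dist M ((\<lambda>_. 0) \<circ> T' 0) ((\<lambda>_. 0) \<circ> T 0) < 1}"
    have "\<exists>T'\<in>C. L2_dist M ((\<lambda>_. 0) \<circ> T' 0) ((\<lambda>_. 0) \<circ> T 0) < 1"
    proof (rule bexI)
      show "T \<in> C" using action_class_mem[OF T(1)] T(2) by simp
    qed (simp add: L2_dist_def)
    then have "C \<in> ?U" using that by simp
    moreover have "openin (weak_topology M) ?U"
      by (rule openin_weak_subbasic[OF z T(1) zero_less_one])
    ultimately show ?thesis using openin_subset by blast
  qed
  moreover have "topspace (weak_topology M) \<subseteq> (action_space M :: ('a, 'd) zd_map set set)"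
    unfolding weak_topology_def topology_generated_by_topspace by blast
  ultimately show ?thesis by blast
qed

lemma limitin_weak_topology_iff:
  fixes S :: "nat \<Rightarrow> ('a, 'd::finite) zd_map"
  assumes S: "\<And>k. S k \<in> mp_actions M" and T: "T \<in> mp_actions M"
  shows "limitin (weak_topology M) (\<lambda>k. ae_equal M `` {S k}) (ae_equal M `` {T}) sequentially
    \<longleftrightarrow> (\<forall>n. \<forall>f\<in>L2_fun M. (\<lambda>k. L2_dist M (f \<circ> S k n) (f \<circ> T n)) \<longlonglongrightarrow> 0)"
    (is "?lim \<longleftrightarrow> ?conv")
proof
  assume lim: ?lim
  show ?conv
  proof (intro allI ballI)
    fix n f assume f: "f \<in> L2_fun M"
    show "(\<lambda>k. L2_dist M (f \<circ> S k n) (f \<circ> T n)) \<longlonglongrightarrow> 0"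
    proof (rule tendstoI)
      fix e :: real assume e: "e > 0"
      let ?U = "{C \<in> action_space M. \<exists>T'\<in>C. L2_dist M (f \<circ> T' n) (f \<circ> T n) < e}"
      have "openin (weak_topology M) ?U"
        by (rule openin_weak_subbasic[OF f T e])
      moreover have "ae_equal M `` {T} \<in> ?U"
        using L2_dist_class[OF f T T, of n e] e action_class_in[OF T]
        by (simp add: L2_dist_def)
      ultimately have "\<forall>\<^sub>F k in sequentially. ae_equal M `` {S k} \<in> ?U"
        using lim unfolding limitin_def by blast
      then show "\<forall>\<^sub>F k in sequentially. dist (L2_dist M (f \<circ> S k n) (f \<circ> T n)) 0 < e"
      proof eventually_elim
        case (elim k)
        then show ?case
          using L2_dist_class[OF f S T, of k n e] by (simp add: L2_dist_def)
      qed
    qed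
  qed
next
  assume conv: ?conv
  have "\<forall>\<^sub>F k in sequentially. ae_equal M `` {S k} \<in> U"
    if "generate_topology_on
     {{C \<in> action_space M. \<exists>T\<in>C. L2_dist M (f \<circ> T n) (f \<circ> R n) < \<epsilon>} | f R n \<epsilon>.
        f \<in> L2_fun M \<and> R \<in> mp_actions M \<and> \<epsilon> > 0} U"
      and "ae_equal M `` {T} \<in> U" for U
    using that
  proof (induction rule: generate_topology_on.induct)
    case (Int a b)
    then show ?case by (auto intro: eventually_conj)
  next
    case (UN K)
    then obtain k where k: "k \<in> K" "ae_equal M `` {T} \<in> k" by blast
    with UN have "\<forall>\<^sub>F j in sequentially. ae_equal M `` {S j} \<in> k" by blast
    then show ?case by eventually_elim (use k in blast)
  next
    case (Basis U)
    then obtain f R n \<epsilon> where U: "U = {C \<in> action_space M.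
        \<exists>T\<in>C. L2_dist M (f \<circ> T n) (f \<circ> R n) < \<epsilon>}"
      and f: "f \<in> L2_fun M" and R: "R \<in> mp_actions M" by blast
    let ?d = "L2_dist M (f \<circ> T n) (f \<circ> R n)"
    have d: "?d < \<epsilon>"
      using Basis(2) L2_dist_class[OF f T R, of n \<epsilon>] unfolding U by simp
    have "(\<lambda>k. L2_dist M (f \<circ> S k n) (f \<circ> T n)) \<longlonglongrightarrow> 0"
      using conv f by blast
    then have "\<forall>\<^sub>F k in sequentially. L2_dist M (f \<circ> S k n) (f \<circ> T n) < \<epsilon> - ?d"
      by (rule order_tendstoD) (use d in simp)
    then show ?case
    proof eventually_elim
      case (elim k)
      have "L2_dist M (f \<circ> S k n) (f \<circ> R n) \<le> L2_dist M (f \<circ> S k n) (f \<circ> T n) + ?d"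
        by (intro L2_dist_triangle L2_fun_comp f S T R)
      with elim have "L2_dist M (f \<circ> S k n) (f \<circ> R n) < \<epsilon>" by simp
      then show ?case
        unfolding U using L2_dist_class[OF f S R, of k n \<epsilon>] action_class_in[OF S] by simp
    qed
  qed simp
  then show ?lim
    by (auto simp: limitin_def topspace_weak_topology action_class_in[OF T])
       (simp add: weak_topology_def openin_topology_generated_by_iff)
qed

definition weak_mixing :: "'a measure \<Rightarrow> ('a, 'd::finite) zd_map \<Rightarrow> bool" where
  "weak_mixing M T \<longleftrightarrow>
     (\<forall>f\<in>L2_fun M. \<forall>ev :: int ^ 'd \<Rightarrow> complex.
        (\<forall>n. AE x in M. f (T n x) = ev n * f x) \<longrightarrow> (\<exists>c. AE x in M. f x = c))"

definition unit_cube :: "(real ^ 'd::finite) set" where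
  "unit_cube = {r. \<forall>i. 0 \<le> r $ i \<and> r $ i < 1}"

definition cube_measure :: "(real ^ 'd::finite) measure" where
  "cube_measure = restrict_space lborel unit_cube"

definition suspension_measure :: "'a measure \<Rightarrow> ('a \<times> (real ^ 'd::finite)) measure" where
  "suspension_measure M = M \<Otimes>\<^sub>M cube_measure"

definition suspension ::
    "('a, 'd::finite) zd_map \<Rightarrow> real ^ 'd \<Rightarrow> 'a \<times> (real ^ 'd) \<Rightarrow> 'a \<times> (real ^ 'd)" where
  "suspension T t = (\<lambda>(x, r). (T (\<chi> i. \<lfloor>(t + r) $ i\<rfloor>) x, \<chi> i. frac ((t + r) $ i)))"

definition O_fun :: "('a \<times> (real ^ 'd::finite) \<Rightarrow> complex) set" where
  "O_fun = {(\<lambda>(x, s). f s) | f. f \<in> L2_fun cube_measure}"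

definition L2_O :: "'a measure \<Rightarrow> ('a \<times> (real ^ 'd::finite) \<Rightarrow> complex) set" where
  "L2_O M =
     {F \<in> L2_fun (suspension_measure M).
        \<forall>G\<in>O_fun. (\<integral>y. F y * cnj (G y) \<partial>suspension_measure M) = 0}"

definition directional_weak_mixing ::
    "'a measure \<Rightarrow> ('a, 'd::finite) zd_map \<Rightarrow> (real ^ 'd) set \<Rightarrow> bool" where
  "directional_weak_mixing M T L \<longleftrightarrow>
     \<not> (\<exists>F\<in>L2_O M. \<not> (AE y in suspension_measure M. F y = 0) \<and>
          (\<exists>l\<in>L. \<forall>t\<in>L. AE y in suspension_measure M.
             F (suspension T t y) = exp (2 * of_real pi * \<i> * of_real (l \<bullet> t)) * F y))"

definition directions :: "nat \<Rightarrow> (real ^ 'd::finite) set set" where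
  "directions e = {L. subspace L \<and> dim L = e}"

(* The defining properties do not depend on the representative T of the class C. *)
definition WA :: "'a measure \<Rightarrow> ('a, 'd::finite) zd_map set set" where
  "WA M =
     {C \<in> action_space M. \<forall>T\<in>C. weak_mixing M T \<and>
        (\<forall>e\<in>{1..CARD('d)}. \<forall>L\<in>directions e. directional_weak_mixing M T L)}"

end

theory Submission
  imports Defs "HOL-Analysis.Function_Metric"
begin

text \<open>\<^bold>\<open>The G-delta part.\<close> Every direction contains a line, and an eigenfunction for the
direction restricts to one for the line; conversely an eigenfunction of the action itself, twisted by
a character of the cube, is an eigenfunction of its suspension for the whole of \<open>\<real>\<^sup>d\<close>. So membership
only concerns unit vectors \<open>v\<close> and eigenvalues \<open>\<theta>\<close> of the flow \<open>t \<mapsto> suspension T (t v)\<close>. By the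
mean ergodic theorem, \<open>\<theta>\<close> is no eigenvalue on the relevant subspace iff the convex hull of the twisted
orbit \<open>exp (-2 \<pi> i \<theta> t) F \<circ> suspension T (t v)\<close> comes arbitrarily close to 0, for \<open>F\<close> in a total
family of test functions; one half of this is orthogonality (\<open>eigenfunction_orthogonal\<close>), the other
takes a vector of minimal norm in the closed hull, which is an eigenfunction
(\<open>eigenfunction_of_averages\<close>). The averages depend continuously on \<open>v\<close> and \<open>\<theta>\<close>, uniformly in \<open>T\<close>,
and continuously on \<open>T\<close> in the weak topology. As \<open>v\<close> runs through a sphere and the line of the \<open>\<theta>\<close> is
exhausted by compact intervals \<open>[-K, K]\<close>, "for all \<open>v\<close> and all \<open>\<theta>\<close> in \<open>[-K, K]\<close> some average is smaller
than \<open>\<epsilon>\<close>" is an open condition on \<open>T\<close> (\<open>openin_small_averages\<close>), and there are countably many such conditions.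

\<^bold>\<open>Density.\<close> An action whose correlations \<open>\<mu> (T\<^sup>-\<^sup>n A \<inter> A)\<close> tend to \<open>\<mu>(A)\<^sup>2\<close> satisfies all these conditions: an
average and a late translate of it are nearly orthogonal, so passing to their midpoint nearly halves
the square of the norm, again and again. It remains to approximate a given action \<open>T\<close> by mixing
ones. Put an independent copy \<open>x\<^sub>i\<close> of a point of \<open>X\<close> and an independent uniform mark \<open>u\<^sub>i\<close> at every
site \<open>i\<close> of \<open>\<int>\<^sup>d\<close>. In a large box, let \<open>c\<close> be the site with the smallest mark, and let
\<open>\<Phi> = T\<^sup>-\<^sup>c x\<^sub>c\<close>. The law of \<open>\<Phi>\<close> is \<open>\<mu>\<close>. A translation by \<open>n\<close> moves the box only slightly, so with high
probability it selects the same point, and then \<open>\<Phi>\<close> of the translate is \<open>T\<^sup>n \<Phi>\<close>. So the Bernoulli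
shift imitates \<open>T\<close> through \<open>\<Phi>\<close>. Finally, the shift is carried over to \<open>X\<close> by an isomorphism of
probability spaces under which \<open>\<Phi>\<close> takes the same values as the identity on a prescribed finite
partition (\<open>standard_probability_iso_over\<close>); the result is \<open>bernoulli_approximation\<close>.\<close>

section \<open>Standard probability spaces are unit intervals\<close>

text \<open>A point of the Cantor set, given by its ternary digits. The gaps of the Cantor set make
the digits Borel functions of the point.\<close>
definition cantor_code :: "(nat \<Rightarrow> bool) \<Rightarrow> real" where
  "cantor_code b = (\<Sum>i. (if b i then 2 else 0) * (1/3) ^ Suc i)"

lemma cantor_code_summable: "summable (\<lambda>i. (if b i then 2 else (0::real)) * (1/3) ^ Suc i)"
proof (rule summable_comparison_test')
  show "summable (\<lambda>i. (2::real) * (1/3) ^ Suc i)"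
    by (intro summable_mult) (simp add: summable_geometric)
qed auto

lemma cantor_code_bounds: "0 \<le> cantor_code b" "cantor_code b \<le> 1"
proof -
  show "0 \<le> cantor_code b"
    unfolding cantor_code_def by (intro suminf_nonneg cantor_code_summable) auto
  have s: "(\<lambda>i. 2/3 * (1/3::real) ^ i) sums 1"
    using sums_mult[OF geometric_sums[of "1/3::real"], of "2/3"] by simp
  have "cantor_code b \<le> (\<Sum>i. 2/3 * (1/3::real) ^ i)"
    unfolding cantor_code_def
    by (intro suminf_le cantor_code_summable sums_summable[OF s]) auto
  then show "cantor_code b \<le> 1" using sums_unique[OF s] by simp
qed

lemma cantor_code_shift:
  "cantor_code b = (if b 0 then 2/3 else 0) + cantor_code (\<lambda>i. b (Suc i)) / 3"
proof -
  have "cantor_code b = (\<Sum>i. (if b (Suc i) then 2 else 0) * (1/3) ^ Suc (Suc i)) + (if b 0 then 2/3 else 0)"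
    unfolding cantor_code_def
    by (subst suminf_split_head[OF cantor_code_summable]) simp
  also have "(\<Sum>i. (if b (Suc i) then 2 else 0) * (1/3::real) ^ Suc (Suc i))
      = (\<Sum>i. (if b (Suc i) then 2 else 0) * (1/3) ^ Suc i / 3)"
    by (rule suminf_cong) simp
  also have "\<dots> = cantor_code (\<lambda>i. b (Suc i)) / 3"
    unfolding cantor_code_def using suminf_divide[OF cantor_code_summable, of "\<lambda>i. b (Suc i)" 3] by simp
  finally show ?thesis by simp
qed

text \<open>On the Cantor set, the map that forgets the first ternary digit.\<close>
definition cantor_step :: "real \<Rightarrow> real" where
  "cantor_step y = (if y \<ge> 1/2 then 3 * y - 2 else 3 * y)"

lemma cantor_code_digit: "b i \<longleftrightarrow> (cantor_step ^^ i) (cantor_code b) \<ge> 1/2"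
proof -
  have step: "b 0 \<longleftrightarrow> cantor_code b \<ge> 1/2" "cantor_step (cantor_code b) = cantor_code (\<lambda>i. b (Suc i))" for b
    using cantor_code_bounds[of "\<lambda>i. b (Suc i)"] cantor_code_shift[of b]
    by (auto simp: cantor_step_def split: if_splits)
  have "(cantor_step ^^ i) (cantor_code b) = cantor_code (\<lambda>j. b (i + j))"
    by (induction i) (auto simp: step(2))
  then show ?thesis using step(1)[of "\<lambda>j. b (i + j)"] by simp
qed

lemma measurable_cantor_step_iter [measurable]: "(cantor_step ^^ i) \<in> borel_measurable borel"
proof (induction i)
  case (Suc i)
  have [measurable]: "cantor_step \<in> borel_measurable borel"
    unfolding cantor_step_def by measurable
  show ?case using measurable_compose[OF Suc, of cantor_step borel] by (simp add: o_def)
qed (simp add: id_def)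

text \<open>The code of a point lists which of the balls with centres in a dense sequence
and radii \<open>1 / (m + 1)\<close> contain it. Reading off, for each \<open>m\<close>, the first such ball gives a sequence of
centres that converges to the point, so the inverse is a limit of Borel functions of the code.\<close>
lemma polish_borel_coding:
  obtains j :: "'a::{complete_space, second_countable_topology} \<Rightarrow> real" and r :: "real \<Rightarrow> 'a" where
    "j \<in> borel_measurable borel" "r \<in> borel_measurable borel" "\<And>x. r (j x) = x"
    "\<And>x. 0 \<le> j x" "\<And>x. j x \<le> 1"
proof -
  obtain D :: "'a set" where D: "countable D" "\<And>U. open U \<Longrightarrow> U \<noteq> {} \<Longrightarrow> \<exists>d\<in>D. d \<in> U"
    using countable_dense_setE by blast
  have "D \<noteq> {}" using D(2)[of UNIV] by auto
  define e where "e = from_nat_into D"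
  have e: "\<exists>i. dist (e i) x < inverse (real (Suc m))" for x m
  proof -
    obtain d where "d \<in> D" "d \<in> ball x (inverse (real (Suc m)))"
      using D(2)[of "ball x (inverse (real (Suc m)))"] by (metis ball_eq_empty inverse_positive_iff_positive of_nat_0_less_iff open_ball not_le zero_less_Suc)
    then show ?thesis unfolding e_def
      using from_nat_into_surj[OF D(1)] by (metis dist_commute mem_ball)
  qed
  define b where "b x n = (case prod_decode n of (i, m) \<Rightarrow> dist (e i) x < inverse (real (Suc m)))" for x n
  define j where "j x = cantor_code (b x)" for x
  define p where "p m y = (LEAST i. (cantor_step ^^ prod_encode (i, m)) y \<ge> 1/2)" for m y
  define r where "r y = lim (\<lambda>m. if Cauchy (\<lambda>m. e (p m y)) then e (p m y) else e 0)" for y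
  have digit: "(cantor_step ^^ prod_encode (i, m)) (j x) \<ge> 1/2 \<longleftrightarrow> dist (e i) x < inverse (real (Suc m))" for i m x
    using cantor_code_digit[of "b x" "prod_encode (i, m)"] by (simp add: j_def b_def)
  have close: "dist (e (p m (j x))) x < inverse (real (Suc m))" for m x
    unfolding p_def digit by (rule LeastI_ex[OF e])
  have "(\<lambda>m. e (p m (j x))) \<longlonglongrightarrow> x" for x
  proof (rule metric_LIMSEQ_I)
    fix \<epsilon> :: real assume "\<epsilon> > 0"
    then obtain N where "inverse (real (Suc N)) < \<epsilon>" using reals_Archimedean by blast
    then have "dist (e (p m (j x))) x < \<epsilon>" if "m \<ge> N" for m
      using close[of m x] that by (smt (verit) inverse_le_iff_le of_nat_Suc of_nat_mono of_nat_0_le_iff)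
    then show "\<exists>N. \<forall>m\<ge>N. dist (e (p m (j x))) x < \<epsilon>" by blast
  qed
  then have rj: "r (j x) = x" for x
    using LIMSEQ_imp_Cauchy[of "\<lambda>m. e (p m (j x))" x] by (simp add: r_def limI)
  have [measurable]: "j \<in> borel_measurable borel"
    unfolding j_def cantor_code_def b_def by (simp add: case_prod_beta)
  have [measurable]: "p m \<in> borel \<rightarrow>\<^sub>M count_space UNIV" for m
    unfolding p_def by measurable
  have [measurable]: "r \<in> borel_measurable borel"
  proof (rule borel_measurable_LIMSEQ_metric)
    fix y
    have "convergent (\<lambda>m. if Cauchy (\<lambda>m. e (p m y)) then e (p m y) else e 0)"
      by (cases "Cauchy (\<lambda>m. e (p m y))") (auto intro: Cauchy_convergent convergent_const)
    then show "(\<lambda>m. if Cauchy (\<lambda>m. e (p m y)) then e (p m y) else e 0) \<longlonglongrightarrow> r y"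
      unfolding r_def by (rule convergent_LIMSEQ_iff[THEN iffD1])
  qed measurable
  show ?thesis
    by (rule that[of j r]) (use rj in \<open>auto simp: j_def cantor_code_bounds\<close>)
qed

definition unit_uniform :: "real measure" where
  "unit_uniform = uniform_measure lborel {0<..<1}"

lemma sets_unit_uniform [simp, measurable_cong]: "sets unit_uniform = sets borel"
  and space_unit_uniform [simp]: "space unit_uniform = UNIV"
  by (auto simp: unit_uniform_def)

lemma prob_space_unit_uniform: "prob_space unit_uniform"
  unfolding unit_uniform_def by (intro prob_space_uniform_measure) auto

lemma unit_uniform_eq_distr: "unit_uniform = distr (restrict_space lborel {0<..<1::real}) borel (\<lambda>x. x)"
proof (rule measure_eqI)
  fix A assume "A \<in> sets unit_uniform"
  then have A: "A \<in> sets borel" by simp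
  have m: "(\<lambda>x. x) \<in> restrict_space lborel {0<..<1::real} \<rightarrow>\<^sub>M borel"
    by (intro measurable_restrict_space1) simp
  have "emeasure (distr (restrict_space lborel {0<..<1::real}) borel (\<lambda>x. x)) A = emeasure lborel ({0<..<1} \<inter> A)"
    by (subst emeasure_distr[OF m A], subst emeasure_restrict_space)
       (use A in \<open>auto simp: space_restrict_space intro!: arg_cong2[where f=emeasure]\<close>)
  then show "emeasure unit_uniform A = emeasure (distr (restrict_space lborel {0<..<1::real}) borel (\<lambda>x. x)) A"
    using A by (simp add: unit_uniform_def divide_ennreal_def)
qed simp

lemma AE_unit_uniform_range: "AE u in unit_uniform. 0 < u \<and> u < 1"
  unfolding unit_uniform_def
  by (rule AE_uniform_measureI) auto

lemma unit_uniform_countable_null: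
  assumes "countable C" shows "AE u in unit_uniform. u \<notin> C"
  unfolding unit_uniform_def
proof (rule AE_uniform_measureI)
  have "AE x in lborel. x \<notin> C"
    using assms by (auto intro!: AE_not_in simp: null_sets_def emeasure_lborel_countable sets.countable)
  then show "AE x in lborel. x \<in> {0<..<1} \<longrightarrow> x \<notin> C" by eventually_elim auto
qed auto

text \<open>For an atomless law the distribution function is continuous, so that it is a left inverse
of the quantile function on the open unit interval; the law is the image of the uniform one
under the quantile function, whence the two functions are mutually inverse almost everywhere.\<close>
lemma atomless_cdf_iso:
  fixes \<nu> :: "real measure"
  assumes "real_distribution \<nu>" and atomless: "\<And>x. measure \<nu> {x} = 0"
  obtains q where "q \<in> borel_measurable borel"
    "distr \<nu> borel (cdf \<nu>) = unit_uniform" "distr unit_uniform borel q = \<nu>"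
    "AE x in \<nu>. q (cdf \<nu> x) = x"
proof -
  interpret cdf_distribution \<nu> unfolding cdf_distribution_def by fact
  let ?R = "restrict_space lborel {0<..<1::real}"
  have IM: "I \<in> ?R \<rightarrow>\<^sub>M borel" using measurable_CI by (simp cong: measurable_cong_sets)
  have CM: "cdf \<nu> \<in> borel_measurable borel" by measurable
  have CI: "cdf \<nu> (I \<omega>) = \<omega>" if "0 < \<omega>" "\<omega> < 1" for \<omega>
  proof (rule antisym)
    show "\<omega> \<le> cdf \<nu> (I \<omega>)" using pseudoinverse[OF that, of "I \<omega>"] by simp
    have cont: "isCont (cdf \<nu>) (I \<omega>)" using isCont_cdf atomless by simp
    have "cdf \<nu> x < \<omega>" if "x < I \<omega>" for x
      using pseudoinverse[OF \<open>0 < \<omega>\<close> \<open>\<omega> < 1\<close>, of x] that by simp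
    then have "eventually (\<lambda>x. cdf \<nu> x \<le> \<omega>) (at_left (I \<omega>))"
      by (auto simp: eventually_at_filter less_imp_le)
    moreover have "(cdf \<nu> \<longlongrightarrow> cdf \<nu> (I \<omega>)) (at_left (I \<omega>))"
      using cont unfolding isCont_def by (rule filterlim_at_split[THEN iffD1, THEN conjunct1])
    ultimately show "cdf \<nu> (I \<omega>) \<le> \<omega>"
      by (intro tendsto_upperbound) auto
  qed
  define q where "q = (\<lambda>\<omega>. if \<omega> \<in> {0<..<1} then I \<omega> else 0)"
  have qm: "q \<in> borel_measurable borel"
    unfolding q_def using measurable_CI
    by (subst measurable_If_restrict_space_iff) (auto simp: greaterThanLessThan_def greaterThan_def lessThan_def Int_def)
  have d1: "distr unit_uniform borel q = \<nu>"
  proof -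
    have "distr unit_uniform borel q = distr ?R borel q"
      unfolding unit_uniform_eq_distr
      by (subst distr_distr) (auto simp: qm o_def intro: measurable_restrict_space1)
    also have "\<dots> = distr ?R borel I"
      by (intro distr_cong) (auto simp: q_def space_restrict_space)
    finally show ?thesis using distr_I_eq_M by simp
  qed
  have d2: "distr \<nu> borel (cdf \<nu>) = unit_uniform"
  proof -
    have "distr \<nu> borel (cdf \<nu>) = distr (distr ?R borel I) borel (cdf \<nu>)" by (simp add: distr_I_eq_M)
    also have "\<dots> = distr ?R borel (\<lambda>x. cdf \<nu> (I x))"
      by (subst distr_distr) (auto simp: o_def IM)
    also have "\<dots> = distr ?R borel (\<lambda>x. x)"
      by (intro distr_cong) (auto simp: CI space_restrict_space)
    finally show ?thesis by (simp add: unit_uniform_eq_distr)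
  qed
  have "AE u in unit_uniform. q (cdf \<nu> (q u)) = q u"
    using AE_unit_uniform_range by eventually_elim (auto simp: q_def CI)
  then have "AE x in \<nu>. q (cdf \<nu> x) = x"
    by (subst d1[symmetric], subst AE_distr_iff)
       (use qm CM in \<open>auto simp: measurable_cong_sets[OF sets_unit_uniform refl]\<close>)
  from that[OF qm d2 d1 this] show ?thesis .
qed

text \<open>The isomorphism is \<open>F (k x + j x / 2)\<close> with \<open>j\<close> a Borel coding into the unit
interval and \<open>F\<close> the distribution function. Adding \<open>k\<close> orders the points by their index first, so each
level set of \<open>k\<close> is mapped to an interval whose ends only depend on the law of \<open>k\<close>.\<close>
lemma standard_probability_iso:
  fixes Q :: "'b::{complete_space, second_countable_topology} measure" and k :: "'b \<Rightarrow> nat"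
  assumes "prob_space Q" and sQ: "sets Q = sets borel"
    and points: "\<And>x. emeasure Q {x} = 0"
    and k: "k \<in> Q \<rightarrow>\<^sub>M count_space UNIV"
  obtains f :: "'b \<Rightarrow> real" and g :: "real \<Rightarrow> 'b" where
    "f \<in> borel_measurable borel" "g \<in> borel_measurable borel"
    "distr Q borel f = unit_uniform" "distr unit_uniform borel g = Q"
    "AE x in Q. g (f x) = x"
    "AE x in Q. k x = (LEAST n. measure Q {x \<in> space Q. k x \<le> n} \<ge> f x)"
proof -
  interpret prob_space Q by fact
  obtain j :: "'b \<Rightarrow> real" and r :: "real \<Rightarrow> 'b" where
    jm: "j \<in> borel_measurable borel" and rm: "r \<in> borel_measurable borel" and rj: "\<And>x. r (j x) = x"
    and j01: "\<And>x. 0 \<le> j x" "\<And>x. j x \<le> 1" using polish_borel_coding by blast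
  have spQ: "space Q = UNIV" using sets_eq_imp_space_eq[OF sQ] by simp
  note [measurable_cong] = sQ
  note [measurable] = jm rm k
  \<comment> \<open>The factor 1/2 keeps the fractional part below 1, so that it can be recovered even where \<open>j x = 1\<close>.\<close>
  define w where "w x = real (k x) + j x / 2" for x
  define s where "s y = r (2 * frac y)" for y :: real
  have [measurable]: "w \<in> borel_measurable Q" unfolding w_def by measurable
  have kb: "k \<in> borel \<rightarrow>\<^sub>M count_space UNIV" using k by (simp cong: measurable_cong_sets add: sQ)
  have wb: "w \<in> borel_measurable borel" unfolding w_def using kb by measurable
  have [measurable]: "s \<in> borel_measurable borel" unfolding s_def frac_def by measurable
  have sw: "s (w x) = x" for x
  proof -
    have "frac (w x) = j x / 2" unfolding w_def using j01[of x]
      by (subst frac_unique_iff) auto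
    then show ?thesis using rj[of x] by (simp add: s_def mult.commute)
  qed
  define \<nu> where "\<nu> = distr Q borel w"
  have rd: "real_distribution \<nu>" unfolding \<nu>_def by (rule real_distribution_distr) measurable
  interpret \<nu>: real_distribution \<nu> by (rule rd)
  have "measure \<nu> {y} = 0" for y
  proof -
    have "w -` {y} \<inter> space Q \<subseteq> {s y}" using sw by auto
    then have "emeasure Q (w -` {y} \<inter> space Q) \<le> emeasure Q {s y}"
      by (intro emeasure_mono) (auto simp: sQ)
    then have "measure Q (w -` {y} \<inter> space Q) = 0" using points by (simp add: measure_def)
    then show ?thesis by (simp add: \<nu>_def measure_distr)
  qed
  from atomless_cdf_iso[OF rd this] obtain q where
    qm: "q \<in> borel_measurable borel" and dF: "distr \<nu> borel (cdf \<nu>) = unit_uniform"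
    and dq: "distr unit_uniform borel q = \<nu>" and qF: "AE x in \<nu>. q (cdf \<nu> x) = x" by blast
  define F where "F = cdf \<nu>"
  have Fm[measurable]: "F \<in> borel_measurable borel"
    unfolding F_def by (intro borel_measurable_mono monoI \<nu>.cdf_nondecreasing)
  note [measurable] = qm
  define f where "f x = F (w x)" for x
  define g where "g u = s (q u)" for u
  have fQ[measurable]: "f \<in> borel_measurable Q" unfolding f_def by measurable
  have fb: "f \<in> borel_measurable borel" unfolding f_def using wb by measurable
  have gm[measurable]: "g \<in> borel_measurable borel" unfolding g_def by measurable
  have df: "distr Q borel f = unit_uniform"
  proof -
    have "distr \<nu> borel F = distr Q borel f"
      unfolding \<nu>_def f_def by (subst distr_distr) (auto simp: o_def)
    then show ?thesis using dF by (simp add: F_def)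
  qed
  have AEw: "AE x in Q. q (F (w x)) = w x"
    using qF[folded F_def] unfolding \<nu>_def by (subst (asm) AE_distr_iff) auto
  have gf: "AE x in Q. g (f x) = x"
    using AEw by eventually_elim (simp add: g_def f_def sw)
  have dg: "distr unit_uniform borel g = Q"
  proof -
    have "distr unit_uniform borel g = distr Q borel (\<lambda>x. g (f x))"
      unfolding df[symmetric] by (subst distr_distr) (auto simp: o_def gm)
    also have "\<dots> = distr Q Q (\<lambda>x. x)"
      using gf by (intro distr_cong_AE) (auto simp: sQ)
    finally show ?thesis by simp
  qed
  define C where "C n = measure Q {x \<in> space Q. k x \<le> n}" for n
  \<comment> \<open>The ends of the level intervals, where the index could not be read off, are countably many.\<close>
  have "AE u in unit_uniform. u \<notin> range C"
    by (rule unit_uniform_countable_null) simp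
  moreover have "{u. u \<notin> range C} \<in> sets borel"
    using sets.countable[of "range C" borel] by (simp add: Collect_neg_eq borel_comp)
  ultimately have "AE x in Q. f x \<notin> range C"
    unfolding df[symmetric] by (subst (asm) AE_distr_iff) auto
  then have "AE x in Q. k x = (LEAST n. C n \<ge> f x)"
  proof eventually_elim
    case (elim x)
    have fx: "f x = measure Q {y \<in> space Q. w y \<le> w x}"
      by (simp add: f_def F_def cdf_def \<nu>_def measure_distr vimage_def Int_def conj_commute)
    show ?case
    proof (rule Least_equality[symmetric])
      show "f x \<le> C (k x)" unfolding fx C_def
      proof (rule finite_measure_mono)
        have "k y \<le> k x" if "w y \<le> w x" for y
        proof -
          have "real (k y) < real (k x) + 1" using that j01[of x] j01[of y] by (simp add: w_def)
          then show ?thesis by linarith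
        qed
        then show "{y \<in> space Q. w y \<le> w x} \<subseteq> {y \<in> space Q. k y \<le> k x}" by auto
      qed measurable
    next
      fix n assume n: "f x \<le> C n"
      show "k x \<le> n"
      proof (rule ccontr)
        assume "\<not> k x \<le> n"
        then have kn: "Suc n \<le> k x" by simp
        have "C n \<le> f x" unfolding fx C_def
        proof (rule finite_measure_mono)
          have "w y \<le> w x" if "k y \<le> n" for y
          proof -
            have "real (k y) + 1 \<le> real (k x)" using kn that by linarith
            then show ?thesis using j01[of x] j01[of y] by (simp add: w_def)
          qed
          then show "{y \<in> space Q. k y \<le> n} \<subseteq> {y \<in> space Q. w y \<le> w x}" by auto
        qed measurable
        with n elim show False by auto
      qed
    qed
  qed
  from that[OF fb gm df dg gf this[unfolded C_def]] show ?thesis .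
qed

text \<open>Two spaces whose index functions have the same law are isomorphic by a
map that respects the indices, because both go to the unit interval with the same level
intervals.\<close>
lemma standard_probability_iso_over:
  fixes Q1 :: "'b::{complete_space, second_countable_topology} measure" and Q2 :: "'c::{complete_space, second_countable_topology} measure"
    and k1 :: "'b \<Rightarrow> nat" and k2 :: "'c \<Rightarrow> nat"
  assumes Q1: "prob_space Q1" "sets Q1 = sets borel" "\<And>x. emeasure Q1 {x} = 0"
    and Q2: "prob_space Q2" "sets Q2 = sets borel" "\<And>y. emeasure Q2 {y} = 0"
    and k: "k1 \<in> Q1 \<rightarrow>\<^sub>M count_space UNIV" "k2 \<in> Q2 \<rightarrow>\<^sub>M count_space UNIV"
    and law: "distr Q1 (count_space UNIV) k1 = distr Q2 (count_space UNIV) k2"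
  obtains \<psi> \<phi> where "\<psi> \<in> Q1 \<rightarrow>\<^sub>M Q2" "\<phi> \<in> Q2 \<rightarrow>\<^sub>M Q1"
    "distr Q1 Q2 \<psi> = Q2" "distr Q2 Q1 \<phi> = Q1"
    "AE x in Q1. \<phi> (\<psi> x) = x" "AE y in Q2. \<psi> (\<phi> y) = y"
    "AE x in Q1. k2 (\<psi> x) = k1 x" "AE y in Q2. k1 (\<phi> y) = k2 y"
proof -
  obtain f1 g1 where f1: "f1 \<in> borel_measurable borel" "g1 \<in> borel_measurable borel"
    "distr Q1 borel f1 = unit_uniform" "distr unit_uniform borel g1 = Q1"
    "AE x in Q1. g1 (f1 x) = x"
    "AE x in Q1. k1 x = (LEAST n. measure Q1 {x \<in> space Q1. k1 x \<le> n} \<ge> f1 x)"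
    by (rule standard_probability_iso[OF Q1 k(1)])
  obtain f2 g2 where f2: "f2 \<in> borel_measurable borel" "g2 \<in> borel_measurable borel"
    "distr Q2 borel f2 = unit_uniform" "distr unit_uniform borel g2 = Q2"
    "AE x in Q2. g2 (f2 x) = x"
    "AE x in Q2. k2 x = (LEAST n. measure Q2 {x \<in> space Q2. k2 x \<le> n} \<ge> f2 x)"
    by (rule standard_probability_iso[OF Q2 k(2)])
  note mc = measurable_cong_sets
  have m1: "f1 \<in> Q1 \<rightarrow>\<^sub>M borel" "g1 \<in> borel \<rightarrow>\<^sub>M Q1" "f1 \<in> Q1 \<rightarrow>\<^sub>M unit_uniform" "g1 \<in> unit_uniform \<rightarrow>\<^sub>M Q1"
    and m2: "f2 \<in> Q2 \<rightarrow>\<^sub>M borel" "g2 \<in> borel \<rightarrow>\<^sub>M Q2" "f2 \<in> Q2 \<rightarrow>\<^sub>M unit_uniform" "g2 \<in> unit_uniform \<rightarrow>\<^sub>M Q2"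
    using f1(1,2) f2(1,2) Q1(2) Q2(2)
    by (simp_all add: mc[OF Q1(2)] mc[OF _ Q1(2)] mc[OF Q2(2)] mc[OF _ Q2(2)]
          mc[OF refl sets_unit_uniform] mc[OF sets_unit_uniform refl] mc[OF sets_unit_uniform Q1(2)]
          mc[OF sets_unit_uniform Q2(2)] mc[OF refl Q1(2)] mc[OF refl Q2(2)])
  have d: "distr Q1 unit_uniform f1 = unit_uniform" "distr unit_uniform Q1 g1 = Q1"
    "distr Q2 unit_uniform f2 = unit_uniform" "distr unit_uniform Q2 g2 = Q2"
    using f1(3,4) f2(3,4) by (simp_all cong: distr_cong add: Q1(2) Q2(2))
  define K where "K u = (LEAST n. measure (distr Q1 (count_space UNIV) k1) {..n} \<ge> u)" for u
  have "measure (distr Q1 (count_space UNIV) k1) {..n} = measure Q1 {x \<in> space Q1. k1 x \<le> n}" for n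
    using k(1) by (simp add: measure_distr vimage_def Int_def conj_commute)
  then have K1: "AE x in Q1. k1 x = K (f1 x)" using f1(6) by (simp add: K_def)
  have "measure (distr Q1 (count_space UNIV) k1) {..n} = measure Q2 {x \<in> space Q2. k2 x \<le> n}" for n
    unfolding law using k(2) by (simp add: measure_distr vimage_def Int_def conj_commute)
  then have K2: "AE x in Q2. k2 x = K (f2 x)" using f2(6) by (simp add: K_def)
  have \<psi>: "(\<lambda>x. g2 (f1 x)) \<in> Q1 \<rightarrow>\<^sub>M Q2" and \<phi>: "(\<lambda>x. g1 (f2 x)) \<in> Q2 \<rightarrow>\<^sub>M Q1"
    using measurable_compose[OF m1(3) m2(4)] measurable_compose[OF m2(3) m1(4)] by auto
  have D\<psi>: "distr Q1 Q2 (\<lambda>x. g2 (f1 x)) = Q2" and D\<phi>: "distr Q2 Q1 (\<lambda>x. g1 (f2 x)) = Q1"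
    using distr_distr[OF m2(4) m1(3)] distr_distr[OF m1(4) m2(3)] by (simp_all add: d o_def)
  have tr: "AE x in Q. P (f x)" if "AE u in R. P u" "distr Q R f = R" "f \<in> Q \<rightarrow>\<^sub>M R"
    for Q :: "'x measure" and R :: "'y measure" and f P
    by (rule AE_distrD[OF that(3)]) (unfold that(2), rule that(1))
  have "AE u in unit_uniform. f1 (g1 u) = u" "AE u in unit_uniform. f2 (g2 u) = u"
  proof -
    have s: "{u \<in> space unit_uniform. f1 (g1 u) = u} \<in> sets unit_uniform" "{u \<in> space unit_uniform. f2 (g2 u) = u} \<in> sets unit_uniform"
      using f1(1,2) f2(1,2) by simp_all
    have "AE x in Q1. f1 (g1 (f1 x)) = f1 x" using f1(5) by eventually_elim simp
    then show "AE u in unit_uniform. f1 (g1 u) = u"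
      by (subst d(1)[symmetric], subst AE_distr_iff[OF m1(3) s(1)]) 
    have "AE x in Q2. f2 (g2 (f2 x)) = f2 x" using f2(5) by eventually_elim simp
    then show "AE u in unit_uniform. f2 (g2 u) = u"
      by (subst d(3)[symmetric], subst AE_distr_iff[OF m2(3) s(2)]) 
  qed
  note fg1 = tr[OF this(1) d(3) m2(3)] and fg2 = tr[OF this(2) d(1) m1(3)]
  show ?thesis
  proof (rule that[OF \<psi> \<phi> D\<psi> D\<phi>])
    show "AE x in Q1. g1 (f2 (g2 (f1 x))) = x" using fg2 f1(5) by eventually_elim simp
    show "AE x in Q2. g2 (f1 (g1 (f2 x))) = x" using fg1 f2(5) by eventually_elim simp
    show "AE x in Q1. k2 (g2 (f1 x)) = k1 x" using tr[OF K2 D\<psi> \<psi>] K1 fg2 by eventually_elim simp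
    show "AE x in Q2. k1 (g1 (f2 x)) = k2 x" using tr[OF K1 D\<phi> \<phi>] K2 fg1 by eventually_elim simp
  qed
qed

section \<open>Mixing of Bernoulli shifts\<close>

definition mixing_along :: "'b measure \<Rightarrow> ('i \<Rightarrow> 'b \<Rightarrow> 'b) \<Rightarrow> 'b set \<Rightarrow> 'b set \<Rightarrow> bool" where
  "mixing_along Q \<tau> A B \<longleftrightarrow>
     ((\<lambda>n. measure Q (\<tau> n -` A \<inter> space Q \<inter> B)) \<longlongrightarrow> measure Q A * measure Q B) cofinite"

lemma (in prob_space) mixing_along_compl:
  assumes \<tau>: "\<And>n. \<tau> n \<in> M \<rightarrow>\<^sub>M M" "\<And>n. distr M M (\<tau> n) = M"
    and A: "A \<in> events" and B: "B \<in> events" and m: "mixing_along M \<tau> A B"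
  shows "mixing_along M \<tau> (space M - A) B" "mixing_along M \<tau> A (space M - B)"
proof -
  have tA: "\<tau> n -` A \<inter> space M \<in> events" for n using \<tau>(1) A by (rule measurable_sets)
  have "prob (\<tau> n -` (space M - A) \<inter> space M \<inter> B) = prob B - prob (\<tau> n -` A \<inter> space M \<inter> B)" for n
  proof -
    have "\<tau> n -` (space M - A) \<inter> space M \<inter> B = B - (\<tau> n -` A \<inter> space M \<inter> B)"
      using measurable_space[OF \<tau>(1)] sets.sets_into_space[OF B] by auto
    then show ?thesis using tA B by (simp add: finite_measure_Diff)
  qed
  then show "mixing_along M \<tau> (space M - A) B"
    using tendsto_diff[OF tendsto_const[of "prob B" cofinite] m[unfolded mixing_along_def]] A
    by (simp add: mixing_along_def prob_compl left_diff_distrib)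
  have "prob (\<tau> n -` A \<inter> space M \<inter> (space M - B)) = prob A - prob (\<tau> n -` A \<inter> space M \<inter> B)" for n
  proof -
    have "\<tau> n -` A \<inter> space M \<inter> (space M - B) = \<tau> n -` A \<inter> space M - (\<tau> n -` A \<inter> space M \<inter> B)"
      by auto
    moreover have "prob (\<tau> n -` A \<inter> space M) = prob A"
      using measure_distr[OF \<tau>(1) A, of n] \<tau>(2) by simp
    ultimately show ?thesis using tA[of n] B
      by (simp only: finite_measure_Diff[OF tA[of n] sets.Int[OF tA[of n] B]] Int_lower1)
  qed
  then show "mixing_along M \<tau> A (space M - B)"
    using tendsto_diff[OF tendsto_const[of "prob A" cofinite] m[unfolded mixing_along_def]] B
    by (simp add: mixing_along_def prob_compl right_diff_distrib)
qed

text \<open>The correlations of the pieces are dominated by their measures, which are summable, so the limit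
may be taken inside the sum.\<close>
lemma (in prob_space) mixing_along_UN:
  fixes \<tau> :: "'i \<Rightarrow> 'a \<Rightarrow> 'a"
  assumes inf: "infinite (UNIV :: 'i set)"
    and \<tau>: "\<And>n. \<tau> n \<in> M \<rightarrow>\<^sub>M M" "\<And>n. distr M M (\<tau> n) = M"
  shows "disjoint_family A \<Longrightarrow> range A \<subseteq> events \<Longrightarrow> B \<in> events \<Longrightarrow>
      (\<And>i::nat. mixing_along M \<tau> (A i) B) \<Longrightarrow> mixing_along M \<tau> (\<Union>i. A i) B"
    and "disjoint_family B' \<Longrightarrow> range B' \<subseteq> events \<Longrightarrow> A' \<in> events \<Longrightarrow>
      (\<And>i::nat. mixing_along M \<tau> A' (B' i)) \<Longrightarrow> mixing_along M \<tau> A' (\<Union>i. B' i)"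
proof -
  have tA: "\<tau> n -` X \<inter> space M \<in> events" "prob (\<tau> n -` X \<inter> space M) = prob X" if "X \<in> events" for n X
    using measurable_sets[OF \<tau>(1) that] measure_distr[OF \<tau>(1) that, of n] \<tau>(2) by auto
  have cf: "cofinite \<noteq> (bot :: 'i filter)" using inf by simp
  {
    assume d: "disjoint_family A" and r: "range A \<subseteq> events" and B: "B \<in> events"
      and m: "\<And>i::nat. mixing_along M \<tau> (A i) B"
    have s: "(\<lambda>i. prob (A i)) sums prob (\<Union>i. A i)" by (rule finite_measure_UNION[OF r d])
    have n: "(\<lambda>i. prob (\<tau> n -` A i \<inter> space M \<inter> B)) sums prob (\<tau> n -` (\<Union>i. A i) \<inter> space M \<inter> B)" for n
    proof -
      have "(\<lambda>i. prob (\<tau> n -` A i \<inter> space M \<inter> B)) sums prob (\<Union>i. \<tau> n -` A i \<inter> space M \<inter> B)"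
      proof (rule finite_measure_UNION)
        show "range (\<lambda>i. \<tau> n -` A i \<inter> space M \<inter> B) \<subseteq> events"
          using tA(1)[of "A _" n] B r by blast
        show "disjoint_family (\<lambda>i. \<tau> n -` A i \<inter> space M \<inter> B)"
          using d unfolding disjoint_family_on_def by blast
      qed
      then show ?thesis by (simp add: vimage_UN)
    qed
    have "((\<lambda>n. \<Sum>i. prob (\<tau> n -` A i \<inter> space M \<inter> B)) \<longlongrightarrow> (\<Sum>i. prob (A i) * prob B)) cofinite"
    proof (rule tannerys_theorem[THEN conjunct2, THEN conjunct2, OF _ _ sums_summable[OF s] cf])
      show "((\<lambda>n. prob (\<tau> n -` A k \<inter> space M \<inter> B)) \<longlongrightarrow> prob (A k) * prob B) cofinite" for k
        using m by (simp add: mixing_along_def)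
      have "prob (\<tau> n -` A k \<inter> space M \<inter> B) \<le> prob (A k)" for n k
        using tA[of "A k" n] r B finite_measure_mono[of "\<tau> n -` A k \<inter> space M \<inter> B" "\<tau> n -` A k \<inter> space M"] by auto
      then show "\<forall>\<^sub>F (k, n) in at_top \<times>\<^sub>F cofinite. norm (prob (\<tau> n -` A k \<inter> space M \<inter> B)) \<le> prob (A k)"
        by (intro always_eventually) auto
    qed
    moreover have "(\<Sum>i. prob (A i) * prob B) = prob (\<Union>i. A i) * prob B"
      using sums_mult2[OF s] by (rule sums_unique[symmetric])
    ultimately show "mixing_along M \<tau> (\<Union>i. A i) B"
      using sums_unique[OF n] by (simp add: mixing_along_def)
  }
  {
    assume d: "disjoint_family B'" and r: "range B' \<subseteq> events" and A: "A' \<in> events"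
      and m: "\<And>i::nat. mixing_along M \<tau> A' (B' i)"
    have s: "(\<lambda>i. prob (B' i)) sums prob (\<Union>i. B' i)" by (rule finite_measure_UNION[OF r d])
    have n: "(\<lambda>i. prob (\<tau> n -` A' \<inter> space M \<inter> B' i)) sums prob (\<tau> n -` A' \<inter> space M \<inter> (\<Union>i. B' i))" for n
    proof -
      have "(\<lambda>i. prob (\<tau> n -` A' \<inter> space M \<inter> B' i)) sums prob (\<Union>i. \<tau> n -` A' \<inter> space M \<inter> B' i)"
      proof (rule finite_measure_UNION)
        show "range (\<lambda>i. \<tau> n -` A' \<inter> space M \<inter> B' i) \<subseteq> events"
          using tA(1)[OF A, of n] r by blast
        show "disjoint_family (\<lambda>i. \<tau> n -` A' \<inter> space M \<inter> B' i)"
          using d unfolding disjoint_family_on_def by blast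
      qed
      then show ?thesis by simp
    qed
    have "((\<lambda>n. \<Sum>i. prob (\<tau> n -` A' \<inter> space M \<inter> B' i)) \<longlongrightarrow> (\<Sum>i. prob A' * prob (B' i))) cofinite"
    proof (rule tannerys_theorem[THEN conjunct2, THEN conjunct2, OF _ _ sums_summable[OF s] cf])
      show "((\<lambda>n. prob (\<tau> n -` A' \<inter> space M \<inter> B' k)) \<longlongrightarrow> prob A' * prob (B' k)) cofinite" for k
        using m by (simp add: mixing_along_def)
      have "prob (\<tau> n -` A' \<inter> space M \<inter> B' k) \<le> prob (B' k)" for n k
        using r by (intro finite_measure_mono) auto
      then show "\<forall>\<^sub>F (k, n) in at_top \<times>\<^sub>F cofinite. norm (prob (\<tau> n -` A' \<inter> space M \<inter> B' k)) \<le> prob (B' k)"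
        by (intro always_eventually) auto
    qed
    moreover have "(\<Sum>i. prob A' * prob (B' i)) = prob A' * prob (\<Union>i. B' i)"
      using sums_mult[OF s] by (rule sums_unique[symmetric])
    ultimately show "mixing_along M \<tau> A' (\<Union>i. B' i)"
      using sums_unique[OF n] by (simp add: mixing_along_def)
  }
qed

text \<open>For a fixed second set the sets that mix with it form a Dynkin system, and likewise
in the other argument, so that mixing has to be checked on a generating pi-system only.\<close>
lemma (in prob_space) mixing_along_generated:
  fixes \<tau> :: "'i \<Rightarrow> 'a \<Rightarrow> 'a"
  assumes inf: "infinite (UNIV :: 'i set)"
    and \<tau>: "\<And>n. \<tau> n \<in> M \<rightarrow>\<^sub>M M" "\<And>n. distr M M (\<tau> n) = M"
    and G: "Int_stable G" "G \<subseteq> Pow (space M)" "events = sigma_sets (space M) G"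
    and gen: "\<And>A B. A \<in> G \<Longrightarrow> B \<in> G \<Longrightarrow> mixing_along M \<tau> A B"
    and A: "A \<in> events" and B: "B \<in> events"
  shows "mixing_along M \<tau> A B"
proof -
  have GE: "X \<in> events" if "X \<in> G" for X using that G(3) by auto
  have *: "mixing_along M \<tau> X Y" if X: "X \<in> sigma_sets (space M) G" and Y: "Y \<in> G" for X Y
    using G(1,2) X
  proof (induction rule: sigma_sets_induct_disjoint)
    case (compl X)
    show ?case by (rule mixing_along_compl(1)[OF \<tau>]) (use compl G(3) GE Y in auto)
  next
    case (union X)
    show ?case by (rule mixing_along_UN(1)[OF inf \<tau>]) (use union G(3) GE Y in auto)
  qed (use gen Y in \<open>auto simp: mixing_along_def\<close>)
  show ?thesis using G(1,2) B[unfolded G(3)]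
  proof (induction rule: sigma_sets_induct_disjoint)
    case (basic Y) then show ?case using * A G(3) by auto
  next
    case (compl Y)
    show ?case by (rule mixing_along_compl(2)[OF \<tau>]) (use compl G(3) A in auto)
  next
    case (union Y)
    show ?case by (rule mixing_along_UN(2)[OF inf \<tau>]) (use union G(3) A in auto)
  qed (auto simp: mixing_along_def)
qed

definition coord_shift :: "'i::ab_group_add \<Rightarrow> ('i \<Rightarrow> 'b) \<Rightarrow> 'i \<Rightarrow> 'b" where
  "coord_shift n \<omega> = (\<lambda>i. \<omega> (i + n))"

lemma coord_shift_0 [simp]: "coord_shift 0 \<omega> = \<omega>" and coord_shift_coord_shift: "coord_shift m (coord_shift n \<omega>) = coord_shift (m + n) \<omega>"
  by (auto simp: coord_shift_def add_ac)

lemma distr_PiM_permute: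
  assumes "prob_space B" and "inj f"
  shows "(\<lambda>\<omega> i. \<omega> (f i)) \<in> PiM UNIV (\<lambda>_. B) \<rightarrow>\<^sub>M PiM UNIV (\<lambda>_. B)"
    "distr (PiM UNIV (\<lambda>_. B)) (PiM UNIV (\<lambda>_. B)) (\<lambda>\<omega> i. \<omega> (f i)) = PiM UNIV (\<lambda>_. B)"
proof -
  show "(\<lambda>\<omega> i. \<omega> (f i)) \<in> PiM UNIV (\<lambda>_. B) \<rightarrow>\<^sub>M PiM UNIV (\<lambda>_. B)"
    by (rule measurable_PiM_single') (auto simp: space_PiM PiE_iff)
  show "distr (PiM UNIV (\<lambda>_. B)) (PiM UNIV (\<lambda>_. B)) (\<lambda>\<omega> i. \<omega> (f i)) = PiM UNIV (\<lambda>_. B)"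
    using distr_PiM_reindex[of UNIV "\<lambda>_. B" f UNIV] assms by (simp add: restrict_def)
qed

lemma measurable_coord_shift [measurable]:
  assumes "prob_space B"
  shows "coord_shift n \<in> PiM UNIV (\<lambda>_. B) \<rightarrow>\<^sub>M PiM UNIV (\<lambda>_. B)"
  using distr_PiM_permute(1)[OF assms, of "\<lambda>i. i + n"] by (simp add: coord_shift_def[abs_def] inj_def)

lemma distr_coord_shift:
  assumes "prob_space B"
  shows "distr (PiM UNIV (\<lambda>_. B)) (PiM UNIV (\<lambda>_. B)) (coord_shift n) = PiM UNIV (\<lambda>_. B)"
  using distr_PiM_permute(2)[OF assms, of "\<lambda>i. i + n"] by (simp add: coord_shift_def[abs_def] inj_def)

lemma measure_cylinder:
  assumes "prob_space B" and sp: "space B = UNIV" and "finite J" "\<And>i. i \<in> J \<Longrightarrow> X i \<in> sets B"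
  shows "measure (PiM UNIV (\<lambda>_. B)) {\<omega>. \<forall>i\<in>J. \<omega> i \<in> X i} = (\<Prod>i\<in>J. measure B (X i))"
proof -
  interpret prob_space B by fact
  interpret product_prob_space "\<lambda>_. B" UNIV by unfold_locales
  have "prod_emb UNIV (\<lambda>_. B) J (Pi\<^sub>E J X) = {\<omega>. \<forall>i\<in>J. \<omega> i \<in> X i}"
    by (auto simp: prod_emb_def sp)
  then show ?thesis using measure_PiM_emb[of J X] assms by simp
qed

text \<open>Two cylinders become independent once the translate of one set of coordinates misses
the other, and only finitely many translations fail to do so.\<close>
lemma mixing_bernoulli_shift:
  fixes A B :: "('i::ab_group_add \<Rightarrow> 'b) set"
  assumes prob: "prob_space Q" and sp: "space Q = UNIV" and inf: "infinite (UNIV :: 'i set)"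
    and A: "A \<in> sets (PiM UNIV (\<lambda>_. Q))" and B: "B \<in> sets (PiM UNIV (\<lambda>_. Q))"
  shows "mixing_along (PiM UNIV (\<lambda>_. Q)) coord_shift A B"
proof -
  let ?P = "PiM (UNIV::'i set) (\<lambda>_. Q)"
  interpret P: prob_space ?P by (rule prob_space_PiM) (rule prob)
  have spP: "space ?P = UNIV" using sp by (simp add: space_PiM)
  let ?G = "{{\<omega>. \<forall>i\<in>J. \<omega> i \<in> X i} | J X. finite J \<and> (\<forall>i\<in>J. X i \<in> sets Q)} :: ('i \<Rightarrow> 'b) set set"
  have emb: "prod_emb UNIV (\<lambda>_. Q) J (Pi\<^sub>E J X) = {\<omega>. \<forall>i\<in>J. \<omega> i \<in> X i}" for J :: "'i set" and X
    by (auto simp: prod_emb_def sp)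
  have GG: "?G = prod_algebra (UNIV::'i set) (\<lambda>_. Q)"
  proof (intro equalityI subsetI)
    fix C assume "C \<in> ?G"
    then obtain J X where C: "C = {\<omega>. \<forall>i\<in>J. \<omega> i \<in> X i}" "finite J" "\<forall>i\<in>J. X i \<in> sets Q" by blast
    show "C \<in> prod_algebra (UNIV::'i set) (\<lambda>_. Q)"
    proof (cases "J = {}")
      case True
      have "prod_emb UNIV (\<lambda>_. Q) {undefined::'i} (Pi\<^sub>E {undefined} (\<lambda>_. space Q)) \<in> prod_algebra UNIV (\<lambda>_. Q)"
        by (intro prod_algebraI) auto
      then show ?thesis using True C(1) sp emb[of "{undefined}" "\<lambda>_. UNIV"] by simp
    next
      case False
      then show ?thesis using C prod_algebraI[of J UNIV X "\<lambda>_. Q"] by (simp add: emb)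
    qed
  next
    fix C assume "C \<in> prod_algebra (UNIV::'i set) (\<lambda>_. Q)"
    then show "C \<in> ?G" by (rule prod_algebraE) (auto simp: emb)
  qed
  have mix: "mixing_along ?P coord_shift C D" if "C \<in> ?G" "D \<in> ?G" for C D
  proof -
    from that obtain J X K Y where C: "C = {\<omega>. \<forall>i\<in>J. \<omega> i \<in> X i}" "finite J" "\<And>i. i\<in>J \<Longrightarrow> X i \<in> sets Q"
      and D: "D = {\<omega>. \<forall>i\<in>K. \<omega> i \<in> Y i}" "finite K" "\<And>i. i\<in>K \<Longrightarrow> Y i \<in> sets Q" by blast
    have "finite ((\<lambda>(k, j). k - j) ` (K \<times> J))" using C D by auto
    then have "\<forall>\<^sub>F n in cofinite. n \<notin> (\<lambda>(k, j). k - j) ` (K \<times> J)"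
      by (simp add: eventually_cofinite)
    then have "\<forall>\<^sub>F n in cofinite. measure ?P (coord_shift n -` C \<inter> space ?P \<inter> D) = measure ?P C * measure ?P D"
    proof eventually_elim
      case (elim n)
      have disj: "(\<lambda>i. i + n) ` J \<inter> K = {}"
      proof (rule ccontr)
        assume "\<not> ?thesis"
        then obtain j where "j \<in> J" "j + n \<in> K" by auto
        then have "n \<in> (\<lambda>(k, j). k - j) ` (K \<times> J)" by (intro image_eqI[of _ _ "(j + n, j)"]) auto
        with elim show False by simp
      qed
      \<comment> \<open>The intersection is again a cylinder, on the disjoint union of the two sets of coordinates.\<close>
      define Z where "Z l = (if l \<in> K then Y l else X (l - n))" for l
      have ZJ: "Z (j + n) = X j" if "j \<in> J" for j using disj that by (auto simp: Z_def)
      have ZK: "Z k = Y k" if "k \<in> K" for k using that by (simp add: Z_def)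
      have "coord_shift n -` C \<inter> space ?P \<inter> D = {\<omega>. \<forall>i\<in>(\<lambda>i. i + n) ` J \<union> K. \<omega> i \<in> Z i}"
        by (simp add: spP C(1) D(1) coord_shift_def set_eq_iff ball_Un ZJ ZK)
      then have "measure ?P (coord_shift n -` C \<inter> space ?P \<inter> D) = (\<Prod>i\<in>(\<lambda>i. i + n) ` J \<union> K. measure Q (Z i))"
        using C D ZJ ZK by (simp, subst measure_cylinder[OF prob sp]) auto
      also have "\<dots> = (\<Prod>i\<in>(\<lambda>i. i + n) ` J. measure Q (Z i)) * (\<Prod>i\<in>K. measure Q (Z i))"
        using C D disj by (intro prod.union_disjoint) auto
      also have "(\<Prod>i\<in>(\<lambda>i. i + n) ` J. measure Q (Z i)) = (\<Prod>i\<in>J. measure Q (X i))"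
        by (subst prod.reindex) (auto simp: ZJ inj_on_def)
      also have "\<dots> = measure ?P C" using C by (simp add: measure_cylinder[OF prob sp])
      also have "(\<Prod>i\<in>K. measure Q (Z i)) = (\<Prod>i\<in>K. measure Q (Y i))" by (simp add: ZK)
      also have "\<dots> = measure ?P D" using D by (simp add: measure_cylinder[OF prob sp])
      finally show ?case .
    qed
    then show ?thesis unfolding mixing_along_def by (rule tendsto_eventually)
  qed
  show ?thesis
  proof (rule P.mixing_along_generated[OF inf _ _ _ _ _ mix A B])
    show "Int_stable ?G" unfolding GG by (rule Int_stable_prod_algebra)
    show "sets ?P = sigma_sets (space ?P) ?G" unfolding GG sets_PiM by (simp add: space_PiM)
  qed (use prob spP in \<open>auto simp: distr_coord_shift measurable_coord_shift\<close>)
qed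

text \<open>On rectangles the correlations of a product action are products of correlations.\<close>
lemma mixing_along_pair:
  fixes \<tau>1 :: "'i \<Rightarrow> 'b \<Rightarrow> 'b" and \<tau>2 :: "'i \<Rightarrow> 'c \<Rightarrow> 'c"
  assumes prob: "prob_space P1" "prob_space P2" and inf: "infinite (UNIV :: 'i set)"
    and t1: "\<And>n. \<tau>1 n \<in> P1 \<rightarrow>\<^sub>M P1" "\<And>n. distr P1 P1 (\<tau>1 n) = P1"
    and t2: "\<And>n. \<tau>2 n \<in> P2 \<rightarrow>\<^sub>M P2" "\<And>n. distr P2 P2 (\<tau>2 n) = P2"
    and m1: "\<And>A B. A \<in> sets P1 \<Longrightarrow> B \<in> sets P1 \<Longrightarrow> mixing_along P1 \<tau>1 A B"
    and m2: "\<And>A B. A \<in> sets P2 \<Longrightarrow> B \<in> sets P2 \<Longrightarrow> mixing_along P2 \<tau>2 A B"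
    and A: "A \<in> sets (P1 \<Otimes>\<^sub>M P2)" and B: "B \<in> sets (P1 \<Otimes>\<^sub>M P2)"
  shows "mixing_along (P1 \<Otimes>\<^sub>M P2) (\<lambda>n. map_prod (\<tau>1 n) (\<tau>2 n)) A B"
    and "\<And>n. distr (P1 \<Otimes>\<^sub>M P2) (P1 \<Otimes>\<^sub>M P2) (map_prod (\<tau>1 n) (\<tau>2 n)) = P1 \<Otimes>\<^sub>M P2"
proof -
  interpret P1: prob_space P1 by fact
  interpret P2: prob_space P2 by fact
  interpret pair_prob_space P1 P2 ..
  note [measurable] = t1(1) t2(1)
  show distr: "distr (P1 \<Otimes>\<^sub>M P2) (P1 \<Otimes>\<^sub>M P2) (map_prod (\<tau>1 n) (\<tau>2 n)) = P1 \<Otimes>\<^sub>M P2" for n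
    using pair_measure_distr[OF t1(1)[of n] t2(1)[of n]] t1(2) t2(2) P2.sigma_finite_measure_axioms
    by (simp add: map_prod_def)
  let ?G = "{a \<times> b | a b. a \<in> sets P1 \<and> b \<in> sets P2}"
  show "mixing_along (P1 \<Otimes>\<^sub>M P2) (\<lambda>n. map_prod (\<tau>1 n) (\<tau>2 n)) A B"
  proof (rule mixing_along_generated[OF inf _ distr _ _ _ _ A B, where G = ?G])
    show "map_prod (\<tau>1 n) (\<tau>2 n) \<in> P1 \<Otimes>\<^sub>M P2 \<rightarrow>\<^sub>M P1 \<Otimes>\<^sub>M P2" for n
      unfolding map_prod_def by measurable
    show "Int_stable ?G" by (rule Int_stable_pair_measure_generator)
    show "?G \<subseteq> Pow (space (P1 \<Otimes>\<^sub>M P2))"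
      by (auto simp: space_pair_measure dest: sets.sets_into_space)
    show "sets (P1 \<Otimes>\<^sub>M P2) = sigma_sets (space (P1 \<Otimes>\<^sub>M P2)) ?G"
      by (simp add: sets_pair_measure space_pair_measure)
    fix C D assume "C \<in> ?G" "D \<in> ?G"
    then obtain a b a' b' where C: "C = a \<times> b" "a \<in> sets P1" "b \<in> sets P2"
      and D: "D = a' \<times> b'" "a' \<in> sets P1" "b' \<in> sets P2" by blast
    have tim: "measure (P1 \<Otimes>\<^sub>M P2) (X \<times> Y) = measure P1 X * measure P2 Y"
      if "X \<in> sets P1" "Y \<in> sets P2" for X Y
      using that by (simp add: measure_def P2.emeasure_pair_measure_Times enn2real_mult)
    have "map_prod (\<tau>1 n) (\<tau>2 n) -` C \<inter> space (P1 \<Otimes>\<^sub>M P2) \<inter> D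
        = (\<tau>1 n -` a \<inter> space P1 \<inter> a') \<times> (\<tau>2 n -` b \<inter> space P2 \<inter> b')" for n
      by (auto simp: C D space_pair_measure)
    moreover have "\<tau>1 n -` a \<inter> space P1 \<inter> a' \<in> sets P1" "\<tau>2 n -` b \<inter> space P2 \<inter> b' \<in> sets P2" for n
      using measurable_sets[OF t1(1) C(2)] measurable_sets[OF t2(1) C(3)] D by auto
    ultimately have "measure (P1 \<Otimes>\<^sub>M P2) (map_prod (\<tau>1 n) (\<tau>2 n) -` C \<inter> space (P1 \<Otimes>\<^sub>M P2) \<inter> D)
      = measure P1 (\<tau>1 n -` a \<inter> space P1 \<inter> a') * measure P2 (\<tau>2 n -` b \<inter> space P2 \<inter> b')" for n
      by (simp add: tim)
    then show "mixing_along (P1 \<Otimes>\<^sub>M P2) (\<lambda>n. map_prod (\<tau>1 n) (\<tau>2 n)) C D"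
      using tendsto_mult[OF m1[unfolded mixing_along_def, OF C(2) D(2)] m2[unfolded mixing_along_def, OF C(3) D(3)]]
      using C D by (simp add: mixing_along_def tim mult_ac)
  qed
qed

section \<open>A random site that hardly changes under translation\<close>

text \<open>Strictness makes the minimising site unique, and ties between independent uniform marks have
probability 0.\<close>
definition strict_argmin :: "'i set \<Rightarrow> ('i \<Rightarrow> real) \<Rightarrow> 'i \<Rightarrow> bool" where
  "strict_argmin W u i \<longleftrightarrow> i \<in> W \<and> (\<forall>j\<in>W - {i}. u i < u j)"

text \<open>The value 0 is a default for the null set of configurations with ties.\<close>
definition argmin :: "'i set \<Rightarrow> ('i \<Rightarrow> real) \<Rightarrow> 'i::zero" where
  "argmin W u = (if \<exists>i. strict_argmin W u i then THE i. strict_argmin W u i else 0)"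

lemma strict_argmin_unique: "strict_argmin W u i \<Longrightarrow> strict_argmin W u j \<Longrightarrow> i = j"
  unfolding strict_argmin_def by (metis DiffI insertE empty_iff less_asym)

lemma argmin_eq: "strict_argmin W u i \<Longrightarrow> argmin W u = i"
  unfolding argmin_def using strict_argmin_unique by (metis the_equality)

lemma strict_argmin_mono: "strict_argmin W u i \<Longrightarrow> V \<subseteq> W \<Longrightarrow> i \<in> V \<Longrightarrow> strict_argmin V u i"
  unfolding strict_argmin_def by auto

abbreviation uniform_marks :: "('i \<Rightarrow> real) measure" where
  "uniform_marks \<equiv> PiM UNIV (\<lambda>_. unit_uniform)"

lemma space_uniform_marks: "space uniform_marks = UNIV"
  by (simp add: space_PiM)

lemma prob_space_uniform_marks: "prob_space uniform_marks"
  by (rule prob_space_PiM) (rule prob_space_unit_uniform)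

lemma measurable_mark [measurable]: "(\<lambda>u. u i) \<in> borel_measurable uniform_marks"
  using measurable_component_singleton[of i UNIV "\<lambda>_. unit_uniform"]
  by (simp add: measurable_cong_sets[OF refl sets_unit_uniform])

lemma sets_strict_argmin [measurable]:
  assumes "finite W"
  shows "{u. strict_argmin W u i} \<in> sets uniform_marks"
proof -
  have less: "{u \<in> space uniform_marks. u i < u j} \<in> sets uniform_marks" for j
    by (rule borel_measurable_less[OF measurable_mark measurable_mark])
  have "{u \<in> space uniform_marks. \<forall>j\<in>W - {i}. u i < u j} \<in> sets uniform_marks"
    using assms less by (intro sets.sets_Collect_finite_All) auto
  then show ?thesis by (cases "i \<in> W") (simp_all add: space_uniform_marks strict_argmin_def)
qed

lemma argmin_iff:
  "argmin W u = i \<longleftrightarrow> strict_argmin W u i \<or> (i = 0 \<and> (\<nexists>k. strict_argmin W u k))"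
proof (cases "\<exists>k. strict_argmin W u k")
  case True
  then obtain k where "strict_argmin W u k" by blast
  then show ?thesis using argmin_eq strict_argmin_unique by metis
next
  case False
  then show ?thesis by (auto simp: argmin_def)
qed

lemma measurable_argmin [measurable]:
  assumes "finite (W :: 'i::{zero,countable} set)"
  shows "argmin W \<in> uniform_marks \<rightarrow>\<^sub>M count_space UNIV"
proof (subst measurable_count_space_eq2_countable, intro conjI ballI)
  show "argmin W \<in> space uniform_marks \<rightarrow> UNIV" by (rule funcsetI) (rule UNIV_I)
  fix i :: 'i
  have all: "{u. \<exists>i. strict_argmin W u i} \<in> sets uniform_marks"
  proof -
    have "{u. \<exists>i. strict_argmin W u i} = (\<Union>i. {u. strict_argmin W u i})" by auto
    also have "\<dots> \<in> sets uniform_marks"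
      by (rule sets.countable_UN''[OF countableI_type sets_strict_argmin[OF assms]])
    finally show ?thesis .
  qed
  have "argmin W -` {i} \<inter> space uniform_marks
      = {u. strict_argmin W u i} \<union> (if i = 0 then space uniform_marks - {u. \<exists>i. strict_argmin W u i} else {})"
    by (rule set_eqI) (simp add: space_uniform_marks argmin_iff)
  then show "argmin W -` {i} \<inter> space uniform_marks \<in> sets uniform_marks"
    using sets.Un[OF sets_strict_argmin[OF assms, of i] sets.compl_sets[OF all]] sets_strict_argmin[OF assms, of i]
    by (cases "i = 0") (simp_all only: if_True if_False refl Un_empty_right simp_thms)
qed

lemma AE_marks_distinct:
  fixes i j :: 'i
  assumes "i \<noteq> j"
  shows "AE u in uniform_marks. u i \<noteq> u j"
proof -
  interpret U: prob_space unit_uniform by (rule prob_space_unit_uniform)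
  interpret UU: pair_prob_space unit_uniform unit_uniform ..
  interpret P: product_prob_space "\<lambda>_. unit_uniform" "UNIV :: 'i set" ..
  have pm [measurable]: "(\<lambda>u. (u i, u j)) \<in> uniform_marks \<rightarrow>\<^sub>M unit_uniform \<Otimes>\<^sub>M unit_uniform" by measurable
  have eq: "unit_uniform \<Otimes>\<^sub>M unit_uniform = distr uniform_marks (unit_uniform \<Otimes>\<^sub>M unit_uniform) (\<lambda>u. (u i, u j))"
  proof (rule pair_measure_eqI)
    fix A B assume A: "A \<in> sets unit_uniform" "B \<in> sets unit_uniform"
    have "(\<lambda>u. (u i, u j)) -` (A \<times> B) \<inter> space uniform_marks
        = prod_emb UNIV (\<lambda>_. unit_uniform) {i, j} (Pi\<^sub>E {i, j} (\<lambda>k. if k = i then A else B))"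
      using assms by (auto simp: prod_emb_def space_PiM)
    then show "emeasure unit_uniform A * emeasure unit_uniform B
        = emeasure (distr uniform_marks (unit_uniform \<Otimes>\<^sub>M unit_uniform) (\<lambda>u. (u i, u j))) (A \<times> B)"
      using A assms by (subst emeasure_distr) (auto simp: P.emeasure_PiM_emb)
  qed (auto intro: U.sigma_finite_measure_axioms)
  have fs: "fst \<in> borel_measurable (unit_uniform \<Otimes>\<^sub>M unit_uniform)" "snd \<in> borel_measurable (unit_uniform \<Otimes>\<^sub>M unit_uniform)"
    using measurable_fst[of unit_uniform unit_uniform] measurable_snd[of unit_uniform unit_uniform]
    by (simp_all only: measurable_cong_sets[OF refl sets_unit_uniform])
  have neq: "{x \<in> space (unit_uniform \<Otimes>\<^sub>M unit_uniform). fst x \<noteq> snd x} \<in> sets (unit_uniform \<Otimes>\<^sub>M unit_uniform)"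
    by (rule borel_measurable_neq[OF fs])
  have "AE z in unit_uniform \<Otimes>\<^sub>M unit_uniform. fst z \<noteq> snd z"
  proof (rule UU.AE_pair_measure[OF neq])
    have "AE y in unit_uniform. x \<noteq> y" for x
      using unit_uniform_countable_null[of "{x}"] by auto
    then show "AE x in unit_uniform. AE y in unit_uniform. fst (x, y) \<noteq> snd (x, y)" by simp
  qed
  then have "AE z in distr uniform_marks (unit_uniform \<Otimes>\<^sub>M unit_uniform) (\<lambda>u. (u i, u j)). fst z \<noteq> snd z"
    by (simp only: eq[symmetric])
  then show ?thesis by (subst (asm) AE_distr_iff[OF pm neq]) simp
qed

text \<open>The law of the marks is invariant under transpositions of sites, so all sites of \<open>W\<close> are
equally likely to carry the smallest mark.\<close>
lemma prob_strict_argmin: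
  fixes W :: "'i::countable set"
  assumes W: "finite W" "i \<in> W"
  shows "measure uniform_marks {u. strict_argmin W u i} = 1 / card W"
proof -
  interpret P: prob_space "uniform_marks :: ('i \<Rightarrow> real) measure" by (rule prob_space_uniform_marks)
  let ?P = "uniform_marks :: ('i \<Rightarrow> real) measure"
  have eq: "measure ?P {u. strict_argmin W u k} = measure ?P {u. strict_argmin W u i}" if k: "k \<in> W" for k
  proof -
    let ?f = "Transposition.transpose i k"
    have inj: "inj ?f" by (rule bij_is_inj) simp
    note perm = distr_PiM_permute[OF prob_space_unit_uniform inj]
    have "strict_argmin W (\<lambda>l. u (?f l)) i \<longleftrightarrow> strict_argmin W u k" for u :: "'i \<Rightarrow> real"
    proof -
      have "?f ` (W - {i}) = W - {k}"
        using W k by (auto simp: Transposition.transpose_def image_iff)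
      moreover have "(\<forall>j\<in>?f ` (W - {i}). u k < u j) \<longleftrightarrow> (\<forall>j\<in>W - {i}. u k < u (?f j))"
        by blast
      ultimately have "(\<forall>j\<in>W - {k}. u k < u j) \<longleftrightarrow> (\<forall>j\<in>W - {i}. u k < u (?f j))"
        by simp
      then show ?thesis using W k by (simp add: strict_argmin_def)
    qed
    then have "(\<lambda>\<omega> l. \<omega> (?f l)) -` {u. strict_argmin W u i} \<inter> space ?P = {u. strict_argmin W u k}"
      by (auto simp: space_uniform_marks)
    then show ?thesis
      using measure_distr[OF perm(1) sets_strict_argmin[OF W(1)], of i] perm(2) by simp
  qed
  have "AE u in ?P. \<forall>k\<in>W. \<forall>l\<in>W. k \<noteq> l \<longrightarrow> u k \<noteq> u l"
    using W(1) AE_marks_distinct by (auto intro!: AE_finite_allI)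
  then have "AE u in ?P. u \<in> (\<Union>k\<in>W. {u. strict_argmin W u k})"
  proof eventually_elim
    case (elim u)
    obtain k where k: "k \<in> W" "\<forall>l\<in>W. u k \<le> u l"
      using arg_min_if_finite(1)[of W u] arg_min_least[of W _ u] W by blast
    then have "strict_argmin W u k"
      using elim unfolding strict_argmin_def by (force simp: less_le)
    then show ?case using k by auto
  qed
  then have "measure ?P (\<Union>k\<in>W. {u. strict_argmin W u k}) = 1"
    using W by (intro P.prob_eq_1[THEN iffD2] sets.finite_UN) auto
  also have "measure ?P (\<Union>k\<in>W. {u. strict_argmin W u k}) = (\<Sum>k\<in>W. measure ?P {u. strict_argmin W u k})"
    using W by (intro P.finite_measure_finite_Union)
      (auto simp: disjoint_family_on_def dest: strict_argmin_unique)
  also have "\<dots> = card W * measure ?P {u. strict_argmin W u i}"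
    by (simp add: eq)
  finally show ?thesis using W by (metis nonzero_mult_div_cancel_left div_by_0 mult_zero_left zero_neq_one)
qed

lemma prob_argmin_in:
  fixes W :: "'i::countable set"
  assumes W: "finite W" "W \<noteq> {}" "V \<subseteq> W"
  shows "measure uniform_marks {u. \<exists>i\<in>V. strict_argmin W u i} = card V / card W"
proof -
  interpret P: prob_space "uniform_marks :: ('i \<Rightarrow> real) measure" by (rule prob_space_uniform_marks)
  let ?P = "uniform_marks :: ('i \<Rightarrow> real) measure"
  have fV: "finite V" using W finite_subset by blast
  have "{u. \<exists>i\<in>V. strict_argmin W u i} = (\<Union>k\<in>V. {u. strict_argmin W u k})" by auto
  then have "measure ?P {u. \<exists>i\<in>V. strict_argmin W u i} = (\<Sum>k\<in>V. measure ?P {u. strict_argmin W u k})"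
    using W fV by (simp, intro P.finite_measure_finite_Union)
      (auto simp: disjoint_family_on_def dest: strict_argmin_unique)
  also have "\<dots> = (\<Sum>k\<in>V. 1 / card W)"
    using W by (intro sum.cong prob_strict_argmin) auto
  finally show ?thesis by simp
qed

text \<open>If the smallest mark of a box and its translate together lies in their intersection, then
it is the smallest mark in each of them, and both boxes select the same site.\<close>
lemma argmin_coord_shift:
  assumes "strict_argmin (V \<union> (\<lambda>i. i + n) ` V) u i" "i \<in> V" "i \<in> (\<lambda>i. i + n) ` V"
  shows "argmin V u = i" "argmin V (coord_shift n u) = i - n"
proof -
  show "argmin V u = i" using strict_argmin_mono[OF assms(1) _ assms(2)] by (intro argmin_eq) auto
  have "strict_argmin ((\<lambda>i. i + n) ` V) u i" using strict_argmin_mono[OF assms(1) _ assms(3)] by auto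
  then have "strict_argmin V (coord_shift n u) (i - n)"
    unfolding strict_argmin_def coord_shift_def by force
  then show "argmin V (coord_shift n u) = i - n" by (rule argmin_eq)
qed

definition integer_box :: "nat \<Rightarrow> (int ^ 'd::finite) set" where
  "integer_box R = {i. \<forall>k. i $ k \<in> {0..<int R}}"

lemma card_vec_box:
  fixes A :: "'d::finite \<Rightarrow> 'b set"
  assumes "\<And>k. finite (A k)"
  shows "finite {i::'b^'d. \<forall>k. i $ k \<in> A k}" "card {i::'b^'d. \<forall>k. i $ k \<in> A k} = (\<Prod>k\<in>UNIV. card (A k))"
proof -
  have b: "bij_betw vec_nth {i::'b^'d. \<forall>k. i $ k \<in> A k} (Pi\<^sub>E UNIV A)"
    by (rule bij_betwI[of _ _ _ vec_lambda]) (auto simp: vec_lambda_inverse)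
  show "finite {i::'b^'d. \<forall>k. i $ k \<in> A k}"
    using bij_betw_finite[OF b] assms by (simp add: finite_PiE)
  show "card {i::'b^'d. \<forall>k. i $ k \<in> A k} = (\<Prod>k\<in>UNIV. card (A k))"
    using bij_betw_same_card[OF b] by (simp add: card_PiE)
qed

text \<open>A cube loses only a small proportion of its points when it is intersected with a
translate by a fixed vector.\<close>
lemma integer_box_Folner:
  fixes F :: "(int ^ 'd::finite) set"
  assumes "finite F" "\<epsilon> > 0"
  obtains V :: "(int ^ 'd) set" where "finite V" "V \<noteq> {}"
    "\<And>n. n \<in> F \<Longrightarrow>
      1 - \<epsilon> < card (V \<inter> (\<lambda>i. i + n) ` V) / card (V \<union> (\<lambda>i. i + n) ` V)"
proof -
  have lim: "(\<lambda>R. real (card ((integer_box R :: (int^'d) set) \<inter> (\<lambda>i. i + n) ` integer_box R))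
      / real (card ((integer_box R :: (int^'d) set) \<union> (\<lambda>i. i + n) ` integer_box R))) \<longlonglongrightarrow> 1" for n :: "int^'d"
  proof -
    let ?V = "integer_box :: nat \<Rightarrow> (int^'d) set"
    have fin: "finite (?V R)" for R unfolding integer_box_def by (rule card_vec_box) auto
    have cV: "real (card (?V R)) = real R ^ CARD('d)" for R
      unfolding integer_box_def by (subst card_vec_box) auto
    have cI: "real (card (?V R \<inter> (\<lambda>i. i + n) ` ?V R)) = (\<Prod>k\<in>UNIV. max 0 (real R - \<bar>real_of_int (n $ k)\<bar>))" for R
    proof -
      have "?V R \<inter> (\<lambda>i. i + n) ` ?V R = {i. \<forall>k. i $ k \<in> {max 0 (n $ k)..<min (int R) (int R + n $ k)}}"
      proof (intro equalityI subsetI)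
        fix i assume "i \<in> {i. \<forall>k. i $ k \<in> {max 0 (n $ k)..<min (int R) (int R + n $ k)}}"
        then have i: "max 0 (n $ k) \<le> i $ k" "i $ k < min (int R) (int R + n $ k)" for k by auto
        then have "i \<in> ?V R" "i - n \<in> ?V R" unfolding integer_box_def by (auto simp: less_diff_eq diff_less_eq add.commute)
        then show "i \<in> ?V R \<inter> (\<lambda>i. i + n) ` ?V R" by (auto intro!: image_eqI[of _ _ "i - n"])
      qed (auto simp: integer_box_def)
      then have "card (?V R \<inter> (\<lambda>i. i + n) ` ?V R) = (\<Prod>k\<in>UNIV. card {max 0 (n $ k)..<min (int R) (int R + n $ k)})"
        using card_vec_box(2)[of "\<lambda>k. {max 0 (n $ k)..<min (int R) (int R + n $ k)}"] by simp
      then show ?thesis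
        by (simp only: of_nat_prod) (intro prod.cong refl; auto simp: max_def min_def)
    qed
    have "(\<lambda>R. (\<Prod>k\<in>UNIV. max 0 (real R - \<bar>real_of_int (n $ k)\<bar>) / real R)) \<longlonglongrightarrow> (\<Prod>k\<in>(UNIV::'d set). 1)"
    proof (rule tendsto_prod)
      fix k
      have "((\<lambda>R. 1 - \<bar>real_of_int (n $ k)\<bar> / real R) \<longlongrightarrow> 1 - 0) sequentially"
        by (intro tendsto_diff tendsto_const lim_const_over_n)
      then have "(\<lambda>R. 1 - \<bar>real_of_int (n $ k)\<bar> / real R) \<longlonglongrightarrow> 1" by simp
      moreover have "\<forall>\<^sub>F R in sequentially. 1 - \<bar>real_of_int (n $ k)\<bar> / real R = max 0 (real R - \<bar>real_of_int (n $ k)\<bar>) / real R"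
        using eventually_ge_at_top[of "nat \<bar>n $ k\<bar> + 1"]
        by eventually_elim (auto simp: max_def field_simps)
      ultimately show "(\<lambda>R. max 0 (real R - \<bar>real_of_int (n $ k)\<bar>) / real R) \<longlonglongrightarrow> 1"
        by (rule Lim_transform_eventually)
    qed
    then have rI: "(\<lambda>R. card (?V R \<inter> (\<lambda>i. i + n) ` ?V R) / card (?V R)) \<longlonglongrightarrow> 1"
      by (simp add: cI cV prod_dividef)
    have "(\<lambda>R. (card (?V R \<inter> (\<lambda>i. i + n) ` ?V R) / card (?V R)) /
        (2 - card (?V R \<inter> (\<lambda>i. i + n) ` ?V R) / card (?V R))) \<longlonglongrightarrow> 1 / (2 - 1)"
      by (intro tendsto_divide tendsto_diff tendsto_const rI) simp
    moreover have "\<forall>\<^sub>F R in sequentially. (card (?V R \<inter> (\<lambda>i. i + n) ` ?V R) / card (?V R)) /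
        (2 - card (?V R \<inter> (\<lambda>i. i + n) ` ?V R) / card (?V R))
        = card (?V R \<inter> (\<lambda>i. i + n) ` ?V R) / card (?V R \<union> (\<lambda>i. i + n) ` ?V R)"
      using eventually_gt_at_top[of 0]
    proof eventually_elim
      case (elim R)
      have pos: "0 < real (card (?V R))" using elim by (simp add: cV)
      have "card ((\<lambda>i. i + n) ` ?V R) = card (?V R)" by (rule card_image) (simp add: inj_on_def)
      then have "real (card (?V R \<union> (\<lambda>i. i + n) ` ?V R)) + card (?V R \<inter> (\<lambda>i. i + n) ` ?V R) = 2 * card (?V R)"
        using card_Un_Int[OF fin[of R] finite_imageI[OF fin[of R]], of "\<lambda>i. i + n"] by linarith
      then have "2 - card (?V R \<inter> (\<lambda>i. i + n) ` ?V R) / card (?V R)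
         = card (?V R \<union> (\<lambda>i. i + n) ` ?V R) / card (?V R)"
        using pos by (simp add: field_simps)
      then show ?case using pos by simp
    qed
    ultimately show ?thesis using Lim_transform_eventually by fastforce
  qed
  have "\<forall>\<^sub>F R in sequentially. \<forall>n\<in>F. 1 - \<epsilon> < card (integer_box R \<inter> (\<lambda>i. i + n) ` integer_box R) /
        card ((integer_box R :: (int^'d) set) \<union> (\<lambda>i. i + n) ` integer_box R)"
    using assms by (intro eventually_ball_finite ballI order_tendstoD(1)[OF lim]) auto
  with eventually_gt_at_top[of 0]
  have "\<forall>\<^sub>F R in sequentially. 0 < R \<and> (\<forall>n\<in>F. 1 - \<epsilon> < card (integer_box R \<inter> (\<lambda>i. i + n) ` integer_box R) /
        card ((integer_box R :: (int^'d) set) \<union> (\<lambda>i. i + n) ` integer_box R))"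
    by eventually_elim auto
  then obtain R where R: "0 < R" "\<forall>n\<in>F. 1 - \<epsilon> < card (integer_box R \<inter> (\<lambda>i. i + n) ` integer_box R) /
        card ((integer_box R :: (int^'d) set) \<union> (\<lambda>i. i + n) ` integer_box R)"
    using eventually_happens'[OF sequentially_bot] by blast
  show ?thesis
  proof (rule that[of "integer_box R"])
    show "finite (integer_box R :: (int^'d) set)" unfolding integer_box_def by (rule card_vec_box) auto
    have "0 \<in> (integer_box R :: (int^'d) set)" using R by (simp add: integer_box_def)
    then show "(integer_box R :: (int^'d) set) \<noteq> {}" by blast
  qed (use R in auto)
qed

section \<open>Approximating an action by a Bernoulli shift\<close>

context
  fixes N :: "'a::polish_space measure" and T :: "int ^ 'd::finite \<Rightarrow> 'a \<Rightarrow> 'a"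
  assumes prob: "prob_space N" and setsN: "sets N = sets borel"
    and T_meas: "\<And>n. T n \<in> N \<rightarrow>\<^sub>M N" and T_distr: "\<And>n. distr N N (T n) = N"
    and T_add: "\<And>m n. AE x in N. T m (T n x) = T (m + n) x"
begin

interpretation N: prob_space N by (rule prob)

text \<open>The state space of the Bernoulli shift: at every site an independent point of the space and
an independent uniform mark. Points and marks are kept in two factors, so that
independence of the selected site from the points is Fubini's theorem.\<close>
definition scenery :: "((int ^ 'd \<Rightarrow> 'a) \<times> (int ^ 'd \<Rightarrow> real)) measure" where
  "scenery = PiM UNIV (\<lambda>_. N) \<Otimes>\<^sub>M uniform_marks"

definition scenery_shift :: "int ^ 'd \<Rightarrow> (int ^ 'd \<Rightarrow> 'a) \<times> (int ^ 'd \<Rightarrow> real) \<Rightarrow> (int ^ 'd \<Rightarrow> 'a) \<times> (int ^ 'd \<Rightarrow> real)" where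
  "scenery_shift n = map_prod (coord_shift n) (coord_shift n)"

text \<open>The point at the selected site is moved back along \<open>T\<close>, so that selecting the same site from
a translated position changes the value by \<open>T\<close> itself.\<close>
definition factor :: "(int ^ 'd) set \<Rightarrow> (int ^ 'd \<Rightarrow> 'a) \<times> (int ^ 'd \<Rightarrow> real) \<Rightarrow> 'a" where
  "factor V = (\<lambda>(x, u). T (- argmin V u) (x (argmin V u)))"

lemma spaceN: "space N = UNIV"
  using sets_eq_imp_space_eq[OF setsN] by simp

interpretation X: prob_space "PiM (UNIV :: (int^'d) set) (\<lambda>_. N)"
  by (rule prob_space_PiM) (rule prob)

interpretation U: prob_space "uniform_marks :: ((int^'d) \<Rightarrow> real) measure"
  by (rule prob_space_uniform_marks)

interpretation XU: pair_prob_space "PiM (UNIV :: (int^'d) set) (\<lambda>_. N)" "uniform_marks :: ((int^'d) \<Rightarrow> real) measure" ..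

lemma prob_space_scenery: "prob_space scenery"
  unfolding scenery_def by (rule XU.prob_space_axioms)

lemma space_scenery: "space scenery = UNIV"
  by (simp add: scenery_def space_pair_measure space_PiM spaceN)

lemma sets_scenery: "sets scenery = sets borel"
proof -
  have "sets (PiM (UNIV :: (int^'d) set) (\<lambda>_. N)) = sets (PiM (UNIV :: (int^'d) set) (\<lambda>_. borel :: 'a measure))"
    by (rule sets_PiM_cong) (simp_all add: setsN)
  then have 1: "sets (PiM (UNIV :: (int^'d) set) (\<lambda>_. N)) = sets borel"
    using sets_PiM_equal_borel[where ?'a = "int^'d" and ?'b = 'a] by simp
  have "sets (uniform_marks :: ((int^'d) \<Rightarrow> real) measure) = sets (PiM (UNIV :: (int^'d) set) (\<lambda>_. borel :: real measure))"
    by (rule sets_PiM_cong) simp_all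
  then have 2: "sets (uniform_marks :: ((int^'d) \<Rightarrow> real) measure) = sets borel"
    using sets_PiM_equal_borel[where ?'a = "int^'d" and ?'b = real] by simp
  show ?thesis
    unfolding scenery_def sets_pair_measure_cong[OF 1 2]
    by (subst borel_prod) (rule refl)
qed

lemma scenery_points_null:
  assumes "\<And>x. emeasure N {x} = 0"
  shows "emeasure scenery {\<omega>} = 0"
proof -
  interpret PP: product_prob_space "\<lambda>_. N" "UNIV :: (int^'d) set" ..
  let ?A = "{x \<in> space (PiM UNIV (\<lambda>_. N)). x (0::int^'d) \<in> {fst \<omega> 0}}"
  have A: "?A \<in> sets (PiM UNIV (\<lambda>_. N))"
    using measurable_sets[OF measurable_component_singleton[of 0 UNIV "\<lambda>_. N"], of "{fst \<omega> 0}"]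
    by (simp add: setsN vimage_def Int_def conj_commute)
  have "emeasure scenery {\<omega>} \<le> emeasure scenery (?A \<times> space uniform_marks)"
    unfolding scenery_def
    by (intro emeasure_mono pair_measureI A sets.top)
       (simp add: mem_Times_iff space_PiM spaceN)
  also have "\<dots> = emeasure (PiM UNIV (\<lambda>_. N)) ?A * emeasure uniform_marks (space (uniform_marks :: ((int^'d) \<Rightarrow> real) measure))"
    unfolding scenery_def using A by (intro U.emeasure_pair_measure_Times) auto
  also have "emeasure (PiM UNIV (\<lambda>_. N)) ?A = emeasure N {fst \<omega> 0}"
    by (rule PP.emeasure_PiM_Collect_single) (auto simp: setsN)
  finally show ?thesis using assms by simp
qed

lemma scenery_shift_measurable: "scenery_shift n \<in> scenery \<rightarrow>\<^sub>M scenery"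
proof -
  note [measurable] = measurable_coord_shift[OF prob] measurable_coord_shift[OF prob_space_unit_uniform]
  show ?thesis unfolding scenery_shift_def scenery_def map_prod_def by measurable
qed

lemma infinite_int_vec: "infinite (UNIV :: (int ^ 'd) set)"
proof
  assume "finite (UNIV :: (int ^ 'd) set)"
  then have "finite (range (\<lambda>k::int. (vec k :: int ^ 'd)))" by (rule finite_subset[rotated]) simp
  moreover have "inj (\<lambda>k::int. (vec k :: int ^ 'd))" by (simp add: inj_def vec_eq_iff)
  ultimately show False using finite_imageD infinite_UNIV_int by blast
qed

lemma scenery_mixing:
  assumes "A \<in> sets scenery" "B \<in> sets scenery"
  shows "mixing_along scenery scenery_shift A B"
    and "distr scenery scenery (scenery_shift n) = scenery"
proof -
  note pair = mixing_along_pair[OF X.prob_space_axioms U.prob_space_axioms infinite_int_vec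
    measurable_coord_shift[OF prob] distr_coord_shift[OF prob]
    measurable_coord_shift[OF prob_space_unit_uniform] distr_coord_shift[OF prob_space_unit_uniform]]
  have m1: "mixing_along (PiM (UNIV :: (int^'d) set) (\<lambda>_. N)) coord_shift A B"
    if "A \<in> sets (PiM UNIV (\<lambda>_. N))" "B \<in> sets (PiM UNIV (\<lambda>_. N))" for A B
    by (rule mixing_bernoulli_shift[OF prob spaceN infinite_int_vec that])
  have m2: "mixing_along (uniform_marks :: ((int^'d) \<Rightarrow> real) measure) coord_shift A B"
    if "A \<in> sets uniform_marks" "B \<in> sets uniform_marks" for A B
    by (rule mixing_bernoulli_shift[OF prob_space_unit_uniform space_unit_uniform infinite_int_vec that])
  show "mixing_along scenery scenery_shift A B"
    unfolding scenery_def scenery_shift_def[abs_def]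
    by (rule pair(1)[OF m1 m2 assms[unfolded scenery_def]])
  show "distr scenery scenery (scenery_shift n) = scenery"
    unfolding scenery_def scenery_shift_def
    by (rule pair(2)[OF m1 m2 assms[unfolded scenery_def]])
qed

lemma scenery_shift_distr: "distr scenery scenery (scenery_shift n) = scenery"
  using scenery_mixing(2)[of "{}" "{}"] by simp

lemma factor_measurable:
  assumes "finite V"
  shows "factor V \<in> scenery \<rightarrow>\<^sub>M N"
proof -
  have c: "(\<lambda>\<omega>. argmin V (snd \<omega>)) \<in> scenery \<rightarrow>\<^sub>M count_space UNIV"
    unfolding scenery_def using measurable_argmin[OF assms] by measurable
  note [measurable] = T_meas
  have "(\<lambda>\<omega>. T (- i) (fst \<omega> i)) \<in> scenery \<rightarrow>\<^sub>M N" for i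
    unfolding scenery_def by measurable
  from measurable_compose_countable[OF this c] show ?thesis
    by (simp add: factor_def case_prod_beta)
qed

text \<open>Given the marks, the selected site is fixed, and \<open>T\<close> preserves the law of the point there.\<close>
lemma distr_factor:
  assumes V: "finite V"
  shows "distr scenery N (factor V) = N"
proof (rule measure_eqI)
  interpret PP: product_prob_space "\<lambda>_. N" "UNIV :: (int^'d) set" ..
  fix A assume "A \<in> sets (distr scenery N (factor V))"
  then have A: "A \<in> sets N" by simp
  let ?X = "PiM (UNIV :: (int^'d) set) (\<lambda>_. N)"
  let ?Q = "factor V -` A \<inter> space scenery"
  have Q: "?Q \<in> sets (?X \<Otimes>\<^sub>M uniform_marks)"
    using measurable_sets[OF factor_measurable[OF V] A] by (simp add: scenery_def)
  have "emeasure ?X ((\<lambda>x. (x, u)) -` ?Q) = emeasure N A" for u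
  proof -
    let ?c = "argmin V u"
    have TA: "T (- ?c) -` A \<inter> space N \<in> sets N" using T_meas A by (rule measurable_sets)
    have "(\<lambda>x. (x, u)) -` ?Q = {x \<in> space ?X. x ?c \<in> T (- ?c) -` A \<inter> space N}"
      by (auto simp: factor_def space_scenery space_PiM spaceN)
    then have "emeasure ?X ((\<lambda>x. (x, u)) -` ?Q) = emeasure N (T (- ?c) -` A \<inter> space N)"
      using PP.emeasure_PiM_Collect_single[OF _ TA] by simp
    then show ?thesis using emeasure_distr[OF T_meas A, of "- ?c"] T_distr by simp
  qed
  then have "emeasure scenery ?Q = emeasure N A"
    unfolding scenery_def XU.emeasure_pair_measure_alt2[OF Q[unfolded scenery_def]]
    by (simp add: U.emeasure_space_1)
  then show "emeasure (distr scenery N (factor V)) A = emeasure N A"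
    using factor_measurable[OF V] A by (simp add: emeasure_distr)
qed simp

text \<open>If box and translated box select the same site, equivariance is the
action law, which holds almost everywhere at every site simultaneously.\<close>
lemma factor_almost_equivariant:
  assumes V: "finite V" "V \<noteq> {}"
  shows "measure scenery {\<omega>. factor V (scenery_shift n \<omega>) \<noteq> T n (factor V \<omega>)}
     \<le> 1 - card (V \<inter> (\<lambda>i. i + n) ` V) / card (V \<union> (\<lambda>i. i + n) ` V)"
proof -
  interpret S: prob_space scenery by (rule prob_space_scenery)
  let ?X = "PiM (UNIV :: (int^'d) set) (\<lambda>_. N)"
  let ?W = "V \<union> (\<lambda>i. i + n) ` V" and ?I = "V \<inter> (\<lambda>i. i + n) ` V"
  let ?G = "{u. \<exists>i\<in>?I. strict_argmin ?W u i}"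
  have G: "?G \<in> sets uniform_marks"
  proof -
    have "?G = (\<Union>i\<in>?I. {u. strict_argmin ?W u i})" by auto
    also have "\<dots> \<in> sets uniform_marks"
      using V by (intro sets.finite_UN sets_strict_argmin) auto
    finally show ?thesis .
  qed
  have "AE x in ?X. T n (T (- i) (x i)) = T (n - i) (x i)" for i
    using AE_PiM_component[of UNIV "\<lambda>_. N" i, OF prob UNIV_I T_add[of n "- i"]] by simp
  then have "AE x in ?X. \<forall>i. T n (T (- i) (x i)) = T (n - i) (x i)"
    by (simp add: AE_all_countable)
  then obtain Z where Z: "Z \<in> null_sets ?X" "{x \<in> space ?X. \<not> (\<forall>i. T n (T (- i) (x i)) = T (n - i) (x i))} \<subseteq> Z"
    by (auto simp: eventually_ae_filter)
  have good: "factor V (scenery_shift n \<omega>) = T n (factor V \<omega>)"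
    if "fst \<omega> \<notin> Z" "snd \<omega> \<in> ?G" for \<omega>
  proof -
    obtain x u where \<omega>: "\<omega> = (x, u)" by fastforce
    from that \<omega> obtain i where i: "i \<in> V" "i \<in> (\<lambda>i. i + n) ` V" "strict_argmin ?W u i" by auto
    have "T n (T (- i) (x i)) = T (n - i) (x i)"
      using that Z(2) by (auto simp: \<omega> space_PiM spaceN)
    then show ?thesis
      using argmin_coord_shift[OF i(3,1,2)]
      by (simp add: \<omega> factor_def scenery_shift_def) (simp add: coord_shift_def)
  qed
  let ?B = "Z \<times> UNIV \<union> UNIV \<times> (- ?G)"
  have UX: "UNIV = space ?X" and UU: "UNIV = space (uniform_marks :: ((int^'d) \<Rightarrow> real) measure)"
    by (simp_all add: space_PiM spaceN)
  have UE: "UNIV \<in> sets (uniform_marks :: ((int^'d) \<Rightarrow> real) measure)" using sets.top[of "uniform_marks :: ((int^'d) \<Rightarrow> real) measure"] UU by simp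
  have ZX: "Z \<in> sets ?X" "emeasure ?X Z = 0" using Z(1) by auto
  have m1: "Z \<times> UNIV \<in> sets scenery" "emeasure scenery (Z \<times> UNIV) = 0"
    unfolding scenery_def
    by (rule pair_measureI[OF ZX(1) UE]) (simp only: U.emeasure_pair_measure_Times[OF ZX(1) UE] ZX(2) mult_zero_left)
  have cG: "- ?G \<in> sets uniform_marks" using sets.compl_sets[OF G] UU by (simp add: Compl_eq_Diff_UNIV)
  have m2: "UNIV \<times> (- ?G) \<in> sets scenery" "measure scenery (UNIV \<times> (- ?G)) = measure uniform_marks (- ?G)"
  proof -
    have XE: "UNIV \<in> sets ?X" using sets.top[of ?X] UX by simp
    show "UNIV \<times> (- ?G) \<in> sets scenery" unfolding scenery_def by (rule pair_measureI[OF XE cG])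
    have "emeasure scenery (UNIV \<times> (- ?G)) = emeasure ?X UNIV * emeasure uniform_marks (- ?G)"
      unfolding scenery_def by (rule U.emeasure_pair_measure_Times[OF XE cG])
    then show "measure scenery (UNIV \<times> (- ?G)) = measure uniform_marks (- ?G)"
      using X.emeasure_space_1 UX by (simp add: measure_def)
  qed
  have "measure scenery {\<omega>. factor V (scenery_shift n \<omega>) \<noteq> T n (factor V \<omega>)} \<le> measure scenery ?B"
  proof (rule S.finite_measure_mono[OF _ sets.Un[OF m1(1) m2(1)]], rule subsetI, rule ccontr)
    fix \<omega> assume \<omega>: "\<omega> \<in> {\<omega>. factor V (scenery_shift n \<omega>) \<noteq> T n (factor V \<omega>)}" "\<omega> \<notin> ?B"
    then have "fst \<omega> \<notin> Z" "snd \<omega> \<in> ?G" by (simp_all add: mem_Times_iff)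
    from good[OF this] \<omega>(1) show False by simp
  qed
  also have "\<dots> \<le> measure scenery (Z \<times> UNIV) + measure scenery (UNIV \<times> (- ?G))"
    by (rule measure_Un_le[OF m1(1) m2(1)])
  also have "\<dots> = measure uniform_marks (- ?G)" using m1(2) m2(2) by (simp add: measure_def)
  also have "\<dots> = 1 - measure uniform_marks ?G"
    using U.prob_compl[OF G] UU by (simp add: Compl_eq_Diff_UNIV)
  also have "measure uniform_marks ?G = card ?I / card ?W"
    using V by (intro prob_argmin_in) auto
  finally show ?thesis by simp
qed

text \<open>The maps \<open>T n\<close> obey the action law almost everywhere, as Borel versions of an
action do; the constructed \<open>S\<close> is an action at every point. The last conclusion says that, off a small set, passing from \<open>x\<close> to
\<open>S n x\<close> looks like an application of \<open>T n\<close> as far as the index \<open>k\<close> can tell.\<close>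
lemma bernoulli_approximation:
  fixes k :: "'a \<Rightarrow> nat"
  assumes points: "\<And>x. emeasure N {x} = 0" and k: "k \<in> N \<rightarrow>\<^sub>M count_space UNIV"
    and F: "finite F" "\<epsilon> > 0"
  obtains S :: "int ^ 'd \<Rightarrow> 'a \<Rightarrow> 'a" where "S \<in> mp_actions N"
    "\<And>A B. A \<in> sets N \<Longrightarrow> B \<in> sets N \<Longrightarrow> mixing_along N S A B"
    "\<And>n. n \<in> F \<Longrightarrow> \<exists>B\<in>sets N. measure N B < \<epsilon> \<and>
        (AE x in N. x \<notin> B \<longrightarrow> (\<exists>y. k y = k x \<and> k (S n x) = k (T n y)))"
proof -
  interpret S: prob_space scenery by (rule prob_space_scenery)
  obtain V :: "(int ^ 'd) set" where V: "finite V" "V \<noteq> {}"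
    and VF: "\<And>n. n \<in> F \<Longrightarrow> 1 - \<epsilon> < card (V \<inter> (\<lambda>i. i + n) ` V) / card (V \<union> (\<lambda>i. i + n) ` V)"
    using integer_box_Folner[OF F] by blast
  define \<Phi> where "\<Phi> = factor V"
  have \<Phi>[measurable]: "\<Phi> \<in> scenery \<rightarrow>\<^sub>M N" unfolding \<Phi>_def by (rule factor_measurable[OF V(1)])
  have law: "distr N (count_space UNIV) k = distr scenery (count_space UNIV) (\<lambda>\<omega>. k (\<Phi> \<omega>))"
    using distr_distr[OF k \<Phi>] distr_factor[OF V(1)] by (simp add: \<Phi>_def o_def)
  obtain \<psi> \<phi> where \<psi>: "\<psi> \<in> N \<rightarrow>\<^sub>M scenery" and \<phi>: "\<phi> \<in> scenery \<rightarrow>\<^sub>M N"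
    and D\<psi>: "distr N scenery \<psi> = scenery" and D\<phi>: "distr scenery N \<phi> = N"
    and \<phi>\<psi>: "AE x in N. \<phi> (\<psi> x) = x" and \<psi>\<phi>: "AE \<omega> in scenery. \<psi> (\<phi> \<omega>) = \<omega>"
    and k\<psi>: "AE x in N. k (\<Phi> (\<psi> x)) = k x" and k\<phi>: "AE \<omega> in scenery. k (\<phi> \<omega>) = k (\<Phi> \<omega>)"
    by (rule standard_probability_iso_over[OF prob setsN points prob_space_scenery sets_scenery
          scenery_points_null[OF points] k measurable_compose[OF \<Phi> k] law])
  let ?s = scenery_shift
  have add: "?s m (?s n \<omega>) = ?s (m + n) \<omega>" and zero: "?s 0 \<omega> = \<omega>" for m n \<omega>
    by (cases \<omega>, simp add: scenery_shift_def coord_shift_coord_shift)+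
  have tr: "AE x in Q. P (f x)" if "AE u in R. P u" "distr Q R f = R" "f \<in> Q \<rightarrow>\<^sub>M R"
    for Q :: "'x measure" and R :: "'y measure" and f P
    by (rule AE_distrD[OF that(3)]) (unfold that(2), rule that(1))
  note [measurable] = \<psi> \<phi> scenery_shift_measurable
  \<comment> \<open>On this invariant set of full measure the two maps are inverse to each other along whole orbits; off its preimage, \<open>S\<close> is put equal to the identity.\<close>
  define G where "G = {\<omega>. \<forall>n. \<psi> (\<phi> (?s n \<omega>)) = ?s n \<omega>}"
  define Y where "Y = {x. \<phi> (\<psi> x) = x \<and> \<psi> x \<in> G}"
  define S where "S n x = (if x \<in> Y then \<phi> (?s n (\<psi> x)) else x)" for n x
  have AEG: "AE \<omega> in scenery. \<omega> \<in> G"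
    unfolding G_def using tr[OF \<psi>\<phi> scenery_shift_distr scenery_shift_measurable] by (simp add: AE_all_countable)
  have AEY: "AE x in N. x \<in> Y"
    using tr[OF AEG D\<psi> \<psi>] \<phi>\<psi> by eventually_elim (simp add: Y_def)
  have Gs: "?s n \<omega> \<in> G" if "\<omega> \<in> G" for n \<omega>
    using that unfolding G_def by (simp add: add)
  have YS: "\<psi> (S n x) = ?s n (\<psi> x)" "S n x \<in> Y" if "x \<in> Y" for n x
  proof -
    have g: "\<psi> x \<in> G" using that by (simp add: Y_def)
    show 1: "\<psi> (S n x) = ?s n (\<psi> x)" using that g by (simp add: S_def G_def)
    show "S n x \<in> Y" unfolding Y_def using that 1 Gs[OF g, of n] by (simp add: S_def)
  qed
  have Gm: "G \<in> sets scenery"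
  proof -
    have c: "\<psi> \<in> borel_measurable N" "\<phi> \<in> scenery \<rightarrow>\<^sub>M N" "?s n \<in> borel_measurable scenery" for n
      using \<psi> \<phi> scenery_shift_measurable by (simp_all add: measurable_cong_sets[OF refl sets_scenery[symmetric]])
    have "{\<omega> \<in> space scenery. \<psi> (\<phi> (?s n \<omega>)) = ?s n \<omega>} \<in> sets scenery" for n
      by (rule measurable_equality_set[OF measurable_compose[OF measurable_compose[OF scenery_shift_measurable c(2)] c(1)] c(3)])
    then have "{\<omega> \<in> space scenery. \<forall>n. \<psi> (\<phi> (?s n \<omega>)) = ?s n \<omega>} \<in> sets scenery"
      by (rule sets.sets_Collect_countable_All)
    then show ?thesis by (simp add: G_def space_scenery)
  qed
  have Ym: "Y \<in> sets N"
  proof -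
    have "(\<lambda>x. \<phi> (\<psi> x)) \<in> borel_measurable N" "(\<lambda>x. x) \<in> borel_measurable N"
      using measurable_compose[OF \<psi> \<phi>] measurable_ident[of N]
      by (simp_all add: measurable_cong_sets[OF refl setsN[symmetric]] id_def)
    then have "{x \<in> space N. \<phi> (\<psi> x) = x} \<in> sets N" by (rule measurable_equality_set)
    moreover have "\<psi> -` G \<inter> space N \<in> sets N" using \<psi> Gm by (rule measurable_sets)
    moreover have "Y = {x \<in> space N. \<phi> (\<psi> x) = x} \<inter> (\<psi> -` G \<inter> space N)" by (auto simp: Y_def spaceN)
    ultimately show ?thesis by auto
  qed
  have Sae: "AE x in N. S n x = \<phi> (?s n (\<psi> x))" for n
    using AEY by eventually_elim (simp add: S_def)
  have comp: "(\<lambda>x. \<phi> (?s n (\<psi> x))) \<in> N \<rightarrow>\<^sub>M N" for n by measurable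
  have Sm: "S n \<in> N \<rightarrow>\<^sub>M N" for n
    unfolding S_def[abs_def] using Ym comp by (intro measurable_If_set) (auto simp: spaceN)
  have Sd: "distr N N (S n) = N" for n
  proof -
    have "distr N N (S n) = distr N N (\<lambda>x. \<phi> (?s n (\<psi> x)))"
      by (rule distr_cong_AE[OF refl refl Sae Sm comp])
    also have "\<dots> = distr (distr (distr N scenery \<psi>) scenery (?s n)) N \<phi>"
      using distr_distr[OF \<phi> measurable_compose[OF \<psi> scenery_shift_measurable]]
        distr_distr[OF scenery_shift_measurable \<psi>, of n]
      by (simp add: o_def)
    finally show ?thesis by (simp only: D\<psi> scenery_shift_distr D\<phi>)
  qed
  have act: "S \<in> mp_actions N"
    unfolding mp_actions_def measure_preserving_def
  proof (intro CollectI conjI allI ballI Sm Sd)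
    show "S 0 x = x" for x by (simp add: S_def zero Y_def)
    show "S (m + n) x = S m (S n x)" for m n x
    proof (cases "x \<in> Y")
      case True
      then show ?thesis using YS[OF True, of n] by (simp add: S_def[of m "S n x"] add) (simp add: S_def)
    next
      case False
      then show ?thesis by (simp add: S_def)
    qed
  qed
  show ?thesis
  proof (rule that[OF act])
    fix A B assume A: "A \<in> sets N" and B: "B \<in> sets N"
    let ?A = "\<phi> -` A \<inter> space scenery" and ?B = "\<phi> -` B \<inter> space scenery"
    have AB: "?A \<in> sets scenery" "?B \<in> sets scenery" using A B \<phi> by (auto intro: measurable_sets)
    have "measure N (S n -` A \<inter> space N \<inter> B) = measure scenery (?s n -` ?A \<inter> space scenery \<inter> ?B)" for n
    proof -
      have m: "?s n -` ?A \<inter> space scenery \<inter> ?B \<in> sets scenery"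
        using measurable_sets[OF scenery_shift_measurable AB(1)] AB(2) by auto
      have "measure scenery (?s n -` ?A \<inter> space scenery \<inter> ?B)
          = measure N (\<psi> -` (?s n -` ?A \<inter> space scenery \<inter> ?B) \<inter> space N)"
        using measure_distr[OF \<psi> m] by (simp add: D\<psi>)
      also have "\<dots> = measure N (S n -` A \<inter> space N \<inter> B)"
      proof (rule N.finite_measure_eq_AE)
        show "AE x in N. x \<in> \<psi> -` (?s n -` ?A \<inter> space scenery \<inter> ?B) \<inter> space N
            \<longleftrightarrow> x \<in> S n -` A \<inter> space N \<inter> B"
          using Sae[of n] \<phi>\<psi> by eventually_elim (auto simp: space_scenery spaceN)
        show "\<psi> -` (?s n -` ?A \<inter> space scenery \<inter> ?B) \<inter> space N \<in> sets N" using \<psi> m by (rule measurable_sets)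
        show "S n -` A \<inter> space N \<inter> B \<in> sets N" using measurable_sets[OF Sm A] B by auto
      qed
      finally show ?thesis by simp
    qed
    moreover have "measure N A = measure scenery ?A" "measure N B = measure scenery ?B"
      using measure_distr[OF \<phi> A] measure_distr[OF \<phi> B] by (simp_all add: D\<phi>)
    ultimately show "mixing_along N S A B"
      using scenery_mixing(1)[OF AB] by (simp add: mixing_along_def)
  next
    fix n assume n: "n \<in> F"
    let ?C = "{\<omega>. \<Phi> (?s n \<omega>) \<noteq> T n (\<Phi> \<omega>)}"
    have C: "?C \<in> sets scenery"
    proof -
      have "(\<lambda>\<omega>. \<Phi> (?s n \<omega>)) \<in> borel_measurable scenery" "(\<lambda>\<omega>. T n (\<Phi> \<omega>)) \<in> borel_measurable scenery"
        using measurable_compose[OF scenery_shift_measurable \<Phi>, of n] measurable_compose[OF \<Phi> T_meas, of n]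
        by (simp_all add: measurable_cong_sets[OF refl setsN[symmetric]])
      then have "{\<omega> \<in> space scenery. \<Phi> (?s n \<omega>) = T n (\<Phi> \<omega>)} \<in> sets scenery"
        by (rule measurable_equality_set)
      moreover have "?C = space scenery - {\<omega> \<in> space scenery. \<Phi> (?s n \<omega>) = T n (\<Phi> \<omega>)}"
        by (auto simp: space_scenery)
      ultimately show ?thesis by (simp only: sets.compl_sets)
    qed
    let ?B = "\<psi> -` ?C \<inter> space N"
    have "measure N ?B = measure scenery ?C" using measure_distr[OF \<psi> C] by (simp add: D\<psi>)
    also have "\<dots> < \<epsilon>" using factor_almost_equivariant[OF V, of n] VF[OF n] unfolding \<Phi>_def by linarith
    finally have small: "measure N ?B < \<epsilon>" .
    have "AE x in N. k (\<phi> (?s n (\<psi> x))) = k (\<Phi> (?s n (\<psi> x)))"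
      using tr[OF tr[OF k\<phi> scenery_shift_distr scenery_shift_measurable, of n] D\<psi> \<psi>] .
    then have "AE x in N. x \<notin> ?B \<longrightarrow> (\<exists>y. k y = k x \<and> k (S n x) = k (T n y))"
      using Sae[of n] k\<psi>
    proof eventually_elim
      case (elim x)
      then show ?case by (auto simp: spaceN intro!: exI[of _ "\<Phi> (\<psi> x)"])
    qed
    with small measurable_sets[OF \<psi> C] show "\<exists>B\<in>sets N. measure N B < \<epsilon> \<and>
        (AE x in N. x \<notin> B \<longrightarrow> (\<exists>y. k y = k x \<and> k (S n x) = k (T n y)))"
      by (intro bexI[of _ ?B] conjI)
  qed
qed

end

section \<open>Averages along a measure-preserving flow\<close>

lemma L2_funD: "f \<in> L2_fun M \<Longrightarrow> f \<in> borel_measurable M"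
  "f \<in> L2_fun M \<Longrightarrow> integrable M (\<lambda>x. (cmod (f x))\<^sup>2)"
  by (auto simp: L2_fun_def)

lemma borel_measurable_cnj [measurable (raw)]:
  "f \<in> borel_measurable M \<Longrightarrow> (\<lambda>x. cnj (f x)) \<in> borel_measurable M"
  by (rule borel_measurable_continuous_on[OF _ ]) (intro continuous_intros)

text \<open>The weighted inequality of arithmetic and geometric means; with the weight at one's disposal it
serves as the Cauchy-Schwarz inequality.\<close>
lemma cmod_mult_cnj_le:
  assumes "c > 0"
  shows "cmod (a * cnj b) \<le> (c * (cmod a)\<^sup>2 + (cmod b)\<^sup>2 / c) / 2"
proof -
  have "0 \<le> (c * cmod a - cmod b)\<^sup>2 / c" using assms by simp
  also have "\<dots> = c * (cmod a)\<^sup>2 + (cmod b)\<^sup>2 / c - 2 * (cmod a * cmod b)"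
    using assms by (simp add: power2_eq_square field_simps)
  finally show ?thesis by (simp add: norm_mult)
qed

lemma L2_inner_integrable:
  assumes "f \<in> L2_fun M" "g \<in> L2_fun M"
  shows "integrable M (\<lambda>x. f x * cnj (g x))"
proof (rule Bochner_Integration.integrable_bound)
  show "integrable M (\<lambda>x. (1 * (cmod (f x))\<^sup>2 + (cmod (g x))\<^sup>2 / 1) / 2)"
    using L2_funD(2)[OF assms(1)] L2_funD(2)[OF assms(2)] by auto
  show "(\<lambda>x. f x * cnj (g x)) \<in> borel_measurable M"
    using L2_funD(1)[OF assms(1)] L2_funD(1)[OF assms(2)] by measurable
  show "AE x in M. norm (f x * cnj (g x)) \<le> norm ((1 * (cmod (f x))\<^sup>2 + (cmod (g x))\<^sup>2 / 1) / 2)"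
  proof (rule AE_I2)
    fix x
    have "0 \<le> (1 * (cmod (f x))\<^sup>2 + (cmod (g x))\<^sup>2 / 1) / 2" by simp
    then show "norm (f x * cnj (g x)) \<le> norm ((1 * (cmod (f x))\<^sup>2 + (cmod (g x))\<^sup>2 / 1) / 2)"
      using cmod_mult_cnj_le[of 1 "f x" "g x"] by (metis abs_of_nonneg real_norm_def zero_less_one)
  qed
qed

lemma L2_inner_bound:
  assumes "f \<in> L2_fun M" "g \<in> L2_fun M" "c > 0"
  shows "cmod (\<integral>x. f x * cnj (g x) \<partial>M) \<le> (c * (\<integral>x. (cmod (f x))\<^sup>2 \<partial>M) + (\<integral>x. (cmod (g x))\<^sup>2 \<partial>M) / c) / 2"
proof -
  note i = L2_funD(2)[OF assms(1)] L2_funD(2)[OF assms(2)]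
  have "cmod (\<integral>x. f x * cnj (g x) \<partial>M) \<le> (\<integral>x. cmod (f x * cnj (g x)) \<partial>M)"
    by (rule integral_norm_bound)
  also have "\<dots> \<le> (\<integral>x. (c * (cmod (f x))\<^sup>2 + (cmod (g x))\<^sup>2 / c) / 2 \<partial>M)"
    using i L2_inner_integrable[OF assms(1,2)] cmod_mult_cnj_le[OF assms(3)]
    by (intro integral_mono integrable_norm) auto
  also have "\<dots> = (c * (\<integral>x. (cmod (f x))\<^sup>2 \<partial>M) + (\<integral>x. (cmod (g x))\<^sup>2 \<partial>M) / c) / 2"
    using i by simp
  finally show ?thesis .
qed

lemma L2_fun_cmult: "f \<in> L2_fun M \<Longrightarrow> (\<lambda>x. c * f x) \<in> L2_fun M"
  by (auto simp: L2_fun_def norm_mult power_mult_distrib)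

lemma L2_fun_diff: "f \<in> L2_fun M \<Longrightarrow> g \<in> L2_fun M \<Longrightarrow> (\<lambda>x. f x - g x) \<in> L2_fun M"
  using L2_fun_diff_integrable[of f M g] by (auto simp: L2_fun_def)

lemma L2_fun_add: "f \<in> L2_fun M \<Longrightarrow> g \<in> L2_fun M \<Longrightarrow> (\<lambda>x. f x + g x) \<in> L2_fun M"
  using L2_fun_diff[of f M "\<lambda>x. (- 1) * g x"] L2_fun_cmult[of g M "- 1"] by simp

lemma (in finite_measure) L2_fun_bounded:
  assumes "f \<in> borel_measurable M" "\<And>x. cmod (f x) \<le> C"
  shows "f \<in> L2_fun M"
proof -
  have "integrable M (\<lambda>x. (cmod (f x))\<^sup>2)"
    by (rule integrable_const_bound[where B = "C\<^sup>2"])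
       (use assms in \<open>auto intro!: power_mono\<close>)
  then show ?thesis using assms by (simp add: L2_fun_def)
qed

text \<open>The increments are summable in \<open>L\<^sup>1\<close>, so the sequence converges almost everywhere; the
estimate for the limit is Fatou's lemma.\<close>
lemma (in prob_space) L2_complete:
  fixes F :: "nat \<Rightarrow> 'a \<Rightarrow> complex"
  assumes F: "\<And>k. F k \<in> L2_fun M"
    and cauchy: "\<And>k m. k \<le> m \<Longrightarrow> (\<integral>x. (cmod (F m x - F k x))\<^sup>2 \<partial>M) \<le> (1/4) ^ k"
  obtains G where "G \<in> L2_fun M" "\<And>k. (\<integral>x. (cmod (G x - F k x))\<^sup>2 \<partial>M) \<le> (1/4) ^ k"
proof -
  have Fm [measurable]: "F k \<in> borel_measurable M" for k using F L2_funD by blast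
  define u where "u k x = cmod (F (Suc k) x - F k x)" for k x
  have um [measurable]: "u k \<in> borel_measurable M" for k unfolding u_def by measurable
  have ui: "integrable M (\<lambda>x. (u k x)\<^sup>2)" for k
    unfolding u_def by (rule L2_fun_diff_integrable[OF F F])
  have "(\<integral>\<^sup>+x. ennreal (u k x) \<partial>M) \<le> ennreal ((1/2) ^ k)" for k
  proof -
    have "(\<integral>\<^sup>+x. ennreal (u k x) \<partial>M) \<le> (\<integral>\<^sup>+x. ennreal ((2 ^ k * (u k x)\<^sup>2 + (1/2) ^ k) / 2) \<partial>M)"
    proof (intro nn_integral_mono ennreal_leI)
      fix x
      have "0 \<le> (2 ^ k * u k x - 1)\<^sup>2 / 2 ^ k" by simp
      also have "\<dots> = 2 ^ k * (u k x)\<^sup>2 + (1/2) ^ k - 2 * u k x"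
        by (simp add: power2_eq_square field_simps)
      finally show "u k x \<le> (2 ^ k * (u k x)\<^sup>2 + (1/2) ^ k) / 2" by simp
    qed
    also have "\<dots> = ennreal (\<integral>x. (2 ^ k * (u k x)\<^sup>2 + (1/2) ^ k) / 2 \<partial>M)"
      using ui by (intro nn_integral_eq_integral) auto
    also have "(\<integral>x. (2 ^ k * (u k x)\<^sup>2 + (1/2) ^ k) / 2 \<partial>M) = (2 ^ k * (\<integral>x. (u k x)\<^sup>2 \<partial>M) + (1/2) ^ k) / 2"
      using ui by (simp add: prob_space)
    also have "\<dots> \<le> (2 ^ k * (1/4) ^ k + (1/2) ^ k) / 2"
      using cauchy[of k "Suc k"] by (intro divide_right_mono add_right_mono mult_left_mono) (auto simp: u_def)
    also have "2 ^ k * (1/4) ^ k = (1/2::real) ^ k" by (simp add: power_mult_distrib[symmetric])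
    finally show ?thesis by (simp add: ennreal_leI)
  qed
  then have "(\<Sum>k. \<integral>\<^sup>+x. ennreal (u k x) \<partial>M) \<le> (\<Sum>k. ennreal ((1/2) ^ k))"
    by (intro suminf_le) auto
  also have "\<dots> = ennreal (\<Sum>k. (1/2) ^ k)"
    by (intro suminf_ennreal2) (auto simp: summable_geometric)
  finally have "(\<integral>\<^sup>+x. (\<Sum>k. ennreal (u k x)) \<partial>M) < \<infinity>"
    by (subst nn_integral_suminf) (auto simp: le_less_trans)
  then have "AE x in M. (\<Sum>k. ennreal (u k x)) \<noteq> \<infinity>"
    by (intro nn_integral_noteq_infinite) auto
  then have conv: "AE x in M. convergent (\<lambda>k. F k x)"
  proof eventually_elim
    case (elim x)
    have "summable (\<lambda>k. u k x)"
      using elim by (intro summable_suminf_not_top) (auto simp: u_def)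
    then have "summable (\<lambda>k. F (Suc k) x - F k x)"
      unfolding u_def by (rule summable_norm_cancel)
    then have "(\<lambda>n. \<Sum>k<n. F (Suc k) x - F k x) \<longlonglongrightarrow> (\<Sum>k. F (Suc k) x - F k x)"
      by (rule summable_LIMSEQ)
    then have "(\<lambda>n. F n x - F 0 x) \<longlonglongrightarrow> (\<Sum>k. F (Suc k) x - F k x)"
      by (simp add: sum_lessThan_telescope[of "\<lambda>k. F k x"])
    from tendsto_add[OF this tendsto_const[of "F 0 x"]]
    show ?case by (auto simp: convergent_def)
  qed
  define G where "G x = lim (\<lambda>k. F k x)" for x
  have Gm [measurable]: "G \<in> borel_measurable M" unfolding G_def by measurable
  have Glim: "AE x in M. (\<lambda>k. F k x) \<longlonglongrightarrow> G x"
    using conv by eventually_elim (simp add: G_def convergent_LIMSEQ_iff)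
  have bound: "(\<integral>\<^sup>+x. ennreal ((cmod (G x - F k x))\<^sup>2) \<partial>M) \<le> ennreal ((1/4) ^ k)" for k
  proof -
    have "(\<integral>\<^sup>+x. ennreal ((cmod (G x - F k x))\<^sup>2) \<partial>M)
        = (\<integral>\<^sup>+x. liminf (\<lambda>m. ennreal ((cmod (F m x - F k x))\<^sup>2)) \<partial>M)"
    proof (rule nn_integral_cong_AE)
      show "AE x in M. ennreal ((cmod (G x - F k x))\<^sup>2) = liminf (\<lambda>m. ennreal ((cmod (F m x - F k x))\<^sup>2))"
        using Glim
      proof eventually_elim
        case (elim x)
        have "(\<lambda>m. ennreal ((cmod (F m x - F k x))\<^sup>2)) \<longlonglongrightarrow> ennreal ((cmod (G x - F k x))\<^sup>2)"
          by (intro tendsto_intros elim)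
        then show ?case using lim_imp_Liminf[OF sequentially_bot] by metis
      qed
    qed
    also have "\<dots> \<le> liminf (\<lambda>m. \<integral>\<^sup>+x. ennreal ((cmod (F m x - F k x))\<^sup>2) \<partial>M)"
      by (rule nn_integral_liminf) measurable
    also have "\<dots> \<le> ennreal ((1/4) ^ k)"
    proof -
      have "\<forall>\<^sub>F m in sequentially. (\<integral>\<^sup>+x. ennreal ((cmod (F m x - F k x))\<^sup>2) \<partial>M) \<le> ennreal ((1/4) ^ k)"
        using eventually_ge_at_top[of k]
      proof eventually_elim
        case (elim m)
        then show ?case using cauchy[OF elim] L2_fun_diff_integrable[OF F F]
          by (subst nn_integral_eq_integral) (auto intro: ennreal_leI)
      qed
      then have "liminf (\<lambda>m. \<integral>\<^sup>+x. ennreal ((cmod (F m x - F k x))\<^sup>2) \<partial>M) \<le> liminf (\<lambda>m. ennreal ((1/4) ^ k))"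
        by (rule Liminf_mono)
      then show ?thesis by (simp add: Liminf_const)
    qed
    finally show ?thesis .
  qed
  have di: "integrable M (\<lambda>x. (cmod (G x - F k x))\<^sup>2)" for k
    by (rule integrableI_bounded) (use bound[of k] in \<open>auto simp: le_less_trans\<close>)
  then have "(\<lambda>x. G x - F 0 x) \<in> L2_fun M" by (simp add: L2_fun_def)
  from L2_fun_add[OF this F[of 0]] have "G \<in> L2_fun M" by simp
  moreover have "(\<integral>x. (cmod (G x - F k x))\<^sup>2 \<partial>M) \<le> (1/4) ^ k" for k
    using bound[of k] di[of k] by (subst (asm) nn_integral_eq_integral) auto
  ultimately show ?thesis by (rule that)
qed

text \<open>Iterated midpoints of orbit points. They exhaust the dyadic convex combinations, and closure under
midpoints is the only convexity that the argument uses; as a datatype they permit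
induction instead of manipulation of finite sums.\<close>
datatype average = Sample real | Midpoint average average

primrec delay :: "real \<Rightarrow> average \<Rightarrow> average" where
  "delay s (Sample t) = Sample (t + s)"
| "delay s (Midpoint a b) = Midpoint (delay s a) (delay s b)"

text \<open>With the factor in front, an eigenfunction for \<open>\<theta>\<close> becomes an invariant function.\<close>
primrec twisted_average :: "(real \<Rightarrow> 'y \<Rightarrow> 'y) \<Rightarrow> real \<Rightarrow> ('y \<Rightarrow> complex) \<Rightarrow> average \<Rightarrow> 'y \<Rightarrow> complex" where
  "twisted_average \<phi> \<theta> F (Sample t) y = cis (- (2 * pi * \<theta> * t)) * F (\<phi> t y)"
| "twisted_average \<phi> \<theta> F (Midpoint a b) y = (twisted_average \<phi> \<theta> F a y + twisted_average \<phi> \<theta> F b y) / 2"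

locale mp_flow = prob_space Q for Q :: "'y measure" +
  fixes \<phi> :: "real \<Rightarrow> 'y \<Rightarrow> 'y"
  assumes flow_meas [measurable]: "\<And>t. \<phi> t \<in> Q \<rightarrow>\<^sub>M Q"
    and flow_distr: "\<And>t. distr Q Q (\<phi> t) = Q"
    and flow_add: "\<And>s t y. y \<in> space Q \<Longrightarrow> \<phi> (s + t) y = \<phi> s (\<phi> t y)"
    and flow_0: "\<And>y. y \<in> space Q \<Longrightarrow> \<phi> 0 y = y"
begin

lemma integral_flow:
  fixes f :: "'y \<Rightarrow> 'b::{banach, second_countable_topology}"
  assumes "f \<in> borel_measurable Q"
  shows "(\<integral>y. f (\<phi> t y) \<partial>Q) = (\<integral>y. f y \<partial>Q)"
  using integral_distr[OF flow_meas assms, of t] by (simp add: flow_distr)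

lemma L2_fun_flow:
  assumes "f \<in> L2_fun Q" shows "(\<lambda>y. f (\<phi> t y)) \<in> L2_fun Q"
  using assms integrable_distr[OF flow_meas, of t "\<lambda>y. (cmod (f y))\<^sup>2"]
  by (auto simp: L2_fun_def flow_distr)

lemma L2_fun_average:
  assumes "F \<in> L2_fun Q"
  shows "twisted_average \<phi> \<theta> F a \<in> L2_fun Q"
proof (induction a)
  case (Sample t)
  then show ?case using L2_fun_cmult[OF L2_fun_flow[OF assms, of t]] by (simp add: fun_eq_iff[symmetric])
next
  case (Midpoint a b)
  then show ?case using L2_fun_cmult[OF L2_fun_add[OF Midpoint], of "1/2"]
    by (simp add: fun_eq_iff[symmetric])
qed

text \<open>Delaying all sampling times acts on averages as the twisted flow itself.\<close>
lemma average_delay: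
  assumes "y \<in> space Q"
  shows "twisted_average \<phi> \<theta> F (delay s a) y = cis (- (2 * pi * \<theta> * s)) * twisted_average \<phi> \<theta> F a (\<phi> s y)"
proof (induction a)
  case (Sample t)
  have "cis (- (2 * pi * \<theta> * (t + s))) = cis (- (2 * pi * \<theta> * s)) * cis (- (2 * pi * \<theta> * t))"
    by (simp add: cis_mult algebra_simps)
  then show ?case using flow_add[OF assms, of t s] by simp
next
  case (Midpoint a b)
  then show ?case by (simp add: algebra_simps)
qed

abbreviation sqnorm :: "('y \<Rightarrow> complex) \<Rightarrow> real" where
  "sqnorm f \<equiv> \<integral>y. (cmod (f y))\<^sup>2 \<partial>Q"

lemma sqnorm_delay:
  assumes "F \<in> L2_fun Q"
  shows "sqnorm (twisted_average \<phi> \<theta> F (delay s a)) = sqnorm (twisted_average \<phi> \<theta> F a)"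
proof -
  have "sqnorm (twisted_average \<phi> \<theta> F (delay s a)) = (\<integral>y. (cmod (twisted_average \<phi> \<theta> F a (\<phi> s y)))\<^sup>2 \<partial>Q)"
    by (intro Bochner_Integration.integral_cong refl) (simp add: average_delay norm_mult)
  also have "\<dots> = sqnorm (twisted_average \<phi> \<theta> F a)"
    using L2_funD(1)[OF L2_fun_average[OF assms]] by (intro integral_flow[of "\<lambda>y. (cmod (twisted_average \<phi> \<theta> F a y))\<^sup>2"]) measurable
  finally show ?thesis .
qed

lemma parallelogram:
  assumes "f \<in> L2_fun Q" "g \<in> L2_fun Q"
  shows "sqnorm (\<lambda>y. f y - g y) = 2 * sqnorm f + 2 * sqnorm g - 4 * sqnorm (\<lambda>y. (f y + g y) / 2)"
proof -
  note i = L2_funD(2)[OF assms(1)] L2_funD(2)[OF assms(2)]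
    L2_funD(2)[OF L2_fun_cmult[OF L2_fun_add[OF assms], of "1/2"]]
  have "(cmod (a - b))\<^sup>2 = 2 * (cmod a)\<^sup>2 + 2 * (cmod b)\<^sup>2 - 4 * (cmod ((a + b) / 2))\<^sup>2" for a b :: complex
    unfolding cmod_power2 by (simp add: power2_eq_square field_simps)
  then have "sqnorm (\<lambda>y. f y - g y) = (\<integral>y. 2 * (cmod (f y))\<^sup>2 + 2 * (cmod (g y))\<^sup>2 - 4 * (cmod ((f y + g y) / 2))\<^sup>2 \<partial>Q)"
    by simp
  then show ?thesis using i by simp
qed

text \<open>The mean ergodic theorem by way of the vector of minimal norm. By the parallelogram
law, two averages whose norms are nearly minimal are close to each other. This makes a minimising
sequence Cauchy, and, applied to an average and its delay, it makes the limit invariant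
under the twisted flow.\<close>
lemma eigenfunction_of_averages:
  assumes F: "F \<in> L2_fun Q" and \<delta>: "\<delta> > 0" and low: "\<And>a. \<delta> \<le> sqnorm (twisted_average \<phi> \<theta> F a)"
  obtains G a where "G \<in> L2_fun Q" "\<not> (AE y in Q. G y = 0)"
    "\<And>s. AE y in Q. G (\<phi> s y) = cis (2 * pi * \<theta> * s) * G y"
    "\<And>k. sqnorm (\<lambda>y. G y - twisted_average \<phi> \<theta> F (a k) y) \<le> (1/4) ^ k"
proof -
  let ?A = "twisted_average \<phi> \<theta> F"
  define m where "m = Inf (range (\<lambda>a. sqnorm (?A a)))"
  have bdd: "bdd_below (range (\<lambda>a. sqnorm (?A a)))" by (rule bdd_belowI[of _ \<delta>]) (use low in auto)
  have m_le: "m \<le> sqnorm (?A a)" for a unfolding m_def by (rule cInf_lower[OF _ bdd]) auto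
  have m\<delta>: "\<delta> \<le> m" unfolding m_def by (rule cInf_greatest) (use low in auto)
  have "\<exists>a. sqnorm (?A a) < m + (1/4) ^ k / 4" for k
  proof -
    have "Inf (range (\<lambda>a. sqnorm (?A a))) < m + (1/4) ^ k / 4" by (simp add: m_def)
    from cInf_lessD[OF _ this] show ?thesis by auto
  qed
  then obtain a where a: "\<And>k. sqnorm (?A (a k)) < m + (1/4) ^ k / 4" by metis
  have diff: "sqnorm (\<lambda>y. ?A b y - ?A c y) \<le> 2 * sqnorm (?A b) + 2 * sqnorm (?A c) - 4 * m" for b c
    using parallelogram[OF L2_fun_average[OF F, of \<theta> b] L2_fun_average[OF F, of \<theta> c]] m_le[of "Midpoint b c"]
    by simp
  have cauchy: "sqnorm (\<lambda>y. ?A (a l) y - ?A (a k) y) \<le> (1/4) ^ k" if "k \<le> l" for k l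
  proof -
    have "(1/4::real) ^ l \<le> (1/4) ^ k" using that by (intro power_decreasing) auto
    then show ?thesis using diff[of "a l" "a k"] a[of l] a[of k] by linarith
  qed
  obtain G where G: "G \<in> L2_fun Q" and close: "\<And>k. sqnorm (\<lambda>y. G y - ?A (a k) y) \<le> (1/4) ^ k"
    using L2_complete[of "\<lambda>k. ?A (a k)", OF L2_fun_average[OF F] cauchy] by blast
  have pow0: "\<exists>k. (1/4::real) ^ k < e" if "e > 0" for e
    using real_arch_pow_inv[OF that, of "1/4"] by auto
  have le2: "sqnorm (\<lambda>y. f y + g y) \<le> 2 * sqnorm f + 2 * sqnorm g" if "f \<in> L2_fun Q" "g \<in> L2_fun Q" for f g
  proof -
    have "sqnorm (\<lambda>y. f y - - g y) = 2 * sqnorm f + 2 * sqnorm (\<lambda>y. - g y) - 4 * sqnorm (\<lambda>y. (f y + - g y) / 2)"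
      using parallelogram[OF that(1) L2_fun_cmult[OF that(2), of "- 1"]] by simp
    moreover have "0 \<le> sqnorm (\<lambda>y. (f y + - g y) / 2)" by simp
    ultimately show ?thesis by (simp del: integral_nonneg_AE)
  qed
  have nonzero: "\<not> (AE y in Q. G y = 0)"
  proof
    assume z: "AE y in Q. G y = 0"
    obtain k where k: "(1/4::real) ^ k < \<delta>" using pow0[OF \<delta>] by blast
    have "sqnorm (\<lambda>y. G y - ?A (a k) y) = sqnorm (?A (a k))"
    proof (rule integral_cong_AE)
      show "AE y in Q. (cmod (G y - ?A (a k) y))\<^sup>2 = (cmod (?A (a k) y))\<^sup>2"
        using z by eventually_elim simp
    qed (use L2_funD(1)[OF G] L2_funD(1)[OF L2_fun_average[OF F]] in measurable)
    then show False using close[of k] low[of "a k"] k by linarith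
  qed
  have inv: "AE y in Q. G (\<phi> s y) = cis (2 * pi * \<theta> * s) * G y" for s
  proof -
    let ?c = "cis (- (2 * pi * \<theta> * s))"
    let ?D = "\<lambda>y. ?c * G (\<phi> s y) - G y"
    have D: "?D \<in> L2_fun Q" by (intro L2_fun_diff L2_fun_cmult L2_fun_flow G)
    have "sqnorm ?D \<le> e" if "e > 0" for e
    proof -
      have "e / 10 > 0" using that by simp
      from pow0[OF this] obtain k where k: "(1/4::real) ^ k < e / 10" ..
      let ?f = "\<lambda>y. G y - ?A (a k) y"
      have f: "?f \<in> L2_fun Q" by (intro L2_fun_diff G L2_fun_average F)
      let ?g = "\<lambda>y. ?c * ?f (\<phi> s y)"
      have g: "?g \<in> L2_fun Q" by (intro L2_fun_cmult L2_fun_flow[OF f])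
      let ?h = "\<lambda>y. ?A (delay s (a k)) y - ?A (a k) y"
      have h: "?h \<in> L2_fun Q" by (intro L2_fun_diff L2_fun_average F)
      have f': "(\<lambda>y. (-1) * ?f y) \<in> L2_fun Q" by (rule L2_fun_cmult[OF f])
      have "sqnorm ?D = sqnorm (\<lambda>y. ?g y + (?h y + (-1) * ?f y))"
        by (intro Bochner_Integration.integral_cong refl) (simp add: average_delay algebra_simps)
      also have "\<dots> \<le> 2 * sqnorm ?g + 2 * sqnorm (\<lambda>y. ?h y + (-1) * ?f y)"
        by (rule le2[OF g L2_fun_add[OF h f']])
      also have "\<dots> \<le> 2 * sqnorm ?g + 2 * (2 * sqnorm ?h + 2 * sqnorm (\<lambda>y. (-1) * ?f y))"
        by (intro add_left_mono mult_left_mono le2[OF h f']) simp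
      also have "sqnorm (\<lambda>y. (-1) * ?f y) = sqnorm ?f" by (simp add: norm_minus_commute)
      also have "sqnorm ?g = sqnorm ?f"
        using integral_flow[of "\<lambda>y. (cmod (?f y))\<^sup>2" s] L2_funD(1)[OF f] by (simp add: norm_mult)
      also have "sqnorm ?h \<le> (1/4) ^ k"
        using diff[of "delay s (a k)" "a k"] a[of k] sqnorm_delay[OF F, of \<theta> s "a k"] by linarith
      also have "sqnorm ?f \<le> (1/4) ^ k" by (rule close)
      finally show ?thesis using k by simp
    qed
    then have "sqnorm ?D \<le> 0" by (rule field_le_epsilon[where y = 0, simplified])
    then have "sqnorm ?D = 0" by (simp add: antisym)
    then have "AE y in Q. (cmod (?D y))\<^sup>2 = 0"
      using integral_nonneg_eq_0_iff_AE[OF L2_funD(2)[OF D]] by simp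
    then show ?thesis
    proof eventually_elim
      case (elim y)
      then have "?c * G (\<phi> s y) = G y" by simp
      moreover have "cis (2 * pi * \<theta> * s) * ?c = 1" by (simp add: cis_mult)
      ultimately show ?case by (metis mult.assoc mult_1)
    qed
  qed
  show ?thesis by (rule that[OF G nonzero inv close])
qed

text \<open>The inner product of an average with an eigenfunction does not depend on the average.\<close>
lemma eigenfunction_orthogonal:
  assumes F: "F \<in> L2_fun Q" and G: "G \<in> L2_fun Q"
    and eig: "\<And>s. AE y in Q. G (\<phi> s y) = cis (2 * pi * \<theta> * s) * G y"
    and small: "\<And>\<epsilon>. \<epsilon> > 0 \<Longrightarrow> \<exists>a. sqnorm (twisted_average \<phi> \<theta> F a) < \<epsilon>"
  shows "(\<integral>y. F y * cnj (G y) \<partial>Q) = 0"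
proof -
  let ?A = "twisted_average \<phi> \<theta> F"
  note [measurable] = L2_funD(1)[OF F] L2_funD(1)[OF G]
  have const: "(\<integral>y. ?A a y * cnj (G y) \<partial>Q) = (\<integral>y. F y * cnj (G y) \<partial>Q)" for a
  proof (induction a)
    case (Sample t)
    have "(\<integral>y. ?A (Sample t) y * cnj (G y) \<partial>Q) = (\<integral>y. F (\<phi> t y) * cnj (G (\<phi> t y)) \<partial>Q)"
    proof (rule integral_cong_AE)
      show "AE y in Q. ?A (Sample t) y * cnj (G y) = F (\<phi> t y) * cnj (G (\<phi> t y))"
        using eig[of t] by eventually_elim (simp add: cis_cnj)
    qed (rule borel_measurable_integrable, rule L2_inner_integrable, intro L2_fun_average L2_fun_flow F G,
         intro L2_fun_average L2_fun_flow F G)+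
    also have "\<dots> = (\<integral>y. F y * cnj (G y) \<partial>Q)"
      by (rule integral_flow[of "\<lambda>y. F y * cnj (G y)"]) measurable
    finally show ?case .
  next
    case (Midpoint a b)
    have "(\<integral>y. ?A (Midpoint a b) y * cnj (G y) \<partial>Q) = (\<integral>y. (?A a y * cnj (G y) + ?A b y * cnj (G y)) / 2 \<partial>Q)"
      by (intro Bochner_Integration.integral_cong refl) (simp add: field_simps)
    then show ?case
      using L2_inner_integrable[OF L2_fun_average[OF F] G] Midpoint by simp
  qed
  have nn: "0 \<le> sqnorm G" by simp
  have "cmod (\<integral>y. F y * cnj (G y) \<partial>Q) \<le> 0 + \<epsilon>" if \<epsilon>: "\<epsilon> > 0" for \<epsilon>
  proof -
    \<comment> \<open>A weight that makes the second term of the bound at most \<open>\<epsilon>\<close>; the average is then chosen for the first.\<close>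
    define c where "c = (sqnorm G + 1) / \<epsilon>"
    have "(q + 1) / \<epsilon> > 0 \<and> q / ((q + 1) / \<epsilon>) \<le> \<epsilon>" if "0 \<le> q" for q :: real
      using \<epsilon> that by (auto simp: field_simps)
    from this[OF nn] have c: "c > 0" "sqnorm G / c \<le> \<epsilon>" by (simp_all add: c_def)
    obtain a where a: "sqnorm (?A a) < \<epsilon> / c" using small[of "\<epsilon> / c"] \<epsilon> c by auto
    have "cmod (\<integral>y. F y * cnj (G y) \<partial>Q) \<le> (c * sqnorm (?A a) + sqnorm G / c) / 2"
      using L2_inner_bound[OF L2_fun_average[OF F] G c(1), of \<theta> a] by (simp only: const)
    also have "\<dots> \<le> (\<epsilon> + \<epsilon>) / 2"
      using a c by (intro divide_right_mono add_mono) (auto simp: field_simps)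
    finally show ?thesis by simp
  qed
  then have "cmod (\<integral>y. F y * cnj (G y) \<partial>Q) \<le> 0" by (rule field_le_epsilon)
  then show ?thesis by simp
qed

text \<open>The inner product of an average with a late delay of itself is small, so the square of the
norm of their midpoint is about one half of that of the average. The factor \<open>3/4\<close> leaves room
for the error.\<close>
lemma averages_small_of_decorrelation:
  assumes F: "F \<in> L2_fun Q"
    and dec: "\<And>\<epsilon>. \<epsilon> > 0 \<Longrightarrow> \<exists>R. \<forall>s\<ge>R. cmod (\<integral>y. F (\<phi> s y) * cnj (F y) \<partial>Q) \<le> \<epsilon>"
    and \<epsilon>: "\<epsilon> > 0"
  shows "\<exists>a. sqnorm (twisted_average \<phi> \<theta> F a) < \<epsilon>"
proof -
  let ?A = "twisted_average \<phi> \<theta> F"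
  note [measurable] = L2_funD(1)[OF F]
  have AL: "?A a \<in> L2_fun Q" for a by (rule L2_fun_average[OF F])
  have split1: "(\<integral>y. ?A (Midpoint a b) y * cnj (?A c y) \<partial>Q)
     = ((\<integral>y. ?A a y * cnj (?A c y) \<partial>Q) + (\<integral>y. ?A b y * cnj (?A c y) \<partial>Q)) / 2" for a b c
  proof -
    have "(\<integral>y. ?A (Midpoint a b) y * cnj (?A c y) \<partial>Q) = (\<integral>y. (?A a y * cnj (?A c y) + ?A b y * cnj (?A c y)) / 2 \<partial>Q)"
      by (intro Bochner_Integration.integral_cong refl) (simp add: field_simps)
    then show ?thesis using L2_inner_integrable[OF AL AL] by simp
  qed
  have split2: "(\<integral>y. ?A c y * cnj (?A (Midpoint a b) y) \<partial>Q)
     = ((\<integral>y. ?A c y * cnj (?A a y) \<partial>Q) + (\<integral>y. ?A c y * cnj (?A b y) \<partial>Q)) / 2" for a b c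
  proof -
    have "(\<integral>y. ?A c y * cnj (?A (Midpoint a b) y) \<partial>Q) = (\<integral>y. (?A c y * cnj (?A a y) + ?A c y * cnj (?A b y)) / 2 \<partial>Q)"
      by (intro Bochner_Integration.integral_cong refl) (simp add: field_simps)
    then show ?thesis using L2_inner_integrable[OF AL AL] by simp
  qed
  have half: "cmod ((u + v) / 2) \<le> e" if "cmod u \<le> e" "cmod v \<le> e" for u v :: complex and e
    using norm_triangle_ineq[of u v] that by (simp add: norm_divide)
  have decor: "\<exists>R. \<forall>s\<ge>R. cmod (\<integral>y. ?A a y * cnj (?A (delay s b) y) \<partial>Q) \<le> e" if e: "e > 0" for a b e
  proof (induction a arbitrary: b)
    case (Sample t)
    show ?case
    proof (induction b)
      case (Sample t')
      obtain R where R: "\<forall>s\<ge>R. cmod (\<integral>y. F (\<phi> s y) * cnj (F y) \<partial>Q) \<le> e" using dec[OF e] by blast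
      have "cmod (\<integral>y. ?A (Sample t) y * cnj (?A (delay s (Sample t')) y) \<partial>Q) \<le> e" if s: "s \<ge> R + t - t'" for s
      proof -
        let ?c = "cis (- (2 * pi * \<theta> * t)) * cnj (cis (- (2 * pi * \<theta> * (t' + s))))"
        let ?H = "\<lambda>y. cnj (F (\<phi> (t' + s - t) y) * cnj (F y))"
        have "(\<integral>y. ?A (Sample t) y * cnj (?A (delay s (Sample t')) y) \<partial>Q) = (\<integral>y. ?c * ?H (\<phi> t y) \<partial>Q)"
          by (intro Bochner_Integration.integral_cong refl)
             (simp add: flow_add[of _ "t' + s - t" t, symmetric] mult_ac)
        also have "\<dots> = (\<integral>y. ?c * ?H y \<partial>Q)"
          by (rule integral_flow[of "\<lambda>y. ?c * ?H y"]) measurable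
        also have "\<dots> = ?c * cnj (\<integral>y. F (\<phi> (t' + s - t) y) * cnj (F y) \<partial>Q)"
          by (simp only: integral_mult_right_zero Bochner_Integration.integral_cnj)
        finally have "cmod (\<integral>y. ?A (Sample t) y * cnj (?A (delay s (Sample t')) y) \<partial>Q)
            = cmod (\<integral>y. F (\<phi> (t' + s - t) y) * cnj (F y) \<partial>Q)"
          by (simp only: norm_mult complex_mod_cnj norm_cis mult_1)
        also have "\<dots> \<le> e" using R s by simp
        finally show ?thesis .
      qed
      then show ?case by blast
    next
      case (Midpoint b1 b2)
      then obtain R1 R2 where
        R1: "\<forall>s\<ge>R1. cmod (\<integral>y. ?A (Sample t) y * cnj (?A (delay s b1) y) \<partial>Q) \<le> e" and
        R2: "\<forall>s\<ge>R2. cmod (\<integral>y. ?A (Sample t) y * cnj (?A (delay s b2) y) \<partial>Q) \<le> e" by blast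
      have "\<forall>s\<ge>max R1 R2. cmod (\<integral>y. ?A (Sample t) y * cnj (?A (delay s (Midpoint b1 b2)) y) \<partial>Q) \<le> e"
        unfolding delay.simps split2 using R1 R2 by (intro allI impI half) (simp_all only: max.bounded_iff)
      then show ?case by blast
    qed
  next
    case (Midpoint a1 a2)
    obtain R1 where R1: "\<forall>s\<ge>R1. cmod (\<integral>y. ?A a1 y * cnj (?A (delay s b) y) \<partial>Q) \<le> e" using Midpoint(1) by blast
    obtain R2 where R2: "\<forall>s\<ge>R2. cmod (\<integral>y. ?A a2 y * cnj (?A (delay s b) y) \<partial>Q) \<le> e" using Midpoint(2) by blast
    have "\<forall>s\<ge>max R1 R2. cmod (\<integral>y. ?A (Midpoint a1 a2) y * cnj (?A (delay s b) y) \<partial>Q) \<le> e"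
      unfolding split1 using R1 R2 by (intro allI impI half) (simp_all only: max.bounded_iff)
    then show ?case by blast
  qed
  have mid: "sqnorm (?A (Midpoint a b)) \<le> (sqnorm (?A a) + sqnorm (?A b)) / 4 + cmod (\<integral>y. ?A a y * cnj (?A b y) \<partial>Q) / 2" for a b
  proof -
    have pw: "(cmod ((u + v) / 2))\<^sup>2 = (cmod u)\<^sup>2 / 4 + (cmod v)\<^sup>2 / 4 + Re (u * cnj v) / 2" for u v :: complex
      unfolding cmod_power2 by (simp add: power2_eq_square field_simps)
    have lin: "(\<integral>y. p y / 4 + q y / 4 + r y / 2 \<partial>Q) = (\<integral>y. p y \<partial>Q) / 4 + (\<integral>y. q y \<partial>Q) / 4 + (\<integral>y. r y \<partial>Q) / 2"
      if "integrable Q p" "integrable Q q" "integrable Q r" for p q r :: "'y \<Rightarrow> real"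
      using that by simp
    have "sqnorm (?A (Midpoint a b)) = (\<integral>y. (cmod (?A a y))\<^sup>2 / 4 + (cmod (?A b y))\<^sup>2 / 4 + Re (?A a y * cnj (?A b y)) / 2 \<partial>Q)"
      by (simp only: twisted_average.simps pw)
    also have "\<dots> = sqnorm (?A a) / 4 + sqnorm (?A b) / 4 + (\<integral>y. Re (?A a y * cnj (?A b y)) \<partial>Q) / 2"
      by (rule lin[OF L2_funD(2)[OF AL] L2_funD(2)[OF AL] integrable_Re[OF L2_inner_integrable[OF AL AL]]])
    also have "(\<integral>y. Re (?A a y * cnj (?A b y)) \<partial>Q) = Re (\<integral>y. ?A a y * cnj (?A b y) \<partial>Q)"
      by (rule integral_Re[OF L2_inner_integrable[OF AL AL]])
    also have "\<dots> \<le> cmod (\<integral>y. ?A a y * cnj (?A b y) \<partial>Q)" by (rule complex_Re_le_cmod)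
    finally show ?thesis by (simp only: add_divide_distrib)
  qed
  define C where "C = sqnorm F + 1"
  have C: "C > 0" by (simp add: C_def add_nonneg_pos)
  have "\<exists>a. sqnorm (?A a) \<le> (3/4) ^ k * C" for k
  proof (induction k)
    case 0
    have "sqnorm (?A (Sample 0)) = sqnorm F"
      by (intro Bochner_Integration.integral_cong refl) (simp add: flow_0)
    then show ?case by (intro exI[of _ "Sample 0"]) (simp add: C_def)
  next
    case (Suc k)
    then obtain a where a: "sqnorm (?A a) \<le> (3/4) ^ k * C" by blast
    have "(3/4) ^ k * C / 2 > 0" using C by simp
    from decor[OF this, of a a] obtain s where
      s: "cmod (\<integral>y. ?A a y * cnj (?A (delay s a) y) \<partial>Q) \<le> (3/4) ^ k * C / 2" by blast
    have "sqnorm (?A (Midpoint a (delay s a))) \<le> (3/4) ^ Suc k * C"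
      using mid[of a "delay s a"] sqnorm_delay[OF F, of \<theta> s a] a s by simp
    then show ?case by blast
  qed
  note bound = this
  have "\<epsilon> / C > 0" using \<epsilon> C by simp
  from real_arch_pow_inv[OF this, of "3/4"] obtain k where "(3/4::real) ^ k < \<epsilon> / C" by auto
  then have k: "(3/4) ^ k * C < \<epsilon>" using C by (simp only: pos_less_divide_eq)
  from bound[of k] obtain a where "sqnorm (?A a) \<le> (3/4) ^ k * C" ..
  from le_less_trans[OF this k] show ?thesis ..
qed

end

section \<open>The unit suspension as a flow\<close>

definition int_vec :: "int ^ 'd \<Rightarrow> real ^ 'd::finite" where
  "int_vec n = (\<chi> i. real_of_int (n $ i))"

definition floor_vec :: "real ^ 'd \<Rightarrow> int ^ 'd::finite" where
  "floor_vec z = (\<chi> i. \<lfloor>z $ i\<rfloor>)"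

definition frac_vec :: "real ^ 'd \<Rightarrow> real ^ 'd::finite" where
  "frac_vec z = (\<chi> i. frac (z $ i))"

lemma frac_vec_eq: "frac_vec z = z - int_vec (floor_vec z)"
  by (simp add: frac_vec_def int_vec_def floor_vec_def vec_eq_iff frac_def)

text \<open>The translates of the half-open cube by integer vectors tile the space.\<close>
lemma diff_int_vec_in_unit_cube: "z - int_vec n \<in> unit_cube \<longleftrightarrow> n = floor_vec z"
proof -
  have "0 \<le> z $ i - real_of_int (n $ i) \<and> z $ i - real_of_int (n $ i) < 1 \<longleftrightarrow> n $ i = \<lfloor>z $ i\<rfloor>" for i
    by linarith
  then show ?thesis by (simp add: unit_cube_def int_vec_def floor_vec_def vec_eq_iff)
qed

lemma frac_vec_in_unit_cube: "frac_vec z \<in> unit_cube"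
  by (simp add: frac_vec_eq diff_int_vec_in_unit_cube)

lemma int_vec_0 [simp]: "int_vec 0 = 0"
  by (simp add: int_vec_def vec_eq_iff)

lemma in_unit_cube_iff_floor: "z \<in> unit_cube \<longleftrightarrow> floor_vec z = 0"
  using diff_int_vec_in_unit_cube[of z 0] by auto

lemma suspension_eq: "suspension T t (x, r) = (T (floor_vec (t + r)) x, frac_vec (t + r))"
  by (simp add: suspension_def floor_vec_def frac_vec_def)

lemma unit_cube_borel [measurable]: "unit_cube \<in> sets borel"
proof -
  have "unit_cube = (\<Inter>i. {r::real^'d. 0 \<le> r $ i} \<inter> {r. r $ i < 1})" by (auto simp: unit_cube_def)
  also have "\<dots> \<in> sets borel"
    by (intro sets.countable_INT'' sets.Int borel_closed borel_open closed_Collect_le open_Collect_less continuous_intros) auto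
  finally show ?thesis .
qed

lemma unit_cube_sandwich: "box 0 1 \<subseteq> (unit_cube :: (real^'d::finite) set)" "(unit_cube :: (real^'d) set) \<subseteq> cbox 0 1"
  by (auto simp: unit_cube_def mem_box_cart less_imp_le)

lemma emeasure_unit_box: "emeasure lborel (box 0 (1::real^'d::finite)) = 1" "emeasure lborel (cbox 0 (1::real^'d)) = 1"
proof -
  have b: "(1::real^'d) \<bullet> b = 1" if "b \<in> Basis" for b
    using that by (auto simp: Basis_vec_def inner_axis)
  then show "emeasure lborel (box 0 (1::real^'d)) = 1" "emeasure lborel (cbox 0 (1::real^'d)) = 1"
    by (simp_all add: emeasure_lborel_box_eq emeasure_lborel_cbox_eq)
qed

lemma emeasure_unit_cube: "emeasure lborel (unit_cube :: (real^'d::finite) set) = 1"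
proof (rule antisym)
  show "emeasure lborel (unit_cube :: (real^'d) set) \<le> 1"
    using emeasure_mono[OF unit_cube_sandwich(2), of lborel] by (simp add: emeasure_unit_box)
  show "1 \<le> emeasure lborel (unit_cube :: (real^'d) set)"
    using emeasure_mono[OF unit_cube_sandwich(1), of lborel] by (simp add: emeasure_unit_box)
qed

lemma space_cube_measure: "space cube_measure = unit_cube"
  by (simp add: cube_measure_def space_restrict_space)

lemma sets_cube_measure: "A \<in> sets cube_measure \<longleftrightarrow> A \<in> sets borel \<and> A \<subseteq> unit_cube"
  unfolding cube_measure_def by (subst sets_restrict_space_iff) auto

lemma emeasure_cube_measure:
  "A \<in> sets borel \<Longrightarrow> A \<subseteq> unit_cube \<Longrightarrow> emeasure cube_measure A = emeasure lborel A"
  unfolding cube_measure_def by (intro emeasure_restrict_space) auto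

lemma prob_space_cube_measure: "prob_space (cube_measure :: (real^'d::finite) measure)"
  by (rule prob_spaceI) (simp add: space_cube_measure emeasure_cube_measure emeasure_unit_cube)

lemma measurable_cube_measure_borel: "f \<in> borel \<rightarrow>\<^sub>M N \<Longrightarrow> f \<in> cube_measure \<rightarrow>\<^sub>M N"
  unfolding cube_measure_def by (intro measurable_restrict_space1) simp

lemma AE_cube_interior: "AE r in (cube_measure :: (real^'d::finite) measure). r \<in> box 0 1"
proof -
  have "emeasure lborel (unit_cube - box 0 (1::real^'d)) = 0"
    using emeasure_Diff[of lborel "box 0 (1::real^'d)" unit_cube] unit_cube_sandwich(1)
    by (simp add: emeasure_unit_box emeasure_unit_cube)
  then have "unit_cube - box 0 (1::real^'d) \<in> null_sets cube_measure"
    by (auto simp: null_sets_def sets_cube_measure emeasure_cube_measure)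
  then show ?thesis by (rule AE_I') (auto simp: space_cube_measure)
qed

lemma measurable_floor_vec [measurable]: "floor_vec \<in> borel \<rightarrow>\<^sub>M count_space UNIV"
proof (subst measurable_count_space_eq2_countable, intro conjI ballI)
  fix n :: "int ^ 'a"
  have "floor_vec -` {n} \<inter> space borel = (\<lambda>z. z - int_vec n) -` unit_cube \<inter> space borel"
    by (auto simp: diff_int_vec_in_unit_cube)
  also have "\<dots> \<in> sets borel" by (intro measurable_sets[OF _ unit_cube_borel]) measurable
  finally show "floor_vec -` {n} \<inter> space borel \<in> sets borel" .
qed simp

lemma measurable_frac_vec [measurable]: "frac_vec \<in> borel \<rightarrow>\<^sub>M borel"
proof -
  have "(\<lambda>z. z - int_vec n) \<in> borel \<rightarrow>\<^sub>M borel" for n :: "int ^ 'a" by measurable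
  from measurable_compose_countable[OF this measurable_floor_vec] show ?thesis
    by (simp add: frac_vec_eq[abs_def])
qed

lemma measurable_rotation:
  "(\<lambda>r. frac_vec (t + r)) \<in> cube_measure \<rightarrow>\<^sub>M cube_measure"
proof -
  have "(\<lambda>r. frac_vec (t + r)) \<in> borel \<rightarrow>\<^sub>M borel" by measurable
  then have "(\<lambda>r. frac_vec (t + r)) \<in> cube_measure \<rightarrow>\<^sub>M borel" by (rule measurable_cube_measure_borel)
  then show ?thesis unfolding cube_measure_def
    by (intro measurable_restrict_space2) (auto simp: frac_vec_in_unit_cube)
qed

text \<open>Cutting the translated cube along the integer tiling and moving the pieces back to the cube
reassembles it, and translations preserve Lebesgue measure.\<close>
lemma distr_rotation:
  "distr cube_measure cube_measure (\<lambda>r. frac_vec (t + r)) = (cube_measure :: (real^'d::finite) measure)"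
proof (rule measure_eqI)
  fix A :: "(real^'d) set" assume "A \<in> sets (distr cube_measure cube_measure (\<lambda>r. frac_vec (t + r)))"
  then have A: "A \<in> sets borel" "A \<subseteq> unit_cube" by (auto simp: sets_cube_measure)
  define B where "B n = {r \<in> unit_cube. t + r - int_vec n \<in> A}" for n
  define C where "C n = {s \<in> A. s - (t - int_vec n) \<in> unit_cube}" for n
  have Cm: "C n \<in> sets borel" for n
  proof -
    have "C n = A \<inter> ((\<lambda>s. s - (t - int_vec n)) -` unit_cube \<inter> space borel)" by (auto simp: C_def)
    also have "\<dots> \<in> sets borel" by (intro sets.Int A measurable_sets[OF _ unit_cube_borel]) measurable
    finally show ?thesis .
  qed
  have BC: "B n = (+) (t - int_vec n) -` C n \<inter> space lborel" for n
    by (auto simp: B_def C_def algebra_simps)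
  have Bm: "B n \<in> sets borel" for n
  proof -
    have "(+) (t - int_vec n) \<in> lborel \<rightarrow>\<^sub>M borel" by measurable
    from measurable_sets[OF this Cm] show ?thesis unfolding BC by simp
  qed
  have eq: "emeasure lborel (B n) = emeasure lborel (C n)" for n
  proof -
    have "emeasure (distr lborel borel ((+) (t - int_vec n))) (C n) = emeasure lborel (B n)"
      unfolding BC by (intro emeasure_distr Cm) measurable
    then show ?thesis by (simp add: lborel_distr_plus)
  qed
  have Bf: "r \<in> B n \<longleftrightarrow> r \<in> unit_cube \<and> n = floor_vec (t + r) \<and> frac_vec (t + r) \<in> A" for n r
    unfolding B_def using A(2) diff_int_vec_in_unit_cube[of "t + r" n] by (auto simp: frac_vec_eq)
  have Cf: "s \<in> C n \<longleftrightarrow> s \<in> A \<and> n = - floor_vec (s - t)" for n s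
  proof -
    have "s - (t - int_vec n) = (s - t) - int_vec (- n)" by (simp add: int_vec_def vec_eq_iff)
    then have "s - (t - int_vec n) \<in> unit_cube \<longleftrightarrow> - n = floor_vec (s - t)"
      by (simp only: diff_int_vec_in_unit_cube)
    also have "\<dots> \<longleftrightarrow> n = - floor_vec (s - t)" by (metis minus_minus)
    finally show ?thesis by (simp add: C_def)
  qed
  have "emeasure (distr cube_measure cube_measure (\<lambda>r. frac_vec (t + r))) A
      = emeasure cube_measure ((\<lambda>r. frac_vec (t + r)) -` A \<inter> space cube_measure)"
    using A by (intro emeasure_distr measurable_rotation) (simp add: sets_cube_measure)
  also have "(\<lambda>r. frac_vec (t + r)) -` A \<inter> space cube_measure = (\<Union>n. B n)"
    using Bf by (auto simp: space_cube_measure)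
  also have "emeasure cube_measure (\<Union>n. B n) = emeasure lborel (\<Union>n. B n)"
    using Bm by (intro emeasure_cube_measure sets.countable_UN'') (auto simp: B_def)
  also have "\<dots> = (\<integral>\<^sup>+n. emeasure lborel (B n) \<partial>count_space UNIV)"
    using Bm Bf by (intro emeasure_UN_countable) (auto simp: disjoint_family_on_def)
  also have "\<dots> = (\<integral>\<^sup>+n. emeasure lborel (C n) \<partial>count_space UNIV)" by (simp add: eq)
  also have "\<dots> = emeasure lborel (\<Union>n. C n)"
    using Cm Cf by (intro emeasure_UN_countable[symmetric]) (auto simp: disjoint_family_on_def)
  also have "(\<Union>n. C n) = A" using Cf by auto
  also have "emeasure lborel A = emeasure cube_measure A" using A by (simp add: emeasure_cube_measure)
  finally show "emeasure (distr cube_measure cube_measure (\<lambda>r. frac_vec (t + r))) A = emeasure cube_measure A" .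
qed simp

lemma mp_actionsD:
  assumes "T \<in> mp_actions M"
  shows "T n \<in> M \<rightarrow>\<^sub>M M" "distr M M (T n) = M" "x \<in> space M \<Longrightarrow> T 0 x = x"
    "x \<in> space M \<Longrightarrow> T (m + n) x = T m (T n x)"
  using assms by (auto simp: mp_actions_def measure_preserving_def)

lemma measurable_suspension:
  assumes "T \<in> mp_actions M"
  shows "suspension T t \<in> suspension_measure M \<rightarrow>\<^sub>M suspension_measure M"
proof -
  note [measurable] = mp_actionsD(1)[OF assms] measurable_rotation
  have [measurable]: "(\<lambda>r. floor_vec (t + r)) \<in> cube_measure \<rightarrow>\<^sub>M count_space UNIV"
    by (rule measurable_cube_measure_borel) measurable
  have "(\<lambda>y. T n (fst y)) \<in> M \<Otimes>\<^sub>M cube_measure \<rightarrow>\<^sub>M M" for n by measurable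
  moreover have "(\<lambda>y. floor_vec (t + snd y)) \<in> M \<Otimes>\<^sub>M cube_measure \<rightarrow>\<^sub>M count_space UNIV" by measurable
  ultimately have [measurable]: "(\<lambda>y. T (floor_vec (t + snd y)) (fst y)) \<in> M \<Otimes>\<^sub>M cube_measure \<rightarrow>\<^sub>M M"
    by (rule measurable_compose_countable)
  have "suspension T t = (\<lambda>y. (T (floor_vec (t + snd y)) (fst y), frac_vec (t + snd y)))"
    by (auto simp: fun_eq_iff suspension_eq)
  then show ?thesis unfolding suspension_measure_def by simp
qed

text \<open>On each fibre the suspension acts by one of the maps \<open>T n\<close>, and on the base by a rotation
of the torus.\<close>
lemma distr_suspension:
  assumes M: "prob_space M" and T: "T \<in> mp_actions M"
  shows "distr (suspension_measure M) (suspension_measure M) (suspension T t) = suspension_measure M"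
proof (rule measure_eqI)
  interpret M: prob_space M by fact
  interpret C: prob_space "cube_measure :: (real^'b) measure" by (rule prob_space_cube_measure)
  interpret P: pair_prob_space M "cube_measure :: (real^'b) measure" ..
  fix Q assume "Q \<in> sets (distr (suspension_measure M) (suspension_measure M) (suspension T t))"
  then have Q: "Q \<in> sets (M \<Otimes>\<^sub>M cube_measure)" by (simp add: suspension_measure_def)
  let ?S = "suspension T t -` Q \<inter> space (M \<Otimes>\<^sub>M cube_measure)"
  let ?g = "\<lambda>r. emeasure M ((\<lambda>x. (x, r)) -` Q)"
  have S: "?S \<in> sets (M \<Otimes>\<^sub>M cube_measure)"
    using measurable_sets[OF measurable_suspension[OF T]] Q by (simp add: suspension_measure_def)
  have gm: "?g \<in> borel_measurable cube_measure" by (rule P.measurable_emeasure_Pair2[OF Q])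
  have sec: "emeasure M ((\<lambda>x. (x, r)) -` ?S) = ?g (frac_vec (t + r))" if r: "r \<in> space cube_measure" for r
  proof -
    have m: "(\<lambda>x. (x, frac_vec (t + r))) -` Q \<in> sets M" by (rule sets_Pair2[OF Q])
    have "(\<lambda>x. (x, r)) -` ?S = T (floor_vec (t + r)) -` ((\<lambda>x. (x, frac_vec (t + r))) -` Q) \<inter> space M"
      using r by (auto simp: suspension_eq space_pair_measure)
    then show ?thesis
      using emeasure_distr[OF mp_actionsD(1)[OF T] m, of "floor_vec (t + r)"] mp_actionsD(2)[OF T] by simp
  qed
  have "emeasure (distr (suspension_measure M) (suspension_measure M) (suspension T t)) Q = emeasure (M \<Otimes>\<^sub>M cube_measure) ?S"
    using emeasure_distr[OF measurable_suspension[OF T], of Q t] Q by (simp add: suspension_measure_def)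
  also have "\<dots> = (\<integral>\<^sup>+r. emeasure M ((\<lambda>x. (x, r)) -` ?S) \<partial>cube_measure)"
    by (rule P.emeasure_pair_measure_alt2[OF S])
  also have "\<dots> = (\<integral>\<^sup>+r. ?g (frac_vec (t + r)) \<partial>cube_measure)"
    by (rule nn_integral_cong) (rule sec)
  also have "\<dots> = (\<integral>\<^sup>+r. ?g r \<partial>distr cube_measure cube_measure (\<lambda>r. frac_vec (t + r)))"
    by (rule nn_integral_distr[symmetric, OF measurable_rotation]) (simp add: gm)
  also have "\<dots> = emeasure (M \<Otimes>\<^sub>M cube_measure) Q"
    unfolding distr_rotation by (rule P.emeasure_pair_measure_alt2[OF Q, symmetric])
  finally show "emeasure (distr (suspension_measure M) (suspension_measure M) (suspension T t)) Q = emeasure (suspension_measure M) Q"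
    by (simp add: suspension_measure_def)
qed simp

lemma suspension_add:
  assumes T: "T \<in> mp_actions M" and y: "y \<in> space (suspension_measure M)"
  shows "suspension T (s + t) y = suspension T s (suspension T t y)"
proof -
  obtain x r where y': "y = (x, r)" "x \<in> space M" using y by (auto simp: suspension_measure_def space_pair_measure)
  have "floor_vec (s + t + r) = floor_vec (s + frac_vec (t + r)) + floor_vec (t + r)"
  proof -
    have "\<lfloor>s $ i + frac (t $ i + r $ i)\<rfloor> + \<lfloor>t $ i + r $ i\<rfloor> = \<lfloor>s $ i + t $ i + r $ i\<rfloor>" for i
      unfolding frac_def by linarith
    then show ?thesis by (simp add: floor_vec_def frac_vec_def vec_eq_iff)
  qed
  moreover have "frac_vec (s + frac_vec (t + r)) = frac_vec (s + t + r)"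
  proof -
    have "frac (s $ i + frac (t $ i + r $ i)) = frac (s $ i + t $ i + r $ i)" for i
      unfolding frac_def
      using floor_diff_of_int[of "s $ i + t $ i + r $ i" "\<lfloor>t $ i + r $ i\<rfloor>"] by (simp add: algebra_simps)
    then show ?thesis by (simp add: frac_vec_def vec_eq_iff)
  qed
  ultimately show ?thesis
    using mp_actionsD(4)[OF T y'(2)] by (simp add: y' suspension_eq)
qed

lemma suspension_0:
  assumes T: "T \<in> mp_actions M" and y: "y \<in> space (suspension_measure M)"
  shows "suspension T 0 y = y"
proof -
  obtain x r where y': "y = (x, r)" "x \<in> space M" "r \<in> unit_cube"
    using y by (auto simp: suspension_measure_def space_pair_measure space_cube_measure)
  have "floor_vec r = 0" using y'(3) by (simp add: in_unit_cube_iff_floor)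
  then show ?thesis using mp_actionsD(3)[OF T y'(2)] by (simp add: y' suspension_eq frac_vec_eq)
qed

lemma prob_space_suspension:
  assumes "prob_space M" shows "prob_space (suspension_measure M :: ('a \<times> (real^'d::finite)) measure)"
proof -
  interpret M: prob_space M by fact
  interpret C: prob_space "cube_measure :: (real^'d) measure" by (rule prob_space_cube_measure)
  interpret P: pair_prob_space M "cube_measure :: (real^'d) measure" ..
  show ?thesis unfolding suspension_measure_def by (rule P.prob_space_axioms)
qed

lemma directional_flow:
  assumes M: "prob_space M" and T: "T \<in> mp_actions M"
  shows "mp_flow (suspension_measure M) (\<lambda>t. suspension T (t *\<^sub>R v))"
proof -
  interpret prob_space "suspension_measure M :: ('a \<times> (real^'b)) measure" by (rule prob_space_suspension[OF M])
  show ?thesis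
    by unfold_locales
      (use T in \<open>simp_all add: measurable_suspension distr_suspension[OF M] suspension_0 suspension_add scaleR_add_left\<close>)
qed

section \<open>Test functions on the suspension\<close>

text \<open>Indicators minus their mean: their products with functions of the fibre variable span a dense
subspace of the orthogonal complement of the functions of the fibre variable alone.\<close>
definition centred :: "'a measure \<Rightarrow> 'a set \<Rightarrow> 'a \<Rightarrow> complex" where
  "centred M A x = complex_of_real (indicator A x - measure M A)"

text \<open>A Lipschitz function supported in \<open>B\<close>. For \<open>B\<close> inside the open cube it vanishes at the faces, where
the suspension passes from one fibre to the next.\<close>
definition bump :: "nat \<Rightarrow> (real ^ 'd::finite) set \<Rightarrow> real ^ 'd \<Rightarrow> real" where
  "bump k B s = min 1 (real k * infdist s (- B))"

definition test_fun :: "'a measure \<Rightarrow> 'a set \<Rightarrow> nat \<Rightarrow> (real ^ 'd::finite) set \<Rightarrow> 'a \<times> (real ^ 'd) \<Rightarrow> complex" where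
  "test_fun M A k B = (\<lambda>(x, s). centred M A x * complex_of_real (bump k B s))"

lemma bump_bounds: "0 \<le> bump k B s" "bump k B s \<le> 1"
  by (auto simp: bump_def infdist_nonneg)

lemma bump_outside: "s \<notin> B \<Longrightarrow> bump k B s = 0"
  by (simp add: bump_def)

lemma bump_lipschitz: "\<bar>bump k B s - bump k B s'\<bar> \<le> real k * dist s s'"
proof -
  have "\<bar>bump k B s - bump k B s'\<bar> \<le> \<bar>real k * infdist s (- B) - real k * infdist s' (- B)\<bar>"
    unfolding bump_def by linarith
  also have "\<dots> = real k * \<bar>infdist s (- B) - infdist s' (- B)\<bar>"
    by (simp add: right_diff_distrib[symmetric] abs_mult)
  also have "\<dots> \<le> real k * dist s s'"
    by (intro mult_left_mono infdist_triangle_abs) auto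
  finally show ?thesis .
qed

lemma bump_tendsto_indicator:
  assumes "open B" "B \<noteq> UNIV"
  shows "(\<lambda>k. bump k B s) \<longlonglongrightarrow> indicator B s"
proof (cases "s \<in> B")
  case True
  have pos: "infdist s (- B) > 0"
    using assms True by (intro infdist_pos_not_in_closed) auto
  obtain K :: nat where K: "1 / infdist s (- B) < real K" using reals_Archimedean2 by blast
  have "\<forall>\<^sub>F k in sequentially. bump k B s = 1"
    using eventually_ge_at_top[of K]
  proof eventually_elim
    case (elim k)
    then have "1 / infdist s (- B) < real k" using K by (meson less_le_trans of_nat_le_iff)
    then have "1 \<le> real k * infdist s (- B)" using pos by (simp add: field_simps)
    then show ?case by (simp add: bump_def)
  qed
  then show ?thesis using True by (simp add: tendsto_eventually)
next
  case False
  then show ?thesis by (simp add: bump_outside)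
qed

lemma measurable_bump [measurable]: "bump k B \<in> borel_measurable borel"
  unfolding bump_def[abs_def] by (intro borel_measurable_continuous_onI continuous_intros)

lemma measurable_bump_cube [measurable]: "bump k B \<in> borel_measurable cube_measure"
  by (intro measurable_cube_measure_borel measurable_bump)

lemma cmod_cis_diff_le: "cmod (cis a - cis b) \<le> \<bar>a - b\<bar>"
proof -
  have "cis a - cis b = cis b * (cis (a - b) - 1)"
    by (simp add: right_diff_distrib cis_mult)
  then have "cmod (cis a - cis b) = cmod (cis (a - b) - 1)" by (simp add: norm_mult)
  also have "\<dots> = 2 * \<bar>sin ((a - b) / 2)\<bar>"
    using dist_exp_i_1[of "a - b"] by (simp add: dist_norm cis_conv_exp)
  also have "\<dots> \<le> \<bar>a - b\<bar>" using abs_sin_x_le_abs_x[of "(a - b) / 2"] by simp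
  finally show ?thesis .
qed

lemma cmod_midpoint_diff:
  "cmod ((u + v) / 2 - (u' + v') / 2) \<le> (cmod (u - u') + cmod (v - v')) / 2"
proof -
  have "(u + v) / 2 - (u' + v') / 2 = ((u - u') + (v - v')) / 2" by (simp add: diff_divide_distrib add_divide_distrib)
  then have "cmod ((u + v) / 2 - (u' + v') / 2) = cmod ((u - u') + (v - v')) / 2" by (simp only: norm_divide norm_numeral)
  then show ?thesis using norm_triangle_ineq[of "u - u'" "v - v'"] by simp
qed

context
  fixes M :: "'a measure" and A :: "'a set"
  assumes prob: "prob_space M" and A: "A \<in> sets M"
begin

interpretation M: prob_space M by (rule prob)

lemma centred_bound: "cmod (centred M A x) \<le> 1"
proof -
  have "\<bar>indicator A x - measure M A\<bar> \<le> 1"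
    using M.prob_le_1[of A] measure_nonneg[of M A] by (cases "x \<in> A") (simp_all add: abs_le_iff del: measure_nonneg)
  then show ?thesis by (simp add: centred_def flip: of_real_diff)
qed

lemma measurable_centred [measurable]: "centred M A \<in> borel_measurable M"
  unfolding centred_def[abs_def] using A by measurable

lemma centred_L2: "centred M A \<in> L2_fun M"
  by (rule M.L2_fun_bounded[OF measurable_centred centred_bound])

lemma integral_centred: "(\<integral>x. centred M A x \<partial>M) = 0"
proof -
  have "(\<integral>x. centred M A x \<partial>M) = complex_of_real (\<integral>x. indicator A x - measure M A \<partial>M)"
    unfolding centred_def by (rule integral_complex_of_real)
  also have "(\<integral>x. indicator A x - measure M A \<partial>M) = 0"
    using A M.emeasure_eq_measure by (simp add: M.prob_space)
  finally show ?thesis by simp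
qed

lemma test_fun_bound: "cmod (test_fun M A k B y) \<le> 1"
proof (cases y)
  case (Pair x s)
  have "cmod (centred M A x) * \<bar>bump k B s\<bar> \<le> 1 * 1"
    using centred_bound[of x] bump_bounds[of k B s] by (intro mult_mono) auto
  then show ?thesis by (simp add: Pair test_fun_def norm_mult)
qed

lemma measurable_test_fun [measurable]: "test_fun M A k B \<in> borel_measurable (suspension_measure M)"
  unfolding test_fun_def suspension_measure_def by measurable

lemma test_fun_L2: "test_fun M A k B \<in> L2_fun (suspension_measure M)"
proof -
  interpret Q: prob_space "suspension_measure M :: ('a \<times> (real^'b)) measure" by (rule prob_space_suspension[OF prob])
  show ?thesis by (rule Q.L2_fun_bounded[OF measurable_test_fun test_fun_bound])
qed

text \<open>Small displacements move the test functions little, with a bound that does not involve the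
action. If the displacement stays in the cube, this is the Lipschitz bound. If it leaves the
cube, the bump vanishes somewhere within the distance \<open>norm \<delta>\<close> of both the old and the
new position.\<close>
lemma test_fun_modulus:
  assumes T: "T \<in> mp_actions M" and B: "B \<subseteq> unit_cube"
    and z: "z \<in> space (suspension_measure M)"
  shows "cmod (test_fun M A k B (suspension T \<delta> z) - test_fun M A k B z) \<le> 2 * real k * norm \<delta>"
proof -
  obtain x s where z': "z = (x, s)" "x \<in> space M" "s \<in> unit_cube"
    using z by (auto simp: suspension_measure_def space_pair_measure space_cube_measure)
  let ?h = "bump k B" and ?n = "floor_vec (\<delta> + s)"
  have lip: "\<bar>?h (\<delta> + u) - ?h u\<bar> \<le> real k * norm \<delta>" for u
    using bump_lipschitz[of k B "\<delta> + u" u] by (simp add: dist_norm)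
  have small: "cmod (centred M A w * complex_of_real b) \<le> \<bar>b\<bar>" for w b
    using mult_right_mono[OF centred_bound[of w], of "\<bar>b\<bar>"] by (simp add: norm_mult)
  show ?thesis
  proof (cases "?n = 0")
    case True
    have "test_fun M A k B (suspension T \<delta> z) - test_fun M A k B z = centred M A x * complex_of_real (?h (\<delta> + s) - ?h s)"
      using mp_actionsD(3)[OF T z'(2)] True
      by (simp add: z' suspension_eq test_fun_def frac_vec_eq right_diff_distrib)
    then have "cmod (test_fun M A k B (suspension T \<delta> z) - test_fun M A k B z) \<le> \<bar>?h (\<delta> + s) - ?h s\<bar>"
      using small by (simp only:)
    also have "\<dots> \<le> 2 * real k * norm \<delta>" using lip[of s] by (simp add: order_trans[OF _ mult_right_mono])
    finally show ?thesis .
  next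
    case False
    have "\<delta> + s \<notin> unit_cube" using False by (simp add: in_unit_cube_iff_floor)
    then have "?h (\<delta> + s) = 0" using B by (intro bump_outside) auto
    then have 1: "\<bar>?h s\<bar> \<le> real k * norm \<delta>" using lip[of s] by simp
    have "s - int_vec ?n \<notin> unit_cube"
      unfolding diff_int_vec_in_unit_cube using False z'(3)[unfolded in_unit_cube_iff_floor] by simp
    then have "?h (s - int_vec ?n) = 0" using B by (intro bump_outside) auto
    moreover have "frac_vec (\<delta> + s) = \<delta> + (s - int_vec ?n)" by (simp add: frac_vec_eq)
    ultimately have 2: "\<bar>?h (frac_vec (\<delta> + s))\<bar> \<le> real k * norm \<delta>" using lip[of "s - int_vec ?n"] by simp
    have "cmod (test_fun M A k B (suspension T \<delta> z) - test_fun M A k B z)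
       \<le> cmod (test_fun M A k B (suspension T \<delta> z)) + cmod (test_fun M A k B z)" by (rule norm_triangle_ineq4)
    also have "\<dots> \<le> \<bar>?h (frac_vec (\<delta> + s))\<bar> + \<bar>?h s\<bar>"
      using small by (auto simp: z' suspension_eq test_fun_def intro!: add_mono)
    finally show ?thesis using 1 2 by simp
  qed
qed

text \<open>The radius \<open>\<rho>\<close> serves all actions at once, which is what makes the open conditions
on \<open>(v, \<theta>)\<close> and on the action combine.\<close>
lemma twisted_average_equicontinuous:
  fixes B :: "(real ^ 'd::finite) set"
  assumes B: "B \<subseteq> unit_cube" and "\<eta> > 0"
  shows "\<exists>\<rho>>0. \<forall>T\<in>mp_actions M. \<forall>v v' \<theta> \<theta>'. dist v v' < \<rho> \<longrightarrow> dist \<theta> \<theta>' < \<rho> \<longrightarrow>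
     (\<forall>y\<in>space (suspension_measure M).
       cmod (twisted_average (\<lambda>t. suspension T (t *\<^sub>R v)) \<theta> (test_fun M A k B) a y
         - twisted_average (\<lambda>t. suspension T (t *\<^sub>R v')) \<theta>' (test_fun M A k B) a y) \<le> \<eta>)"
proof (induction a)
  case (Sample t)
  define C where "C = 2 * pi * \<bar>t\<bar> + 2 * real k * \<bar>t\<bar> + 1"
  have C: "C > 0" unfolding C_def by (intro add_nonneg_pos) auto
  have "cmod (twisted_average (\<lambda>t. suspension T (t *\<^sub>R v)) \<theta> (test_fun M A k B) (Sample t) y
         - twisted_average (\<lambda>t. suspension T (t *\<^sub>R v')) \<theta>' (test_fun M A k B) (Sample t) y) \<le> \<eta>"
    if T: "T \<in> mp_actions M" and v: "dist v v' < \<eta> / C" and th: "dist \<theta> \<theta>' < \<eta> / C"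
      and y: "y \<in> space (suspension_measure M)" for T v v' \<theta> \<theta>' and y :: "'a \<times> (real^'d)"
  proof -
    let ?F = "test_fun M A k B"
    let ?c = "cis (- (2 * pi * \<theta> * t))" and ?c' = "cis (- (2 * pi * \<theta>' * t))"
    let ?y = "suspension T (t *\<^sub>R v) y" and ?y' = "suspension T (t *\<^sub>R v') y"
    have "t *\<^sub>R v = t *\<^sub>R (v - v') + t *\<^sub>R v'" by (simp add: algebra_simps)
    then have y2: "?y = suspension T (t *\<^sub>R (v - v')) ?y'" using suspension_add[OF T y] by simp
    have "?c * ?F ?y - ?c' * ?F ?y' = (?c - ?c') * ?F ?y + ?c' * (?F ?y - ?F ?y')" by (simp add: algebra_simps)
    then have "cmod (?c * ?F ?y - ?c' * ?F ?y') \<le> cmod ((?c - ?c') * ?F ?y) + cmod (?c' * (?F ?y - ?F ?y'))"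
      using norm_triangle_ineq by simp
    also have "cmod ((?c - ?c') * ?F ?y) \<le> \<bar>- (2 * pi * \<theta> * t) - - (2 * pi * \<theta>' * t)\<bar> * 1"
      unfolding norm_mult by (intro mult_mono cmod_cis_diff_le test_fun_bound) auto
    also have "\<bar>- (2 * pi * \<theta> * t) - - (2 * pi * \<theta>' * t)\<bar> * 1 = 2 * pi * \<bar>t\<bar> * dist \<theta> \<theta>'"
    proof -
      have "- (2 * pi * \<theta> * t) - - (2 * pi * \<theta>' * t) = - (2 * pi * t * (\<theta> - \<theta>'))" by (simp add: algebra_simps)
      then show ?thesis by (simp add: abs_mult dist_real_def)
    qed
    also have "cmod (?c' * (?F ?y - ?F ?y')) \<le> 2 * real k * norm (t *\<^sub>R (v - v'))"
      unfolding y2 norm_mult norm_cis mult_1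
      using measurable_space[OF measurable_suspension[OF T] y] by (intro test_fun_modulus[OF T B])
    also have "\<dots> = 2 * real k * \<bar>t\<bar> * dist v v'" by (simp add: dist_norm)
    also have "2 * pi * \<bar>t\<bar> * dist \<theta> \<theta>' + 2 * real k * \<bar>t\<bar> * dist v v' \<le> 2 * pi * \<bar>t\<bar> * (\<eta> / C) + 2 * real k * \<bar>t\<bar> * (\<eta> / C)"
      using v th by (intro add_mono mult_left_mono) auto
    also have "\<dots> = (C - 1) * (\<eta> / C)"
    proof -
      have "C - 1 = 2 * pi * \<bar>t\<bar> + 2 * real k * \<bar>t\<bar>" by (simp add: C_def)
      then show ?thesis by (simp only: distrib_right)
    qed
    also have "\<dots> \<le> \<eta>" using C \<open>\<eta> > 0\<close> by (simp add: field_simps)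
    finally show ?thesis by simp
  qed
  then show ?case using C \<open>\<eta> > 0\<close> by (intro exI[of _ "\<eta> / C"]) auto
next
  case (Midpoint a b)
  let ?D = "\<lambda>T v v' \<theta> \<theta>' a y.
       cmod (twisted_average (\<lambda>t. suspension T (t *\<^sub>R v)) \<theta> (test_fun M A k B) a y
         - twisted_average (\<lambda>t. suspension T (t *\<^sub>R v')) \<theta>' (test_fun M A k B) a y)"
  from Midpoint(1) obtain \<rho>1 where r1: "\<rho>1 > 0" and
    1: "\<forall>T\<in>mp_actions M. \<forall>v v' \<theta> \<theta>'. dist v v' < \<rho>1 \<longrightarrow> dist \<theta> \<theta>' < \<rho>1 \<longrightarrow>
     (\<forall>y\<in>space (suspension_measure M). ?D T v v' \<theta> \<theta>' a y \<le> \<eta>)" by (elim exE conjE)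
  from Midpoint(2) obtain \<rho>2 where r2: "\<rho>2 > 0" and
    2: "\<forall>T\<in>mp_actions M. \<forall>v v' \<theta> \<theta>'. dist v v' < \<rho>2 \<longrightarrow> dist \<theta> \<theta>' < \<rho>2 \<longrightarrow>
     (\<forall>y\<in>space (suspension_measure M). ?D T v v' \<theta> \<theta>' b y \<le> \<eta>)" by (elim exE conjE)
  have half: "cmod ((u + v) / 2 - (u' + v') / 2) \<le> \<eta>" if "cmod (u - u') \<le> \<eta>" "cmod (v - v') \<le> \<eta>" for u v u' v'
    by (rule order_trans[OF cmod_midpoint_diff]) (use that in simp)
  show ?case
  proof (rule exI[of _ "min \<rho>1 \<rho>2"], intro conjI ballI allI impI)
    show "0 < min \<rho>1 \<rho>2" using r1 r2 by simp
    fix T :: "('a, 'd) zd_map" and v v' :: "real^'d" and \<theta> \<theta>' :: real and y :: "'a \<times> (real^'d)"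
    assume h: "T \<in> mp_actions M" "dist v v' < min \<rho>1 \<rho>2" "dist \<theta> \<theta>' < min \<rho>1 \<rho>2" "y \<in> space (suspension_measure M)"
    have "?D T v v' \<theta> \<theta>' a y \<le> \<eta>" "?D T v v' \<theta> \<theta>' b y \<le> \<eta>"
      using 1[rule_format, OF h(1) _ _ h(4), of v v' \<theta> \<theta>'] 2[rule_format, OF h(1) _ _ h(4), of v v' \<theta> \<theta>'] h(2,3) by simp_all
    then show "?D T v v' \<theta> \<theta>' (Midpoint a b) y \<le> \<eta>" unfolding twisted_average.simps by (rule half)
  qed
qed

text \<open>A translation by a fixed vector meets only finitely many of the maps \<open>T n\<close>, so an average
depends on finitely many of them.\<close>
lemma twisted_average_action_continuous:
  fixes B :: "(real ^ 'd::finite) set" and v :: "real ^ 'd"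
  shows "\<exists>J. finite J \<and> (\<forall>T\<in>mp_actions M. \<forall>S\<in>mp_actions M.
     (\<integral>y. (cmod (twisted_average (\<lambda>t. suspension T (t *\<^sub>R v)) \<theta> (test_fun M A k B) a y
         - twisted_average (\<lambda>t. suspension S (t *\<^sub>R v)) \<theta> (test_fun M A k B) a y))\<^sup>2 \<partial>suspension_measure M)
      \<le> (\<Sum>n\<in>J. (L2_dist M (centred M A \<circ> T n) (centred M A \<circ> S n))\<^sup>2))"
proof (induction a)
  case (Sample t)
  interpret C: prob_space "cube_measure :: (real^'d) measure" by (rule prob_space_cube_measure)
  let ?Q = "suspension_measure M :: ('a \<times> (real^'d)) measure"
  let ?J = "{n :: int^'d. \<forall>i. n $ i \<in> {\<lfloor>(t *\<^sub>R v) $ i\<rfloor>, \<lfloor>(t *\<^sub>R v) $ i\<rfloor> + 1}}"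
  have finJ: "finite ?J" by (rule card_vec_box) auto
  have inJ: "floor_vec (t *\<^sub>R v + r) \<in> ?J" if "r \<in> unit_cube" for r
  proof -
    have "\<lfloor>a + b\<rfloor> \<in> {\<lfloor>a\<rfloor>, \<lfloor>a\<rfloor> + 1}" if "0 \<le> b" "b < 1" for a b :: real using that by auto linarith
    then show ?thesis using that by (simp add: floor_vec_def unit_cube_def)
  qed
  have "(\<integral>y. (cmod (twisted_average (\<lambda>t. suspension T (t *\<^sub>R v)) \<theta> (test_fun M A k B) (Sample t) y
         - twisted_average (\<lambda>t. suspension S (t *\<^sub>R v)) \<theta> (test_fun M A k B) (Sample t) y))\<^sup>2 \<partial>?Q)
      \<le> (\<Sum>n\<in>?J. (L2_dist M (centred M A \<circ> T n) (centred M A \<circ> S n))\<^sup>2)"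
    if T: "T \<in> mp_actions M" and S: "S \<in> mp_actions M" for T S
  proof -
    interpret FT: mp_flow ?Q "\<lambda>t. suspension T (t *\<^sub>R v)" by (rule directional_flow[OF prob T])
    interpret FS: mp_flow ?Q "\<lambda>t. suspension S (t *\<^sub>R v)" by (rule directional_flow[OF prob S])
    let ?F = "test_fun M A k B"
    let ?d = "\<lambda>n x. (cmod (centred M A (T n x) - centred M A (S n x)))\<^sup>2"
    have di: "integrable M (?d n)" for n
      using L2_fun_diff_integrable[OF L2_fun_comp[OF centred_L2 T] L2_fun_comp[OF centred_L2 S], of n n] by simp
    have fst_distr: "distr ?Q M fst = M" unfolding suspension_measure_def by (rule C.distr_pair_fst)
    have fm: "fst \<in> ?Q \<rightarrow>\<^sub>M M" unfolding suspension_measure_def by measurable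
    have qi: "integrable ?Q (\<lambda>y. ?d n (fst y))" for n
      using integrable_distr[OF fm, of "?d n"] di fst_distr by simp
    have "(\<integral>y. (cmod (twisted_average (\<lambda>t. suspension T (t *\<^sub>R v)) \<theta> ?F (Sample t) y
         - twisted_average (\<lambda>t. suspension S (t *\<^sub>R v)) \<theta> ?F (Sample t) y))\<^sup>2 \<partial>?Q)
        \<le> (\<integral>y. (\<Sum>n\<in>?J. ?d n (fst y)) \<partial>?Q)"
    proof (rule integral_mono)
      show "integrable ?Q (\<lambda>y. (cmod (twisted_average (\<lambda>t. suspension T (t *\<^sub>R v)) \<theta> ?F (Sample t) y
         - twisted_average (\<lambda>t. suspension S (t *\<^sub>R v)) \<theta> ?F (Sample t) y))\<^sup>2)"
        by (intro L2_fun_diff_integrable FT.L2_fun_average FS.L2_fun_average test_fun_L2)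
      show "integrable ?Q (\<lambda>y. \<Sum>n\<in>?J. ?d n (fst y))" by (intro Bochner_Integration.integrable_sum qi)
      fix y assume "y \<in> space ?Q"
      then obtain x r where y: "y = (x, r)" "r \<in> unit_cube"
        by (auto simp: suspension_measure_def space_pair_measure space_cube_measure)
      let ?n = "floor_vec (t *\<^sub>R v + r)" and ?h = "bump k B (frac_vec (t *\<^sub>R v + r))"
      let ?e = "centred M A (T ?n x) - centred M A (S ?n x)"
      have "twisted_average (\<lambda>t. suspension T (t *\<^sub>R v)) \<theta> ?F (Sample t) y
         - twisted_average (\<lambda>t. suspension S (t *\<^sub>R v)) \<theta> ?F (Sample t) y = cis (- (2 * pi * \<theta> * t)) * (?e * complex_of_real ?h)"
        by (simp add: y suspension_eq test_fun_def algebra_simps)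
      then have "cmod (twisted_average (\<lambda>t. suspension T (t *\<^sub>R v)) \<theta> ?F (Sample t) y
         - twisted_average (\<lambda>t. suspension S (t *\<^sub>R v)) \<theta> ?F (Sample t) y) = cmod ?e * \<bar>?h\<bar>"
        by (simp only: norm_mult norm_cis mult_1 norm_of_real)
      also have "\<dots> \<le> cmod ?e * 1" using bump_bounds[of k B "frac_vec (t *\<^sub>R v + r)"] by (intro mult_left_mono) auto
      finally have "(cmod (twisted_average (\<lambda>t. suspension T (t *\<^sub>R v)) \<theta> ?F (Sample t) y
         - twisted_average (\<lambda>t. suspension S (t *\<^sub>R v)) \<theta> ?F (Sample t) y))\<^sup>2 \<le> ?d ?n (fst y)"
        by (intro power_mono) (simp_all add: y)
      also have "\<dots> \<le> (\<Sum>n\<in>?J. ?d n (fst y))"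
        using inJ[OF y(2)] finJ by (intro member_le_sum) auto
      finally show "(cmod (twisted_average (\<lambda>t. suspension T (t *\<^sub>R v)) \<theta> ?F (Sample t) y
         - twisted_average (\<lambda>t. suspension S (t *\<^sub>R v)) \<theta> ?F (Sample t) y))\<^sup>2 \<le> (\<Sum>n\<in>?J. ?d n (fst y))" .
    qed
    also have "\<dots> = (\<Sum>n\<in>?J. \<integral>y. ?d n (fst y) \<partial>?Q)" by (rule Bochner_Integration.integral_sum[OF qi])
    also have "\<dots> = (\<Sum>n\<in>?J. (L2_dist M (centred M A \<circ> T n) (centred M A \<circ> S n))\<^sup>2)"
    proof (rule sum.cong[OF refl])
      fix n
      have "(\<integral>y. ?d n (fst y) \<partial>?Q) = (\<integral>x. ?d n x \<partial>M)"
        using integral_distr[OF fm, of "?d n"] fst_distr borel_measurable_integrable[OF di] by simp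
      also have "\<dots> = (L2_dist M (centred M A \<circ> T n) (centred M A \<circ> S n))\<^sup>2"
        by (simp add: L2_dist_def)
      finally show "(\<integral>y. ?d n (fst y) \<partial>?Q) = (L2_dist M (centred M A \<circ> T n) (centred M A \<circ> S n))\<^sup>2" .
    qed
    finally show ?thesis .
  qed
  then show ?case by (intro exI[of _ ?J] conjI ballI finJ)
next
  case (Midpoint a b)
  let ?Q = "suspension_measure M :: ('a \<times> (real^'d)) measure"
  let ?A = "\<lambda>T a. twisted_average (\<lambda>t. suspension T (t *\<^sub>R v)) \<theta> (test_fun M A k B) a"
  let ?s = "\<lambda>T S n. (L2_dist M (centred M A \<circ> T n) (centred M A \<circ> S n))\<^sup>2"
  from Midpoint(1) obtain J1 where J1: "finite J1" and
    1: "\<forall>T\<in>mp_actions M. \<forall>S\<in>mp_actions M. (\<integral>y. (cmod (?A T a y - ?A S a y))\<^sup>2 \<partial>?Q) \<le> (\<Sum>n\<in>J1. ?s T S n)"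
    by (elim exE conjE)
  from Midpoint(2) obtain J2 where J2: "finite J2" and
    2: "\<forall>T\<in>mp_actions M. \<forall>S\<in>mp_actions M. (\<integral>y. (cmod (?A T b y - ?A S b y))\<^sup>2 \<partial>?Q) \<le> (\<Sum>n\<in>J2. ?s T S n)"
    by (elim exE conjE)
  note J = J1 J2
  have "(\<integral>y. (cmod (?A T (Midpoint a b) y - ?A S (Midpoint a b) y))\<^sup>2 \<partial>?Q) \<le> (\<Sum>n\<in>J1 \<union> J2. ?s T S n)"
    if T: "T \<in> mp_actions M" and S: "S \<in> mp_actions M" for T S
  proof -
    interpret FT: mp_flow ?Q "\<lambda>t. suspension T (t *\<^sub>R v)" by (rule directional_flow[OF prob T])
    interpret FS: mp_flow ?Q "\<lambda>t. suspension S (t *\<^sub>R v)" by (rule directional_flow[OF prob S])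
    have i: "integrable ?Q (\<lambda>y. (cmod (?A T a y - ?A S a y))\<^sup>2)" for a
      by (intro L2_fun_diff_integrable FT.L2_fun_average FS.L2_fun_average test_fun_L2)
    have pw: "(cmod ((u + v) / 2 - (u' + v') / 2))\<^sup>2 \<le> ((cmod (u - u'))\<^sup>2 + (cmod (v - v'))\<^sup>2) / 2" for u v u' v'
    proof -
      have "cmod ((u + v) / 2 - (u' + v') / 2) \<le> (cmod (u - u') + cmod (v - v')) / 2"
        by (rule cmod_midpoint_diff)
      then have "(cmod ((u + v) / 2 - (u' + v') / 2))\<^sup>2 \<le> ((cmod (u - u') + cmod (v - v')) / 2)\<^sup>2"
        by (intro power_mono) auto
      also have "\<dots> \<le> ((cmod (u - u'))\<^sup>2 + (cmod (v - v'))\<^sup>2) / 2"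
        using zero_le_power2[of "cmod (u - u') - cmod (v - v')"] by (simp add: power2_eq_square field_simps)
      finally show ?thesis .
    qed
    have "(\<integral>y. (cmod (?A T (Midpoint a b) y - ?A S (Midpoint a b) y))\<^sup>2 \<partial>?Q)
        \<le> (\<integral>y. ((cmod (?A T a y - ?A S a y))\<^sup>2 + (cmod (?A T b y - ?A S b y))\<^sup>2) / 2 \<partial>?Q)"
      unfolding twisted_average.simps
      by (intro integral_mono integrable_divide Bochner_Integration.integrable_add i i[of "Midpoint a b", unfolded twisted_average.simps] pw)
    also have "\<dots> = ((\<integral>y. (cmod (?A T a y - ?A S a y))\<^sup>2 \<partial>?Q) + (\<integral>y. (cmod (?A T b y - ?A S b y))\<^sup>2 \<partial>?Q)) / 2"
      using i[of a] i[of b] by simp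
    also have "\<dots> \<le> ((\<Sum>n\<in>J1. ?s T S n) + (\<Sum>n\<in>J2. ?s T S n)) / 2"
      by (intro divide_right_mono add_mono 1[rule_format, OF T S] 2[rule_format, OF T S]) simp
    also have "\<dots> \<le> ((\<Sum>n\<in>J1 \<union> J2. ?s T S n) + (\<Sum>n\<in>J1 \<union> J2. ?s T S n)) / 2"
      using J by (intro divide_right_mono add_mono sum_mono2) auto
    finally show ?thesis by simp
  qed
  then show ?case by (intro exI[of _ "J1 \<union> J2"] conjI ballI finite_UnI J)
qed

end

text \<open>The finite intersections of a countable base.\<close>
lemma countable_open_generator:
  obtains \<G> :: "'a::second_countable_topology set set" where
    "countable \<G>" "Int_stable \<G>" "UNIV \<in> \<G>" "\<And>U. U \<in> \<G> \<Longrightarrow> open U" "sets borel = sigma_sets UNIV \<G>"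
proof -
  obtain K :: "'a set set" where K: "countable K" "topological_basis K" using ex_countable_basis by blast
  define \<G> where "\<G> = Inter ` {F. finite F \<and> F \<subseteq> K}"
  have open\<G>: "open U" if "U \<in> \<G>" for U
    using that topological_basis_open[OF K(2)] by (auto simp: \<G>_def intro!: open_Inter)
  have KG: "K \<subseteq> \<G>"
  proof
    fix U assume "U \<in> K"
    then show "U \<in> \<G>" unfolding \<G>_def by (intro image_eqI[of _ _ "{U}"]) auto
  qed
  show ?thesis
  proof (rule that[OF _ _ _ open\<G>])
    show "countable \<G>" unfolding \<G>_def by (intro countable_image countable_Collect_finite_subset K)
    show "Int_stable \<G>"
    proof (rule Int_stableI)
      fix a b assume "a \<in> \<G>" "b \<in> \<G>"
      then obtain F F' where "finite F" "F \<subseteq> K" "a = \<Inter>F" "finite F'" "F' \<subseteq> K" "b = \<Inter>F'"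
        by (auto simp: \<G>_def)
      then show "a \<inter> b \<in> \<G>" unfolding \<G>_def by (intro image_eqI[of _ _ "F \<union> F'"]) auto
    qed
    show "UNIV \<in> \<G>" unfolding \<G>_def by (intro image_eqI[of _ _ "{}"]) auto
    have "sets (borel :: 'a measure) = sigma_sets UNIV K"
      by (subst borel_eq_countable_basis[OF K], rule sets_measure_of) simp
    moreover have "sigma_sets UNIV K \<subseteq> sigma_sets UNIV \<G>" by (rule sigma_sets_mono'[OF KG])
    moreover have "sigma_sets UNIV \<G> \<subseteq> sets borel"
    proof -
      have "\<G> \<subseteq> sets borel" using open\<G> by (auto intro: borel_open)
      from sets.sigma_sets_subset[OF this] show ?thesis by simp
    qed
    ultimately show "sets borel = sigma_sets UNIV \<G>" by blast
  qed
qed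

text \<open>The sets over whose preimages \<open>g\<close> integrates to 0 form a Dynkin system.\<close>
lemma vanishing_integral_generated:
  fixes g :: "'y \<Rightarrow> complex" and p :: "'y \<Rightarrow> 'z"
  assumes g: "integrable Q g" and p: "p \<in> Q \<rightarrow>\<^sub>M R"
    and E: "Int_stable E" "E \<subseteq> Pow (space R)" "sets R = sigma_sets (space R) E" "space R \<in> E"
    and zero: "\<And>e. e \<in> E \<Longrightarrow> (\<integral>y. indicator e (p y) *\<^sub>R g y \<partial>Q) = 0"
    and B: "B \<in> sets R"
  shows "(\<integral>y. indicator B (p y) *\<^sub>R g y \<partial>Q) = 0"
proof -
  have ind: "integrable Q (\<lambda>y. indicator C (p y) *\<^sub>R g y)" if C: "C \<in> sets R" for C
  proof -
    have "integrable Q (\<lambda>y. indicator (p -` C \<inter> space Q) y *\<^sub>R g y)"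
      by (rule integrable_mult_indicator[OF measurable_sets[OF p C] g])
    then show ?thesis by (rule Bochner_Integration.integrable_cong[OF refl, THEN iffD1, rotated]) (simp add: indicator_def)
  qed
  show ?thesis using E(1,2) B[unfolded E(3)]
  proof (induction rule: sigma_sets_induct_disjoint)
    case (basic e) then show ?case by (rule zero)
  next
    case empty then show ?case by simp
  next
    case (compl C)
    then have C: "C \<in> sets R" by (simp add: E(3))
    have "(\<integral>y. indicator (space R - C) (p y) *\<^sub>R g y \<partial>Q)
        = (\<integral>y. indicator (space R) (p y) *\<^sub>R g y - indicator C (p y) *\<^sub>R g y \<partial>Q)"
      by (intro Bochner_Integration.integral_cong refl)
         (use sets.sets_into_space[OF C] in \<open>auto simp: indicator_def\<close>)
    also have "\<dots> = 0" using ind[OF C] ind[OF sets.top] compl zero[OF E(4)] by simp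
    finally show ?case .
  next
    case (union C)
    then have C: "C i \<in> sets R" for i by (auto simp: E(3))
    have part: "(\<integral>y. indicator (\<Union>i<n. C i) (p y) *\<^sub>R g y \<partial>Q) = 0" for n :: nat
    proof -
      have "disjoint_family_on C {..<n}" using union(1) by (auto simp: disjoint_family_on_def)
      then have "indicator (\<Union>i<n. C i) z = (\<Sum>i<n. indicator (C i) z :: real)" for z
        by (intro indicator_UN_disjoint) auto
      then have "(\<integral>y. indicator (\<Union>i<n. C i) (p y) *\<^sub>R g y \<partial>Q) = (\<integral>y. (\<Sum>i<n. indicator (C i) (p y) *\<^sub>R g y) \<partial>Q)"
        by (simp add: scaleR_sum_left)
      also have "\<dots> = (\<Sum>i<n. \<integral>y. indicator (C i) (p y) *\<^sub>R g y \<partial>Q)"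
        by (rule Bochner_Integration.integral_sum) (rule ind[OF C])
      finally show ?thesis using union(3) by simp
    qed
    have UC: "(\<Union>i. C i) \<in> sets R" using C by auto
    have "(\<lambda>n. \<integral>y. indicator (\<Union>i<n. C i) (p y) *\<^sub>R g y \<partial>Q) \<longlonglongrightarrow> (\<integral>y. indicator (\<Union>i. C i) (p y) *\<^sub>R g y \<partial>Q)"
    proof (rule integral_dominated_convergence[where w = "\<lambda>y. norm (g y)"])
      show "(\<lambda>y. indicator (\<Union>i. C i) (p y) *\<^sub>R g y) \<in> borel_measurable Q"
        by (rule borel_measurable_integrable[OF ind[OF UC]])
      have "(\<Union>i<n. C i) \<in> sets R" for n :: nat using C by auto
      then show "(\<lambda>y. indicator (\<Union>i<n. C i) (p y) *\<^sub>R g y) \<in> borel_measurable Q" for n :: nat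
        by (rule borel_measurable_integrable[OF ind])
      show "AE y in Q. (\<lambda>n. indicator (\<Union>i<n. C i) (p y) *\<^sub>R g y) \<longlonglongrightarrow> indicator (\<Union>i. C i) (p y) *\<^sub>R g y"
        by (intro AE_I2 tendsto_scaleR tendsto_const LIMSEQ_indicator_UN)
      show "AE y in Q. norm (indicator (\<Union>i<n. C i) (p y) *\<^sub>R g y) \<le> norm (g y)" for n :: nat
        by (auto simp: indicator_def)
    qed (use g in simp)
    then show ?case unfolding part by (simp add: LIMSEQ_const_iff)
  qed
qed

lemma AE_eq_0_of_vanishing_integrals:
  fixes g :: "'y \<Rightarrow> complex"
  assumes g: "integrable Q g" and zero: "\<And>S. S \<in> sets Q \<Longrightarrow> (\<integral>y. indicator S y *\<^sub>R g y \<partial>Q) = 0"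
  shows "AE y in Q. g y = 0"
proof -
  have i: "integrable Q (\<lambda>y. indicator S y *\<^sub>R g y)" if "S \<in> sets Q" for S
    using integrable_mult_indicator[OF that g] by simp
  have "AE y in Q. Re (g y) = 0"
  proof (rule density_unique_real)
    fix S assume S: "S \<in> sets Q"
    have "(\<integral>y\<in>S. Re (g y) \<partial>Q) = Re (\<integral>y. indicator S y *\<^sub>R g y \<partial>Q)"
      unfolding set_lebesgue_integral_def using integral_Re[OF i[OF S]] by simp
    then show "(\<integral>y\<in>S. Re (g y) \<partial>Q) = (\<integral>y\<in>S. 0 \<partial>Q)" by (simp add: zero[OF S])
  qed (use g in auto)
  moreover have "AE y in Q. Im (g y) = 0"
  proof (rule density_unique_real)
    fix S assume S: "S \<in> sets Q"
    have "(\<integral>y\<in>S. Im (g y) \<partial>Q) = Im (\<integral>y. indicator S y *\<^sub>R g y \<partial>Q)"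
      unfolding set_lebesgue_integral_def using integral_Im[OF i[OF S]] by simp
    then show "(\<integral>y\<in>S. Im (g y) \<partial>Q) = (\<integral>y\<in>S. 0 \<partial>Q)" by (simp add: zero[OF S])
  qed (use g in auto)
  ultimately show ?thesis by eventually_elim (simp add: complex_eq_iff)
qed

lemma L2_O_orthogonal_to_fibre_constant:
  assumes "G \<in> L2_O M" "h \<in> borel_measurable borel" "\<And>s. \<bar>h s\<bar> \<le> 1"
  shows "(\<integral>y. complex_of_real (h (snd y)) * cnj (G y) \<partial>suspension_measure M) = 0"
proof -
  interpret C: prob_space "cube_measure :: (real^'b) measure" by (rule prob_space_cube_measure)
  have hL: "(\<lambda>s. complex_of_real (h s)) \<in> L2_fun cube_measure"
    by (rule C.L2_fun_bounded[where C = 1])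
       (use measurable_cube_measure_borel[OF assms(2)] assms(3) in auto)
  have O: "(\<lambda>(x, s). complex_of_real (h s)) \<in> O_fun"
    unfolding O_fun_def by (intro CollectI exI[of _ "\<lambda>s. complex_of_real (h s)"] conjI refl hL)
  have "(\<integral>y. complex_of_real (h (snd y)) * cnj (G y) \<partial>suspension_measure M)
      = (\<integral>y. cnj (G y * cnj (case y of (x, s) \<Rightarrow> complex_of_real (h s))) \<partial>suspension_measure M)"
    by (intro Bochner_Integration.integral_cong refl) (auto simp: case_prod_beta)
  also have "\<dots> = cnj (\<integral>y. G y * cnj (case y of (x, s) \<Rightarrow> complex_of_real (h s)) \<partial>suspension_measure M)"
    by (rule Bochner_Integration.integral_cnj)
  also have "(\<integral>y. G y * cnj (case y of (x, s) \<Rightarrow> complex_of_real (h s)) \<partial>suspension_measure M) = 0"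
  proof -
    have "\<forall>F\<in>O_fun. (\<integral>y. G y * cnj (F y) \<partial>suspension_measure M) = 0"
      using assms(1) by (simp add: L2_O_def)
    from bspec[OF this O] show ?thesis .
  qed
  finally show ?thesis by simp
qed

text \<open>Orthogonality to the test functions gives vanishing integrals over rectangles: functions of the fibre
variable are orthogonal to \<open>G\<close> anyway, which removes the mean from the indicator, and the bumps
increase to the indicator of their open set. The boundary of the cube is null.\<close>
lemma test_functions_total:
  fixes \<A> :: "'a set set" and \<B> :: "(real ^ 'd::finite) set set"
  assumes prob: "prob_space M"
    and \<A>: "Int_stable \<A>" "\<A> \<subseteq> sets M" "space M \<in> \<A>"
    and approx: "\<And>A. A \<in> sets M \<Longrightarrow> \<exists>A'\<in>sigma_sets (space M) \<A>. AE x in M. x \<in> A \<longleftrightarrow> x \<in> A'"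
    and \<B>: "Int_stable \<B>" "UNIV \<in> \<B>" "\<And>U. U \<in> \<B> \<Longrightarrow> open U" "sets borel = sigma_sets UNIV \<B>"
    and G: "G \<in> L2_O M"
    and orth: "\<And>A B k. A \<in> \<A> \<Longrightarrow> B \<in> \<B> \<Longrightarrow>
       (\<integral>y. test_fun M A k (B \<inter> box 0 1) y * cnj (G y) \<partial>suspension_measure M) = 0"
  shows "AE y in suspension_measure M. G y = 0"
proof -
  interpret M: prob_space M by (rule prob)
  interpret C: prob_space "cube_measure :: (real^'d) measure" by (rule prob_space_cube_measure)
  interpret P: pair_prob_space M "cube_measure :: (real^'d) measure" ..
  let ?Q = "suspension_measure M :: ('a \<times> (real^'d)) measure"
  interpret Q: prob_space ?Q by (rule prob_space_suspension[OF prob])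
  have GL: "G \<in> L2_fun ?Q" using G by (simp add: L2_O_def)
  define g where "g y = cnj (G y)" for y
  have "(\<lambda>_. 1) \<in> L2_fun ?Q" by (rule Q.L2_fun_bounded[where C = 1]) auto
  from L2_inner_integrable[OF this GL] have g: "integrable ?Q g" by (simp add: g_def[abs_def])
  have gm [measurable]: "g \<in> borel_measurable ?Q" using g by simp
  have fst_m [measurable]: "fst \<in> ?Q \<rightarrow>\<^sub>M M" and snd_c: "snd \<in> ?Q \<rightarrow>\<^sub>M cube_measure"
    unfolding suspension_measure_def by measurable
  have snd_m [measurable]: "snd \<in> ?Q \<rightarrow>\<^sub>M borel"
    using measurable_compose[OF snd_c measurable_cube_measure_borel[OF measurable_ident]] by (simp add: id_def)
  have bm: "bump k B \<in> borel_measurable (borel :: (real^'d) measure)" for k B by (rule measurable_bump)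
  have wi: "integrable ?Q (\<lambda>y. complex_of_real (w y) * g y)" if "w \<in> borel_measurable ?Q" "\<And>y. \<bar>w y\<bar> \<le> 1" for w
  proof (rule Bochner_Integration.integrable_bound[OF g])
    show "(\<lambda>y. complex_of_real (w y) * g y) \<in> borel_measurable ?Q" using that by measurable
    show "AE y in ?Q. norm (complex_of_real (w y) * g y) \<le> norm (g y)"
      using that(2) by (auto simp: norm_mult intro!: mult_left_le_one_le)
  qed
  have bump0: "(\<integral>y. complex_of_real (indicator A (fst y) * bump k (B \<inter> box 0 1) (snd y)) * g y \<partial>?Q) = 0"
    if A: "A \<in> \<A>" and B: "B \<in> \<B>" for A B k
  proof -
    let ?h = "bump k (B \<inter> box 0 1)"
    have AM: "A \<in> sets M" using A \<A> by auto
    have h1: "\<bar>?h s\<bar> \<le> 1" for s using bump_bounds[of k "B \<inter> box 0 1" s] by simp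
    have hm: "(\<lambda>y. ?h (snd y)) \<in> borel_measurable ?Q" by (rule measurable_compose[OF snd_m bm])
    have Am: "(\<lambda>y. indicator A (fst y) :: real) \<in> borel_measurable ?Q"
      by (rule measurable_compose[OF fst_m borel_measurable_indicator[OF AM]])
    have i1: "integrable ?Q (\<lambda>y. complex_of_real (indicator A (fst y) * ?h (snd y)) * g y)"
      by (rule wi) (use Am hm h1 in \<open>auto simp: indicator_def\<close>)
    have i2: "integrable ?Q (\<lambda>y. complex_of_real (?h (snd y)) * g y)" by (rule wi) (use hm h1 in auto)
    have "(\<integral>y. test_fun M A k (B \<inter> box 0 1) y * g y \<partial>?Q)
        = (\<integral>y. complex_of_real (indicator A (fst y) * ?h (snd y)) * g y - complex_of_real (measure M A) * (complex_of_real (?h (snd y)) * g y) \<partial>?Q)"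
      by (intro Bochner_Integration.integral_cong refl)
         (simp add: test_fun_def centred_def case_prod_beta algebra_simps)
    also have "\<dots> = (\<integral>y. complex_of_real (indicator A (fst y) * ?h (snd y)) * g y \<partial>?Q)
        - complex_of_real (measure M A) * (\<integral>y. complex_of_real (?h (snd y)) * g y \<partial>?Q)"
      using i1 i2 by (simp only: Bochner_Integration.integral_diff integrable_mult_right integral_mult_right_zero)
    also have "(\<integral>y. complex_of_real (?h (snd y)) * g y \<partial>?Q) = 0"
      unfolding g_def by (rule L2_O_orthogonal_to_fibre_constant[OF G bm h1])
    finally show ?thesis using orth[OF A B, of k] by (simp add: g_def)
  qed
  have ind0: "(\<integral>y. complex_of_real (indicator A (fst y) * indicator (B \<inter> box 0 1) (snd y)) * g y \<partial>?Q) = 0"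
    if A: "A \<in> \<A>" and B: "B \<in> \<B>" for A B
  proof -
    have AM: "A \<in> sets M" using A \<A> by auto
    have Am: "(\<lambda>y. indicator A (fst y) :: real) \<in> borel_measurable ?Q"
      by (rule measurable_compose[OF fst_m borel_measurable_indicator[OF AM]])
    have op: "open (B \<inter> box 0 1)" using \<B>(3)[OF B] by auto
    have "0 \<notin> B \<inter> box 0 1" by (simp add: mem_box_cart)
    then have ne: "B \<inter> box 0 1 \<noteq> UNIV" by blast
    have "(\<lambda>k. \<integral>y. complex_of_real (indicator A (fst y) * bump k (B \<inter> box 0 1) (snd y)) * g y \<partial>?Q)
       \<longlonglongrightarrow> (\<integral>y. complex_of_real (indicator A (fst y) * indicator (B \<inter> box 0 1) (snd y)) * g y \<partial>?Q)"
    proof (rule integral_dominated_convergence[where w = "\<lambda>y. norm (g y)"])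
      have "(\<lambda>y. indicator (B \<inter> box 0 1) (snd y) :: real) \<in> borel_measurable ?Q"
        by (rule measurable_compose[OF snd_m borel_measurable_indicator]) (use op in auto)
      then show "(\<lambda>y. complex_of_real (indicator A (fst y) * indicator (B \<inter> box 0 1) (snd y)) * g y) \<in> borel_measurable ?Q"
        using Am by measurable
      have "(\<lambda>y. bump k (B \<inter> box 0 1) (snd y)) \<in> borel_measurable ?Q" for k
        by (rule measurable_compose[OF snd_m bm])
      then show "(\<lambda>y. complex_of_real (indicator A (fst y) * bump k (B \<inter> box 0 1) (snd y)) * g y) \<in> borel_measurable ?Q" for k
        using Am by measurable
      show "AE y in ?Q. (\<lambda>k. complex_of_real (indicator A (fst y) * bump k (B \<inter> box 0 1) (snd y)) * g y)
          \<longlonglongrightarrow> complex_of_real (indicator A (fst y) * indicator (B \<inter> box 0 1) (snd y)) * g y"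
        by (intro AE_I2 tendsto_mult tendsto_const tendsto_of_real bump_tendsto_indicator op ne)
      show "AE y in ?Q. norm (complex_of_real (indicator A (fst y) * bump k (B \<inter> box 0 1) (snd y)) * g y) \<le> norm (g y)" for k
      proof (rule AE_I2)
        fix y
        have "\<bar>indicator A (fst y) * bump k (B \<inter> box 0 1) (snd y)\<bar> \<le> 1"
          using bump_bounds[of k "B \<inter> box 0 1" "snd y"] by (simp add: indicator_def)
        then show "norm (complex_of_real (indicator A (fst y) * bump k (B \<inter> box 0 1) (snd y)) * g y) \<le> norm (g y)"
          unfolding norm_mult norm_of_real by (intro mult_left_le_one_le) auto
      qed
    qed (use g in simp)
    then show ?thesis unfolding bump0[OF A B] by (simp add: LIMSEQ_const_iff)
  qed
  have Qbox: "AE y in ?Q. snd y \<in> box 0 (1::real^'d)"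
  proof -
    have "AE y in M \<Otimes>\<^sub>M cube_measure. snd y \<in> box 0 (1::real^'d)"
    proof (rule P.AE_pair_measure)
      have "snd -` box 0 (1::real^'d) \<inter> space ?Q \<in> sets ?Q" by (intro measurable_sets[OF snd_m]) auto
      then show "{y \<in> space (M \<Otimes>\<^sub>M cube_measure). snd y \<in> box 0 (1::real^'d)} \<in> sets (M \<Otimes>\<^sub>M cube_measure)"
        by (simp add: suspension_measure_def vimage_def Int_def conj_commute)
      show "AE x in M. AE s in cube_measure. snd (x, s) \<in> box 0 (1::real^'d)" using AE_cube_interior by simp
    qed
    then show ?thesis unfolding suspension_measure_def .
  qed
  have step1: "(\<integral>y. complex_of_real (indicator A (fst y) * indicator B (snd y)) * g y \<partial>?Q) = 0"
    if A: "A \<in> \<A>" and B: "B \<in> sets borel" for A B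
  proof -
    have AM: "A \<in> sets M" using A \<A> by auto
    have Am: "(\<lambda>y. indicator A (fst y) :: real) \<in> borel_measurable ?Q"
      by (rule measurable_compose[OF fst_m borel_measurable_indicator[OF AM]])
    have Im: "(\<lambda>y. indicator S (snd y) :: real) \<in> borel_measurable ?Q" if "S \<in> sets borel" for S
      by (rule measurable_compose[OF snd_m borel_measurable_indicator[OF that]])
    let ?g = "\<lambda>y. complex_of_real (indicator A (fst y) * indicator (box 0 1) (snd y)) * g y"
    have "(\<integral>y. indicator B (snd y) *\<^sub>R ?g y \<partial>?Q) = 0"
    proof (rule vanishing_integral_generated[OF _ snd_m, of ?g \<B>])
      show "integrable ?Q ?g" by (rule wi) (use Am Im in \<open>auto simp: indicator_def\<close>)
      show "(\<integral>y. indicator e (snd y) *\<^sub>R ?g y \<partial>?Q) = 0" if "e \<in> \<B>" for e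
      proof -
        have "(\<integral>y. indicator e (snd y) *\<^sub>R ?g y \<partial>?Q)
           = (\<integral>y. complex_of_real (indicator A (fst y) * indicator (e \<inter> box 0 1) (snd y)) * g y \<partial>?Q)"
          by (intro Bochner_Integration.integral_cong refl) (auto simp: indicator_def)
        then show ?thesis using ind0[OF A that] by simp
      qed
    qed (use \<B> B in auto)
    moreover have "(\<integral>y. complex_of_real (indicator A (fst y) * indicator B (snd y)) * g y \<partial>?Q) = (\<integral>y. indicator B (snd y) *\<^sub>R ?g y \<partial>?Q)"
    proof (rule integral_cong_AE)
      show "AE y in ?Q. complex_of_real (indicator A (fst y) * indicator B (snd y)) * g y = indicator B (snd y) *\<^sub>R ?g y"
        using Qbox by eventually_elim (auto simp: indicator_def)
    qed (use Am Im[OF B] Im[of "box 0 1"] in \<open>auto intro!: borel_measurable_times borel_measurable_scaleR\<close>)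
    ultimately show ?thesis by simp
  qed
  have fst_distr: "distr ?Q M fst = M" unfolding suspension_measure_def by (rule C.distr_pair_fst)
  have step2: "(\<integral>y. complex_of_real (indicator A (fst y) * indicator B (snd y)) * g y \<partial>?Q) = 0"
    if A: "A \<in> sets M" and B: "B \<in> sets borel" for A B
  proof -
    have Am: "(\<lambda>y. indicator S (fst y) :: real) \<in> borel_measurable ?Q" if "S \<in> sets M" for S
      by (rule measurable_compose[OF fst_m borel_measurable_indicator[OF that]])
    have Bm: "(\<lambda>y. indicator B (snd y) :: real) \<in> borel_measurable ?Q"
      by (rule measurable_compose[OF snd_m borel_measurable_indicator[OF B]])
    obtain A' where A': "A' \<in> sigma_sets (space M) \<A>" and AE': "AE x in M. x \<in> A \<longleftrightarrow> x \<in> A'"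
      using approx[OF A] by blast
    have sub: "sigma_sets (space M) \<A> \<subseteq> sets M" by (rule sets.sigma_sets_subset[OF \<A>(2)])
    have A'M: "A' \<in> sets M" using A' sub by blast
    let ?R = "sigma (space M) \<A>" and ?g = "\<lambda>y. complex_of_real (indicator B (snd y)) * g y"
    have PA: "\<A> \<subseteq> Pow (space M)" using \<A>(2) sets.sets_into_space by blast
    have sR: "space ?R = space M" "sets ?R = sigma_sets (space M) \<A>"
      using PA by (simp_all add: space_measure_of sets_measure_of)
    have fR: "fst \<in> ?Q \<rightarrow>\<^sub>M ?R"
    proof (rule measurableI)
      show "fst y \<in> space ?R" if "y \<in> space ?Q" for y using measurable_space[OF fst_m that] sR by simp
      show "fst -` S \<inter> space ?Q \<in> sets ?Q" if "S \<in> sets ?R" for S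
        using measurable_sets[OF fst_m, of S] that sR sub by blast
    qed
    have "(\<integral>y. indicator A' (fst y) *\<^sub>R ?g y \<partial>?Q) = 0"
    proof (rule vanishing_integral_generated[OF _ fR, of ?g \<A>])
      show "integrable ?Q ?g" by (rule wi) (use Bm in \<open>auto simp: indicator_def\<close>)
      show "(\<integral>y. indicator e (fst y) *\<^sub>R ?g y \<partial>?Q) = 0" if "e \<in> \<A>" for e
        using step1[OF that B] by (simp add: scaleR_conv_of_real mult.assoc)
    qed (use \<A> A' PA sR in auto)
    moreover have "(\<integral>y. complex_of_real (indicator A (fst y) * indicator B (snd y)) * g y \<partial>?Q) = (\<integral>y. indicator A' (fst y) *\<^sub>R ?g y \<partial>?Q)"
    proof (rule integral_cong_AE)
      have "AE y in ?Q. fst y \<in> A \<longleftrightarrow> fst y \<in> A'"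
        by (rule AE_distrD[OF fst_m]) (unfold fst_distr, rule AE')
      then show "AE y in ?Q. complex_of_real (indicator A (fst y) * indicator B (snd y)) * g y = indicator A' (fst y) *\<^sub>R ?g y"
        by eventually_elim (auto simp: indicator_def)
    qed (use Am[OF A] Am[OF A'M] Bm in \<open>auto intro!: borel_measurable_times borel_measurable_scaleR\<close>)
    ultimately show ?thesis by simp
  qed
  let ?E = "{a \<times> b | a b. a \<in> sets M \<and> b \<in> sets (cube_measure :: (real^'d) measure)}"
  have "(\<integral>y. indicator S y *\<^sub>R g y \<partial>?Q) = 0" if S: "S \<in> sets ?Q" for S
  proof (rule vanishing_integral_generated[OF g _ _ _ _ _ _ S, where p = "\<lambda>y. y" and E = ?E])
    show "Int_stable ?E" by (rule Int_stable_pair_measure_generator)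
    show "?E \<subseteq> Pow (space ?Q)"
      by (auto simp: suspension_measure_def space_pair_measure dest: sets.sets_into_space)
    show "sets ?Q = sigma_sets (space ?Q) ?E"
      by (simp add: suspension_measure_def sets_pair_measure space_pair_measure)
    show "space ?Q \<in> ?E" unfolding suspension_measure_def space_pair_measure
      by (intro CollectI exI[of _ "space M"] exI[of _ "space cube_measure"] conjI refl sets.top)
    show "(\<integral>y. indicator e y *\<^sub>R g y \<partial>?Q) = 0" if e: "e \<in> ?E" for e
    proof -
      from e obtain a b where e': "e = a \<times> b" "a \<in> sets M" "b \<in> sets borel" by (auto simp: sets_cube_measure)
      show ?thesis
        unfolding e'(1) indicator_times scaleR_conv_of_real by (rule step2[OF e'(2,3)])
    qed
  qed simp
  then have "AE y in ?Q. g y = 0" by (rule AE_eq_0_of_vanishing_integrals[OF g])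
  then show ?thesis by eventually_elim (simp add: g_def)
qed

section \<open>Directional weak mixing in terms of averages\<close>

text \<open>Intersecting with the open cube makes every open set admissible for a bump.\<close>
definition small_average :: "'a measure \<Rightarrow> 'a set \<Rightarrow> nat \<Rightarrow> (real ^ 'd::finite) set \<Rightarrow> real ^ 'd \<Rightarrow> real \<Rightarrow> real \<Rightarrow> ('a, 'd) zd_map \<Rightarrow> bool" where
  "small_average M A k B v \<theta> \<epsilon> T \<longleftrightarrow>
     (\<exists>a. (\<integral>y. (cmod (twisted_average (\<lambda>t. suspension T (t *\<^sub>R v)) \<theta> (test_fun M A k (B \<inter> box 0 1)) a y))\<^sup>2
        \<partial>suspension_measure M) < \<epsilon>)"

lemma exp_eq_cis: "exp (2 * of_real pi * \<i> * of_real a) = cis (2 * pi * a)"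
  by (simp add: cis_conv_exp mult_ac)

lemma unit_vector_in_subspace:
  fixes L :: "(real ^ 'd::finite) set"
  assumes "subspace L" "dim L \<ge> 1"
  obtains v where "v \<in> L" "norm v = 1"
proof -
  have "\<not> L \<subseteq> {0}" using assms(2) by (metis dim_eq_0 not_one_le_zero)
  then obtain w where w: "w \<in> L" "w \<noteq> 0" by auto
  show ?thesis
    by (rule that[of "w /\<^sub>R norm w"]) (use w assms(1) in \<open>auto intro: subspace_scale\<close>)
qed

lemma integral_fibre_product_zero:
  assumes prob: "prob_space M" and F: "F \<in> L2_fun (suspension_measure M :: ('a \<times> (real^'d::finite)) measure)"
    and g: "g \<in> L2_fun (cube_measure :: (real^'d) measure)"
    and zero: "\<And>s. s \<in> unit_cube \<Longrightarrow> (\<integral>x. F (x, s) \<partial>M) = 0"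
  shows "(\<integral>y. F y * cnj (case y of (x, s) \<Rightarrow> g s) \<partial>suspension_measure M) = 0"
proof -
  interpret M: prob_space M by (rule prob)
  interpret C: prob_space "cube_measure :: (real^'d) measure" by (rule prob_space_cube_measure)
  interpret P: pair_prob_space M "cube_measure :: (real^'d) measure" ..
  have snd_distr: "distr (suspension_measure M) cube_measure snd = (cube_measure :: (real^'d) measure)"
  proof (rule measure_eqI)
    fix S :: "(real^'d) set" assume "S \<in> sets (distr (suspension_measure M) cube_measure snd)"
    then have S: "S \<in> sets cube_measure" by simp
    have "snd -` S \<inter> space (M \<Otimes>\<^sub>M cube_measure) = space M \<times> S"
      using sets.sets_into_space[OF S] by (auto simp: space_pair_measure)
    then show "emeasure (distr (suspension_measure M) cube_measure snd) S = emeasure cube_measure S"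
      using S by (simp add: suspension_measure_def emeasure_distr C.emeasure_pair_measure_Times M.emeasure_space_1)
  qed simp
  have sm: "snd \<in> suspension_measure M \<rightarrow>\<^sub>M (cube_measure :: (real^'d) measure)"
    unfolding suspension_measure_def by measurable
  have "integrable (suspension_measure M) (\<lambda>y. (cmod (g (snd y)))\<^sup>2)"
    using integrable_distr[OF sm, of "\<lambda>s. (cmod (g s))\<^sup>2"] L2_funD(2)[OF g] snd_distr by simp
  moreover have "(\<lambda>y. g (snd y)) \<in> borel_measurable (suspension_measure M)"
    by (rule measurable_compose[OF sm L2_funD(1)[OF g]])
  ultimately have gL: "(\<lambda>y. g (snd y)) \<in> L2_fun (suspension_measure M)" by (simp add: L2_fun_def)
  have i: "integrable (M \<Otimes>\<^sub>M cube_measure) (\<lambda>(x, s). F (x, s) * cnj (g s))"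
    using L2_inner_integrable[OF F gL] unfolding suspension_measure_def by (simp add: case_prod_unfold)
  have "(\<integral>y. F y * cnj (case y of (x, s) \<Rightarrow> g s) \<partial>suspension_measure M)
      = (\<integral>s. (\<integral>x. F (x, s) * cnj (g s) \<partial>M) \<partial>cube_measure)"
    using P.integral_snd[OF i] unfolding suspension_measure_def by (simp add: case_prod_unfold)
  also have "\<dots> = (\<integral>s. 0 \<partial>(cube_measure :: (real^'d) measure))"
    by (intro Bochner_Integration.integral_cong refl) (simp add: space_cube_measure zero)
  finally show ?thesis by simp
qed

lemma twisted_average_in_L2_O:
  fixes v :: "real ^ 'd::finite"
  assumes prob: "prob_space M" and A: "A \<in> sets M" and T: "T \<in> mp_actions M"
  shows "twisted_average (\<lambda>t. suspension T (t *\<^sub>R v)) \<theta> (test_fun M A k B) a \<in> L2_O M"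
proof -
  let ?Q = "suspension_measure M :: ('a \<times> (real^'d)) measure"
  let ?A = "twisted_average (\<lambda>t. suspension T (t *\<^sub>R v)) \<theta> (test_fun M A k B)"
  interpret FT: mp_flow ?Q "\<lambda>t. suspension T (t *\<^sub>R v)" by (rule directional_flow[OF prob T])
  have AL: "?A a \<in> L2_fun ?Q" for a by (rule FT.L2_fun_average[OF test_fun_L2[OF prob A]])
  have cT: "(\<integral>x. centred M A (T n x) \<partial>M) = 0" and iT: "integrable M (\<lambda>x. centred M A (T n x))" for n
  proof -
    interpret M: prob_space M by (rule prob)
    have "(\<integral>x. centred M A (T n x) \<partial>M) = (\<integral>x. centred M A x \<partial>distr M M (T n))"
      by (rule integral_distr[symmetric]) (use mp_actionsD(1)[OF T] measurable_centred[OF prob A] in auto)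
    then show "(\<integral>x. centred M A (T n x) \<partial>M) = 0" using mp_actionsD(2)[OF T] integral_centred[OF prob A] by simp
    show "integrable M (\<lambda>x. centred M A (T n x))"
      by (rule M.integrable_const_bound[of _ 1])
        (use centred_bound[OF prob A] measurable_compose[OF mp_actionsD(1)[OF T] measurable_centred[OF prob A]] in auto)
  qed
  have fibre: "(\<integral>x. ?A a (x, s) \<partial>M) = 0 \<and> integrable M (\<lambda>x. ?A a (x, s))" for a s
  proof (induction a)
    case (Sample t)
    let ?n = "floor_vec (t *\<^sub>R v + s)"
    let ?c = "cis (- (2 * pi * \<theta> * t)) * complex_of_real (bump k B (frac_vec (t *\<^sub>R v + s)))"
    have "?A (Sample t) (x, s) = ?c * centred M A (T ?n x)" for x
      by (simp add: suspension_eq test_fun_def)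
    then show ?case using cT[of ?n] iT[of ?n] by (simp only: integral_mult_right_zero integrable_mult_right mult_zero_right)
  next
    case (Midpoint a b)
    then show ?case by simp
  qed
  show ?thesis unfolding L2_O_def
  proof (intro CollectI conjI ballI AL)
    fix g assume "g \<in> (O_fun :: ('a \<times> (real^'d) \<Rightarrow> complex) set)"
    then obtain g' where g: "g = (\<lambda>(x, s). g' s)" "g' \<in> L2_fun cube_measure" by (auto simp: O_fun_def)
    show "(\<integral>y. ?A a y * cnj (g y) \<partial>?Q) = 0"
      unfolding g(1) by (rule integral_fibre_product_zero[OF prob AL g(2)]) (use fibre in blast)
  qed
qed

lemma O_fun_L2:
  assumes "prob_space M" "g \<in> O_fun"
  shows "g \<in> L2_fun (suspension_measure M :: ('a \<times> (real^'d::finite)) measure)"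
proof -
  from assms(2) obtain g' :: "real^'d \<Rightarrow> complex" where g: "g = (\<lambda>(x, s). g' s)" "g' \<in> L2_fun cube_measure" by (auto simp: O_fun_def)
  interpret M: prob_space M by (rule assms(1))
  interpret C: prob_space "cube_measure :: (real^'d) measure" by (rule prob_space_cube_measure)
  interpret P: pair_prob_space M "cube_measure :: (real^'d) measure" ..
  have m: "g \<in> borel_measurable (M \<Otimes>\<^sub>M cube_measure)"
    unfolding g(1) using L2_funD(1)[OF g(2)] by measurable
  have "integrable (M \<Otimes>\<^sub>M cube_measure) (\<lambda>(x, s). (cmod (g' s))\<^sup>2)"
  proof (rule P.Fubini_integrable)
    show "(\<lambda>(x, s). (cmod (g' s))\<^sup>2) \<in> borel_measurable (M \<Otimes>\<^sub>M cube_measure)"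
      using L2_funD(1)[OF g(2)] by measurable
    show "AE x in M. integrable cube_measure (\<lambda>s. case (x, s) of (x, s) \<Rightarrow> (cmod (g' s))\<^sup>2)"
      using L2_funD(2)[OF g(2)] by simp
  qed simp
  then show ?thesis using m by (simp add: L2_fun_def suspension_measure_def g(1) case_prod_unfold)
qed

text \<open>Orthogonality to a fixed function survives limits in the norm.\<close>
lemma L2_O_closed:
  fixes M :: "'a measure" and a :: "nat \<Rightarrow> 'a \<times> (real^'d::finite) \<Rightarrow> complex"
  assumes prob: "prob_space M" and G: "G \<in> L2_fun (suspension_measure M)" and a: "\<And>k. a k \<in> L2_O M"
    and close: "\<And>k. (\<integral>y. (cmod (G y - a k y))\<^sup>2 \<partial>suspension_measure M) \<le> (1/4) ^ k"
  shows "G \<in> L2_O M"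
  unfolding L2_O_def
proof (intro CollectI conjI ballI G)
  let ?Q = "suspension_measure M :: ('a \<times> (real^'d)) measure"
  fix g assume gO: "g \<in> (O_fun :: ('a \<times> (real^'d) \<Rightarrow> complex) set)"
  have gL: "g \<in> L2_fun ?Q" by (rule O_fun_L2[OF prob gO])
  have aL: "a k \<in> L2_fun ?Q" for k using a by (simp add: L2_O_def)
  let ?N = "\<integral>y. (cmod (g y))\<^sup>2 \<partial>?Q"
  have bound: "cmod (\<integral>y. G y * cnj (g y) \<partial>?Q) \<le> (1/2) ^ k * (1 + ?N)" for k
  proof -
    have "(\<integral>y. G y * cnj (g y) \<partial>?Q) = (\<integral>y. (G y - a k y) * cnj (g y) + a k y * cnj (g y) \<partial>?Q)"
      by (intro Bochner_Integration.integral_cong refl) (simp add: algebra_simps)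
    also have "\<dots> = (\<integral>y. (G y - a k y) * cnj (g y) \<partial>?Q) + (\<integral>y. a k y * cnj (g y) \<partial>?Q)"
      by (intro Bochner_Integration.integral_add L2_inner_integrable L2_fun_diff G aL gL)
    also have "(\<integral>y. a k y * cnj (g y) \<partial>?Q) = 0" using a[of k] gO by (simp add: L2_O_def)
    finally have "cmod (\<integral>y. G y * cnj (g y) \<partial>?Q) = cmod (\<integral>y. (G y - a k y) * cnj (g y) \<partial>?Q)" by simp
    also have "\<dots> \<le> (2 ^ k * (\<integral>y. (cmod (G y - a k y))\<^sup>2 \<partial>?Q) + ?N / 2 ^ k) / 2"
      by (rule L2_inner_bound[OF L2_fun_diff[OF G aL] gL]) simp
    also have "\<dots> \<le> (2 ^ k * (1/4) ^ k + ?N / 2 ^ k) / 2"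
      using close[of k] by (intro divide_right_mono add_right_mono mult_left_mono) auto
    also have "2 ^ k * (1/4) ^ k = (1/2::real) ^ k" by (simp add: power_mult_distrib[symmetric])
    also have "((1/2) ^ k + ?N / 2 ^ k) / 2 = (1/2) ^ k * (1 + ?N) / 2" by (simp add: power_one_over field_simps)
    also have "\<dots> \<le> (1/2) ^ k * (1 + ?N)" by simp
    finally show ?thesis .
  qed
  have "(\<lambda>k. (1/2) ^ k * (1 + ?N)) \<longlonglongrightarrow> 0 * (1 + ?N)"
    by (intro tendsto_mult tendsto_const LIMSEQ_realpow_zero) auto
  then have "cmod (\<integral>y. G y * cnj (g y) \<partial>?Q) \<le> 0"
    using LIMSEQ_le_const[of _ 0 "cmod (\<integral>y. G y * cnj (g y) \<partial>?Q)"] bound by auto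
  then show "(\<integral>y. G y * cnj (g y) \<partial>?Q) = 0" by simp
qed

text \<open>If all averages had norms bounded away from 0, a sequence with nearly
minimal norms would converge to a nonzero eigenfunction; it is orthogonal to the functions of the
fibre variable because the averages are.\<close>
lemma small_average_of_directional_weak_mixing:
  fixes v :: "real ^ 'd::finite"
  assumes prob: "prob_space M" and A: "A \<in> sets M" and T: "T \<in> mp_actions M"
    and v: "norm v = 1" and wm: "directional_weak_mixing M T (span {v})" and \<epsilon>: "\<epsilon> > 0"
  shows "small_average M A k B v \<theta> \<epsilon> T"
proof (rule ccontr)
  let ?Q = "suspension_measure M :: ('a \<times> (real^'d)) measure"
  let ?F = "test_fun M A k (B \<inter> box 0 1)"
  interpret FT: mp_flow ?Q "\<lambda>t. suspension T (t *\<^sub>R v)" by (rule directional_flow[OF prob T])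
  assume "\<not> small_average M A k B v \<theta> \<epsilon> T"
  then have low: "\<epsilon> \<le> (\<integral>y. (cmod (twisted_average (\<lambda>t. suspension T (t *\<^sub>R v)) \<theta> ?F a y))\<^sup>2 \<partial>?Q)" for a
    by (auto simp: small_average_def not_less)
  obtain G a where G: "G \<in> L2_fun ?Q" "\<not> (AE y in ?Q. G y = 0)"
    and eig: "\<And>s. AE y in ?Q. G (suspension T (s *\<^sub>R v) y) = cis (2 * pi * \<theta> * s) * G y"
    and close: "\<And>k. (\<integral>y. (cmod (G y - twisted_average (\<lambda>t. suspension T (t *\<^sub>R v)) \<theta> ?F (a k) y))\<^sup>2 \<partial>?Q) \<le> (1/4) ^ k"
    by (rule FT.eigenfunction_of_averages[OF test_fun_L2[OF prob A] \<epsilon> low], rule that; assumption)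
  have GO: "G \<in> L2_O M"
    by (rule L2_O_closed[OF prob G(1) twisted_average_in_L2_O[OF prob A T] close])
  have l: "\<theta> *\<^sub>R v \<in> span {v}" by (intro span_scale span_base) simp
  have "AE y in ?Q. G (suspension T t y) = exp (2 * of_real pi * \<i> * of_real ((\<theta> *\<^sub>R v) \<bullet> t)) * G y"
    if "t \<in> span {v}" for t
  proof -
    from that obtain s where t: "t = s *\<^sub>R v" by (auto simp: span_singleton)
    have "v \<bullet> v = 1" using v by (simp add: dot_square_norm)
    then have ip: "(\<theta> *\<^sub>R v) \<bullet> t = \<theta> * s" by (simp add: t)
    show ?thesis using eig[of s] unfolding exp_eq_cis ip unfolding t by (simp only: mult.assoc)
  qed
  with wm GO G(2) l show False unfolding directional_weak_mixing_def by blast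
qed

text \<open>An eigenfunction for \<open>L\<close> is one for each line in \<open>L\<close>, hence orthogonal
to every test function that has small averages along that line. The test functions are total.\<close>
lemma directional_weak_mixing_of_small_averages:
  fixes L :: "(real ^ 'd::finite) set"
  assumes prob: "prob_space M" and T: "T \<in> mp_actions M"
    and \<A>: "Int_stable \<A>" "\<A> \<subseteq> sets M" "space M \<in> \<A>"
    and approx: "\<And>A. A \<in> sets M \<Longrightarrow> \<exists>A'\<in>sigma_sets (space M) \<A>. AE x in M. x \<in> A \<longleftrightarrow> x \<in> A'"
    and \<B>: "Int_stable \<B>" "UNIV \<in> \<B>" "\<And>U. U \<in> \<B> \<Longrightarrow> open U" "sets borel = sigma_sets UNIV \<B>"
    and L: "subspace L" "dim L \<ge> 1"
    and small: "\<And>A B k v \<theta> \<epsilon>. A \<in> \<A> \<Longrightarrow> B \<in> \<B> \<Longrightarrow> norm v = 1 \<Longrightarrow> \<epsilon> > 0 \<Longrightarrow> small_average M A k B v \<theta> \<epsilon> T"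
  shows "directional_weak_mixing M T L"
  unfolding directional_weak_mixing_def
proof (intro notI, elim bexE conjE)
  let ?Q = "suspension_measure M :: ('a \<times> (real^'d)) measure"
  fix G l assume G: "G \<in> L2_O M" and nz: "\<not> (AE y in ?Q. G y = 0)" and l: "l \<in> L"
    and eig: "\<forall>t\<in>L. AE y in ?Q. G (suspension T t y) = exp (2 * of_real pi * \<i> * of_real (l \<bullet> t)) * G y"
  obtain v where v: "v \<in> L" "norm v = 1" by (rule unit_vector_in_subspace[OF L])
  interpret FT: mp_flow ?Q "\<lambda>t. suspension T (t *\<^sub>R v)" by (rule directional_flow[OF prob T])
  have GL: "G \<in> L2_fun ?Q" using G by (simp add: L2_O_def)
  have e: "AE y in ?Q. G (suspension T (s *\<^sub>R v) y) = cis (2 * pi * (l \<bullet> v) * s) * G y" for s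
  proof -
    have "s *\<^sub>R v \<in> L" by (rule subspace_scale[OF L(1) v(1)])
    from bspec[OF eig this] show ?thesis unfolding exp_eq_cis by (simp add: mult_ac)
  qed
  have "AE y in ?Q. G y = 0"
  proof (rule test_functions_total[OF prob \<A> approx \<B> G])
    fix A B k assume AB: "A \<in> \<A>" "B \<in> \<B>"
    have AM: "A \<in> sets M" using AB \<A> by auto
    show "(\<integral>y. test_fun M A k (B \<inter> box 0 1) y * cnj (G y) \<partial>?Q) = 0"
    proof (rule FT.eigenfunction_orthogonal[OF test_fun_L2[OF prob AM] GL e])
      fix \<epsilon> :: real assume "\<epsilon> > 0"
      from small[OF AB v(2) this, of k "l \<bullet> v"]
      show "\<exists>a. (\<integral>y. (cmod (twisted_average (\<lambda>t. suspension T (t *\<^sub>R v)) (l \<bullet> v) (test_fun M A k (B \<inter> box 0 1)) a y))\<^sup>2 \<partial>?Q) < \<epsilon>"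
        unfolding small_average_def .
    qed
  qed
  with nz show False by simp
qed

lemma inner_int_vec_add: "l \<bullet> int_vec (m + n) = l \<bullet> int_vec m + l \<bullet> int_vec n"
proof -
  have "int_vec (m + n) = int_vec m + int_vec n" by (simp add: int_vec_def vec_eq_iff)
  then show ?thesis by (simp add: inner_add_right)
qed

text \<open>Logarithms are chosen on the basis vectors; the set of lattice vectors on which both
sides agree is a subgroup.\<close>
lemma character_of_integer_lattice:
  fixes ev :: "int ^ 'd::finite \<Rightarrow> complex"
  assumes add: "\<And>m n. ev (m + n) = ev m * ev n" and unit: "\<And>n. cmod (ev n) = 1"
  obtains l where "\<And>n. ev n = cis (2 * pi * (l \<bullet> int_vec n))"
proof -
  have ev0: "ev 0 = 1"
  proof -
    have "ev 0 = ev 0 * ev 0" using add[of 0 0] by simp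
    moreover have "ev 0 \<noteq> 0" using unit[of 0] by auto
    ultimately show ?thesis by simp
  qed
  have "\<exists>r. ev (axis i 1) = cis (2 * pi * r)" for i
  proof -
    have "ev (axis i 1) = cis (Arg (ev (axis i 1)))"
    proof -
      have "ev (axis i 1) \<noteq> 0" using unit[of "axis i 1"] by auto
      from cis_Arg[OF this] show ?thesis using unit[of "axis i 1"] by (simp add: sgn_eq)
    qed
    then show ?thesis by (intro exI[of _ "Arg (ev (axis i 1)) / (2 * pi)"]) simp
  qed
  then obtain r where r: "\<And>i. ev (axis i 1) = cis (2 * pi * r i)" by metis
  define l where "l = (\<chi> i. r i)"
  define H where "H = {n. ev n = cis (2 * pi * (l \<bullet> int_vec n))}"
  have H0: "0 \<in> H" by (simp add: H_def ev0)
  have Hadd: "m + n \<in> H" if "m \<in> H" "n \<in> H" for m n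
    using that by (simp add: H_def add inner_int_vec_add cis_mult distrib_left)
  have Hneg: "- n \<in> H" if n: "n \<in> H" for n
  proof -
    have "ev n * ev (- n) = 1" using add[of n "- n"] ev0 by simp
    moreover have "cis (2 * pi * (l \<bullet> int_vec n)) * cis (2 * pi * (l \<bullet> int_vec (- n))) = 1"
      using inner_int_vec_add[of l n "- n"] by (simp add: cis_mult distrib_left[symmetric])
    ultimately have "ev n * ev (- n) = ev n * cis (2 * pi * (l \<bullet> int_vec (- n)))" using n by (simp add: H_def)
    moreover have "ev n \<noteq> 0" using unit[of n] by auto
    ultimately show ?thesis by (simp add: H_def)
  qed
  have Haxis: "axis i 1 \<in> H" for i
  proof -
    have "int_vec (axis i 1) = axis i 1" by (simp add: int_vec_def axis_def vec_eq_iff)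
    then have "l \<bullet> int_vec (axis i 1) = r i" by (simp add: inner_axis l_def)
    then show ?thesis by (simp add: H_def r)
  qed
  have Hax: "axis i k \<in> H" for i and k :: int
  proof (induction k rule: int_induct[where k = 0])
    case base
    have "axis i 0 = (0 :: int ^ 'd)" by (simp add: axis_def vec_eq_iff)
    then show ?case using H0 by (simp only:)
  next
    case (step1 k)
    have "axis i (k + 1) = axis i k + (axis i 1 :: int ^ 'd)" by (simp add: axis_def vec_eq_iff)
    then show ?case using Hadd[OF step1(2) Haxis[of i]] by simp
  next
    case (step2 k)
    have "axis i (k - 1) = axis i k + - (axis i 1 :: int ^ 'd)" by (simp add: axis_def vec_eq_iff)
    then show ?case using Hadd[OF step2(2) Hneg[OF Haxis[of i]]] by simp
  qed
  have "n \<in> H" for n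
  proof -
    have "(\<Sum>i\<in>I. axis i (n $ i)) \<in> H" for I
      by (induction I rule: infinite_finite_induct) (auto simp: H0 Hadd Hax)
    moreover have "(\<Sum>i\<in>UNIV. axis i (n $ i)) = n"
      by (simp add: vec_eq_iff axis_def)
    ultimately show ?thesis by metis
  qed
  then show ?thesis using that[of l] by (simp add: H_def)
qed

text \<open>A nonconstant eigenfunction \<open>f\<close> may be centred, because a nonzero mean forces the eigenvalues to be 1.
Its eigenvalues then form a character \<open>n \<mapsto> exp (2 \<pi> i l \<bullet> n)\<close>, and
\<open>exp (2 \<pi> i l \<bullet> s) f(x)\<close> is an eigenfunction of the suspension for all of \<open>\<real>\<^sup>d\<close>.\<close>
lemma weak_mixing_of_directional:
  fixes T :: "('a, 'd::finite) zd_map"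
  assumes prob: "prob_space M" and T: "T \<in> mp_actions M"
    and wm: "directional_weak_mixing M T UNIV"
  shows "weak_mixing M T"
  unfolding weak_mixing_def
proof (intro ballI allI impI)
  interpret M: prob_space M by (rule prob)
  let ?Q = "suspension_measure M :: ('a \<times> (real^'d)) measure"
  interpret Q: prob_space ?Q by (rule prob_space_suspension[OF prob])
  interpret C: prob_space "cube_measure :: (real^'d) measure" by (rule prob_space_cube_measure)
  fix f ev assume f: "f \<in> L2_fun M" and eig: "\<forall>n. AE x in M. f (T n x) = ev n * f x"
  have fi: "integrable M f"
  proof -
    have "(\<lambda>_. 1) \<in> L2_fun M" by (rule M.L2_fun_bounded[where C = 1]) auto
    from L2_inner_integrable[OF f this] show ?thesis by simp
  qed
  define c where "c = (\<integral>x. f x \<partial>M)"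
  define f0 where "f0 x = f x - c" for x
  have f0L: "f0 \<in> L2_fun M" unfolding f0_def[abs_def]
    by (rule L2_fun_diff[OF f M.L2_fun_bounded[where C = "cmod c"]]) auto
  have f0z: "(\<integral>x. f0 x \<partial>M) = 0" using fi by (simp add: f0_def c_def M.prob_space)
  have Tm: "T n \<in> M \<rightarrow>\<^sub>M M" "distr M M (T n) = M" for n using mp_actionsD[OF T] by auto
  \<comment> \<open>The mean of \<open>f\<close> is also that of \<open>f \<circ> T n\<close>.\<close>
  have ev1: "ev n = 1" if "c \<noteq> 0" for n
  proof -
    have "c = (\<integral>x. f (T n x) \<partial>M)"
      using integral_distr[OF Tm(1), of f n] Tm(2) L2_funD(1)[OF f] by (simp add: c_def)
    also have "\<dots> = (\<integral>x. ev n * f x \<partial>M)"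
      using eig L2_funD(1)[OF f] measurable_compose[OF Tm(1) L2_funD(1)[OF f]]
      by (intro integral_cong_AE) auto
    also have "\<dots> = ev n * c" by (simp add: c_def)
    finally show ?thesis using that by simp
  qed
  have eig0: "AE x in M. f0 (T n x) = ev n * f0 x" for n
    using eig[rule_format, of n]
  proof eventually_elim
    case (elim x)
    then show ?case using ev1[of n] by (cases "c = 0") (auto simp: f0_def)
  qed
  show "\<exists>c. AE x in M. f x = c"
  proof (cases "AE x in M. f0 x = 0")
    case True
    then have "AE x in M. f x = c" by eventually_elim (simp add: f0_def)
    then show ?thesis by blast
  next
    case nz: False
    define q where "q = (\<integral>x. (cmod (f0 x))\<^sup>2 \<partial>M)"
    have q: "q \<noteq> 0"
    proof
      assume "q = 0"
      then have "AE x in M. (cmod (f0 x))\<^sup>2 = 0"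
        using integral_nonneg_eq_0_iff_AE[OF L2_funD(2)[OF f0L]] by (simp add: q_def)
      then have "AE x in M. f0 x = 0" by eventually_elim simp
      with nz show False by simp
    qed
    have mod1: "cmod (ev n) = 1" for n
    proof -
      have "q = (\<integral>x. (cmod (f0 (T n x)))\<^sup>2 \<partial>M)"
        using integral_distr[OF Tm(1), of "\<lambda>x. (cmod (f0 x))\<^sup>2" n] Tm(2) L2_funD(1)[OF f0L] by (simp add: q_def)
      also have "\<dots> = (\<integral>x. (cmod (ev n))\<^sup>2 * (cmod (f0 x))\<^sup>2 \<partial>M)"
      proof (rule integral_cong_AE)
        show "AE x in M. (cmod (f0 (T n x)))\<^sup>2 = (cmod (ev n))\<^sup>2 * (cmod (f0 x))\<^sup>2"
          using eig0[of n] by eventually_elim (simp add: norm_mult power_mult_distrib)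
      qed (use L2_funD(1)[OF f0L] measurable_compose[OF Tm(1) L2_funD(1)[OF f0L]] in auto)
      also have "\<dots> = (cmod (ev n))\<^sup>2 * q" by (simp add: q_def)
      finally have "(cmod (ev n))\<^sup>2 = 1" using q by simp
      then show ?thesis by (simp add: power2_eq_1_iff) (metis norm_ge_zero neg_0_le_iff_le not_one_le_zero)
    qed
    have evadd: "ev (m + n) = ev m * ev n" for m n
    proof (rule ccontr)
      assume ne: "ev (m + n) \<noteq> ev m * ev n"
      have "AE x in M. f0 (T m (T n x)) = ev m * f0 (T n x)"
        by (rule AE_distrD[OF Tm(1)]) (unfold Tm(2), rule eig0)
      then have "AE x in M. f0 x = 0"
        using eig0[of n] eig0[of "m + n"] AE_space
      proof eventually_elim
        case (elim x)
        then have "ev (m + n) * f0 x = ev m * ev n * f0 x"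
          using mp_actionsD(4)[OF T, of x m n] by (metis mult.assoc)
        then show ?case using ne mult_right_cancel by metis
      qed
      with nz show False by simp
    qed
    obtain l where l: "\<And>n. ev n = cis (2 * pi * (l \<bullet> int_vec n))"
      using character_of_integer_lattice[OF evadd mod1] by blast
    define F where "F = (\<lambda>(x, s). cis (2 * pi * (l \<bullet> s)) * f0 x)"
    have fst_m: "fst \<in> ?Q \<rightarrow>\<^sub>M M" unfolding suspension_measure_def by measurable
    have fst_distr: "distr ?Q M fst = M" unfolding suspension_measure_def by (rule C.distr_pair_fst)
    have cm: "(\<lambda>s. cis (2 * pi * (l \<bullet> s))) \<in> borel_measurable (cube_measure :: (real^'d) measure)"
      unfolding cis_conv_exp by (intro measurable_cube_measure_borel borel_measurable_continuous_onI continuous_intros)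
    have Fm: "F \<in> borel_measurable ?Q"
      unfolding F_def suspension_measure_def using cm L2_funD(1)[OF f0L] by measurable
    have "integrable ?Q (\<lambda>y. (cmod (f0 (fst y)))\<^sup>2)"
      using integrable_distr[OF fst_m, of "\<lambda>x. (cmod (f0 x))\<^sup>2"] fst_distr L2_funD(2)[OF f0L] by simp
    then have FL: "F \<in> L2_fun ?Q" using Fm by (simp add: L2_fun_def F_def case_prod_unfold norm_mult)
    have FO: "F \<in> L2_O M" unfolding L2_O_def
    proof (intro CollectI conjI ballI FL)
      fix g assume "g \<in> (O_fun :: ('a \<times> (real^'d) \<Rightarrow> complex) set)"
      then obtain g' where g: "g = (\<lambda>(x, s). g' s)" "g' \<in> L2_fun cube_measure" by (auto simp: O_fun_def)
      show "(\<integral>y. F y * cnj (g y) \<partial>?Q) = 0"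
        unfolding g(1) by (rule integral_fibre_product_zero[OF prob FL g(2)]) (simp add: F_def f0z)
    qed
    have Fnz: "\<not> (AE y in ?Q. F y = 0)"
    proof
      assume "AE y in ?Q. F y = 0"
      then have ae: "AE y in ?Q. f0 (fst y) = 0" by eventually_elim (auto simp: F_def case_prod_unfold)
      have "{x \<in> space M. f0 x = 0} \<in> sets M" using L2_funD(1)[OF f0L] by measurable
      from AE_distr_iff[OF fst_m this] ae have "AE x in distr ?Q M fst. f0 x = 0" by simp
      then have "AE x in M. f0 x = 0" unfolding fst_distr .
      with nz show False by simp
    qed
    have Feig: "AE y in ?Q. F (suspension T t y) = exp (2 * of_real pi * \<i> * of_real (l \<bullet> t)) * F y" for t
    proof -
      have "AE x in M. \<forall>n. f0 (T n x) = ev n * f0 x" using eig0 by (simp add: AE_all_countable)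
      then have "AE y in ?Q. \<forall>n. f0 (T n (fst y)) = ev n * f0 (fst y)"
        by (intro AE_distrD[OF fst_m, of "\<lambda>x. \<forall>n. f0 (T n x) = ev n * f0 x"]) (unfold fst_distr)
      then show ?thesis
      proof eventually_elim
        case (elim y)
        obtain x r where y: "y = (x, r)" by fastforce
        let ?n = "floor_vec (t + r)"
        have "l \<bullet> frac_vec (t + r) + l \<bullet> int_vec ?n = l \<bullet> t + l \<bullet> r"
          by (simp add: frac_vec_eq inner_add_right inner_diff_right)
        then have "cis (2 * pi * (l \<bullet> frac_vec (t + r))) * ev ?n = cis (2 * pi * (l \<bullet> t)) * cis (2 * pi * (l \<bullet> r))"
          unfolding l cis_mult by (simp add: distrib_left[symmetric])
        then show ?case using elim
          by (simp add: y F_def suspension_eq exp_eq_cis mult.assoc[symmetric])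
      qed
    qed
    from wm FO Fnz Feig show ?thesis unfolding directional_weak_mixing_def by blast
  qed
qed

text \<open>Lines give the conditions on averages; conversely these give weak mixing in
every direction, and the direction of full dimension gives weak mixing of the action itself.\<close>
lemma WA_conditions_iff_small_averages:
  fixes T :: "('a, 'd::finite) zd_map"
  assumes prob: "prob_space M" and T: "T \<in> mp_actions M"
    and \<A>: "Int_stable \<A>" "\<A> \<subseteq> sets M" "space M \<in> \<A>"
    and approx: "\<And>A. A \<in> sets M \<Longrightarrow> \<exists>A'\<in>sigma_sets (space M) \<A>. AE x in M. x \<in> A \<longleftrightarrow> x \<in> A'"
    and \<B>: "Int_stable \<B>" "UNIV \<in> \<B>" "\<And>U. U \<in> \<B> \<Longrightarrow> open U" "sets borel = sigma_sets UNIV \<B>"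
  shows "(weak_mixing M T \<and> (\<forall>e\<in>{1..CARD('d)}. \<forall>L\<in>directions e. directional_weak_mixing M T L))
    \<longleftrightarrow> (\<forall>A\<in>\<A>. \<forall>B\<in>\<B>. \<forall>k v \<theta> \<epsilon>. norm v = 1 \<longrightarrow> \<epsilon> > 0 \<longrightarrow> small_average M A k B v \<theta> \<epsilon> T)"
proof
  assume L: "weak_mixing M T \<and> (\<forall>e\<in>{1..CARD('d)}. \<forall>L\<in>directions e. directional_weak_mixing M T L)"
  show "\<forall>A\<in>\<A>. \<forall>B\<in>\<B>. \<forall>k v \<theta> \<epsilon>. norm v = 1 \<longrightarrow> \<epsilon> > 0 \<longrightarrow> small_average M A k B v \<theta> \<epsilon> T"
  proof (intro ballI allI impI)
    fix A B k \<theta> and v :: "real^'d" and \<epsilon> :: real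
    assume A: "A \<in> \<A>" and v: "norm v = 1" and \<epsilon>: "\<epsilon> > 0"
    have "v \<noteq> 0" using v by auto
    then have "span {v} \<in> directions 1" by (simp add: directions_def dim_span dim_insert)
    moreover have "1 \<in> {1..CARD('d)}" by (simp add: Suc_leI)
    ultimately have "directional_weak_mixing M T (span {v})" using L by blast
    then show "small_average M A k B v \<theta> \<epsilon> T"
      using small_average_of_directional_weak_mixing[OF prob _ T v _ \<epsilon>] A \<A>(2) by blast
  qed
next
  assume R: "\<forall>A\<in>\<A>. \<forall>B\<in>\<B>. \<forall>k v \<theta> \<epsilon>. norm v = 1 \<longrightarrow> \<epsilon> > 0 \<longrightarrow> small_average M A k B v \<theta> \<epsilon> T"
  have dir: "directional_weak_mixing M T L" if "subspace L" "dim L \<ge> 1" for L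
    by (rule directional_weak_mixing_of_small_averages[OF prob T \<A> approx \<B> that]) (use R in blast)+
  have "directional_weak_mixing M T UNIV" by (rule dir) (simp_all add: Suc_leI)
  then have "weak_mixing M T" by (rule weak_mixing_of_directional[OF prob T])
  moreover have "directional_weak_mixing M T L" if "e \<in> {1..CARD('d)}" "L \<in> directions e" for e L
    using that by (intro dir) (auto simp: directions_def)
  ultimately show "weak_mixing M T \<and> (\<forall>e\<in>{1..CARD('d)}. \<forall>L\<in>directions e. directional_weak_mixing M T L)"
    by blast
qed

section \<open>The G-delta property\<close>

lemma equiv_ae_equal: "equiv (mp_actions M) (ae_equal M)"
proof (rule equivI)
  show "ae_equal M \<subseteq> mp_actions M \<times> mp_actions M" by (auto simp: ae_equal_def)
  show "refl_on (mp_actions M) (ae_equal M)" by (auto simp: refl_on_def ae_equal_def)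
  show "sym (ae_equal M)" by (auto simp: sym_def ae_equal_def eq_commute)
  show "trans (ae_equal M)"
  proof (rule transI)
    fix R S T assume a: "(R, S) \<in> ae_equal M" "(S, T) \<in> ae_equal M"
    have "AE x in M. R n x = T n x" for n
    proof -
      have "AE x in M. R n x = S n x" "AE x in M. S n x = T n x" using a by (auto simp: ae_equal_def)
      then show ?thesis by eventually_elim simp
    qed
    with a show "(R, T) \<in> ae_equal M" by (auto simp: ae_equal_def)
  qed
qed

lemma action_class_rep:
  assumes "C \<in> action_space M" "T \<in> C"
  shows "T \<in> mp_actions M" "C = ae_equal M `` {T}"
proof -
  obtain S where S: "S \<in> mp_actions M" "C = ae_equal M `` {S}" using assms(1) by (rule action_space_cases)
  then have ST: "(S, T) \<in> ae_equal M" using assms(2) by simp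
  then show "T \<in> mp_actions M" by (auto simp: ae_equal_def)
  show "C = ae_equal M `` {T}" unfolding S(2) by (rule equiv_class_eq[OF equiv_ae_equal ST])
qed

lemma action_class_nonempty: "C \<in> action_space M \<Longrightarrow> C \<noteq> {}"
  using action_space_cases action_class_mem by (metis empty_iff)

text \<open>Half of the neighbourhood is a ball of directions and frequencies, good for every action, the
other half is a weak neighbourhood of the action, for one direction and frequency. Each of the two
steps may use up a third of the distance to the bound.\<close>
lemma small_average_neighbourhood:
  fixes T0 :: "('a, 'd::finite) zd_map"
  assumes prob: "prob_space M" and A: "A \<in> sets M" and T0: "T0 \<in> mp_actions M"
    and small: "small_average M A k B v \<theta> \<epsilon> T0"
  obtains O' \<rho> where "openin (weak_topology M) O'" "ae_equal M `` {T0} \<in> O'" "\<rho> > 0"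
    "\<And>C T v' \<theta>'. C \<in> O' \<Longrightarrow> T \<in> C \<Longrightarrow> dist v v' < \<rho> \<Longrightarrow> dist \<theta> \<theta>' < \<rho> \<Longrightarrow> small_average M A k B v' \<theta>' \<epsilon> T"
proof -
  let ?Q = "suspension_measure M :: ('a \<times> (real^'d)) measure"
  interpret Q: prob_space ?Q by (rule prob_space_suspension[OF prob])
  let ?B = "B \<inter> box 0 1"
  have BC: "?B \<subseteq> unit_cube" using unit_cube_sandwich(1) by blast
  let ?f = "centred M A"
  have f: "?f \<in> L2_fun M" by (rule centred_L2[OF prob A])
  define tw where "tw T v \<theta> = twisted_average (\<lambda>t. suspension T (t *\<^sub>R v)) \<theta> (test_fun M A k ?B)" for T and v :: "real^'d" and \<theta>
  have twL: "tw T v \<theta> a \<in> L2_fun ?Q" if "T \<in> mp_actions M" for T v \<theta> a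
  proof -
    interpret FT: mp_flow ?Q "\<lambda>t. suspension T (t *\<^sub>R v)" by (rule directional_flow[OF prob that])
    show ?thesis unfolding tw_def by (rule FT.L2_fun_average[OF test_fun_L2[OF prob A]])
  qed
  have zL: "(\<lambda>_. 0) \<in> L2_fun ?Q" by (simp add: L2_fun_def)
  obtain a where a: "(\<integral>y. (cmod (tw T0 v \<theta> a y))\<^sup>2 \<partial>?Q) < \<epsilon>"
    using small unfolding small_average_def tw_def by blast
  define r where "r = L2_dist ?Q (tw T0 v \<theta> a) (\<lambda>_. 0)"
  have r: "r < sqrt \<epsilon>" using a by (simp add: r_def L2_dist_def)
  define \<eta> where "\<eta> = (sqrt \<epsilon> - r) / 3"
  have \<eta>: "\<eta> > 0" using r by (simp add: \<eta>_def)
  obtain \<rho> where \<rho>: "\<rho> > 0" and eq: "\<forall>T\<in>mp_actions M. \<forall>v v' \<theta> \<theta>'. dist v v' < \<rho> \<longrightarrow> dist \<theta> \<theta>' < \<rho> \<longrightarrow>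
     (\<forall>y\<in>space ?Q. cmod (tw T v \<theta> a y - tw T v' \<theta>' a y) \<le> \<eta>)"
    using twisted_average_equicontinuous[OF prob A BC \<eta>, of k a] unfolding tw_def by (elim exE conjE)
  obtain J where J: "finite J" and cont: "\<forall>T\<in>mp_actions M. \<forall>S\<in>mp_actions M.
     (\<integral>y. (cmod (tw T v \<theta> a y - tw S v \<theta> a y))\<^sup>2 \<partial>?Q) \<le> (\<Sum>n\<in>J. (L2_dist M (?f \<circ> T n) (?f \<circ> S n))\<^sup>2)"
    using twisted_average_action_continuous[OF prob A, of v \<theta> k ?B a] unfolding tw_def by (elim exE conjE)
  define \<gamma> where "\<gamma> = \<eta> / (real (card J) + 1)"
  have \<gamma>: "\<gamma> > 0" using \<eta> by (simp add: \<gamma>_def add_nonneg_pos)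
  define U where "U n = {C \<in> action_space M. \<exists>T\<in>C. L2_dist M (?f \<circ> T n) (?f \<circ> T0 n) < \<gamma>}" for n
  have Uo: "openin (weak_topology M) (U n)" for n
    unfolding U_def by (rule openin_weak_subbasic[OF f T0 \<gamma>])
  define O' where "O' = topspace (weak_topology M) \<inter> (\<Inter>n\<in>J. U n)"
  have "openin (weak_topology M) O'"
    unfolding O'_def using J Uo by (cases "J = {}") (auto intro!: openin_Int openin_INT)
  moreover have C0: "ae_equal M `` {T0} \<in> U n" for n
    unfolding U_def using action_class_in[OF T0] action_class_mem[OF T0] \<gamma>
    by (intro CollectI conjI bexI[of _ T0]) (simp_all add: L2_dist_def)
  then have "ae_equal M `` {T0} \<in> O'"
    unfolding O'_def topspace_weak_topology using action_class_in[OF T0] by simp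
  moreover have "small_average M A k B v' \<theta>' \<epsilon> T"
    if C: "C \<in> O'" "T \<in> C" and d: "dist v v' < \<rho>" "dist \<theta> \<theta>' < \<rho>" for C T v' \<theta>'
  proof -
    have CA: "C \<in> action_space M" using C(1) by (simp add: O'_def topspace_weak_topology)
    note T = action_class_rep[OF CA C(2)]
    have dn: "L2_dist M (?f \<circ> T n) (?f \<circ> T0 n) < \<gamma>" if "n \<in> J" for n
    proof -
      have "C \<in> U n" using C(1) that by (simp add: O'_def)
      then have "\<exists>T'\<in>ae_equal M `` {T}. L2_dist M (?f \<circ> T' n) (?f \<circ> T0 n) < \<gamma>"
        unfolding U_def T(2)[symmetric] by simp
      then show ?thesis by (simp only: L2_dist_class[OF f T(1) T0])
    qed
    have "(\<integral>y. (cmod (tw T v \<theta> a y - tw T0 v \<theta> a y))\<^sup>2 \<partial>?Q) \<le> (\<Sum>n\<in>J. (L2_dist M (?f \<circ> T n) (?f \<circ> T0 n))\<^sup>2)"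
      using cont T(1) T0 by blast
    also have "\<dots> \<le> (\<Sum>n\<in>J. \<gamma>\<^sup>2)"
      using dn by (intro sum_mono power_mono) (auto simp: L2_dist_def less_imp_le)
    also have "\<dots> = real (card J) * \<gamma>\<^sup>2" by simp
    also have "\<dots> \<le> (real (card J) + 1)\<^sup>2 * \<gamma>\<^sup>2"
      by (intro mult_right_mono) (auto simp: power2_eq_square algebra_simps)
    also have "\<dots> = \<eta>\<^sup>2"
    proof -
      have "(real (card J) + 1) * \<gamma> = \<eta>" by (simp add: \<gamma>_def add_nonneg_pos less_imp_neq[symmetric])
      then show ?thesis by (simp add: power_mult_distrib[symmetric])
    qed
    finally have 1: "L2_dist ?Q (tw T v \<theta> a) (tw T0 v \<theta> a) \<le> \<eta>"
      using \<eta> unfolding L2_dist_def by (intro real_le_lsqrt) auto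
    have "(\<integral>y. (cmod (tw T v' \<theta>' a y - tw T v \<theta> a y))\<^sup>2 \<partial>?Q) \<le> (\<integral>y. \<eta>\<^sup>2 \<partial>?Q)"
    proof (rule integral_mono)
      show "integrable ?Q (\<lambda>y. (cmod (tw T v' \<theta>' a y - tw T v \<theta> a y))\<^sup>2)"
        by (rule L2_fun_diff_integrable[OF twL[OF T(1)] twL[OF T(1)]])
      fix y assume "y \<in> space ?Q"
      then have "cmod (tw T v \<theta> a y - tw T v' \<theta>' a y) \<le> \<eta>" using eq T(1) d by blast
      then show "(cmod (tw T v' \<theta>' a y - tw T v \<theta> a y))\<^sup>2 \<le> \<eta>\<^sup>2"
        by (intro power_mono) (auto simp: norm_minus_commute)
    qed simp
    then have 2: "L2_dist ?Q (tw T v' \<theta>' a) (tw T v \<theta> a) \<le> \<eta>"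
      using \<eta> unfolding L2_dist_def by (intro real_le_lsqrt) (auto simp: Q.prob_space)
    have 3: "L2_dist ?Q (tw T v' \<theta>' a) (\<lambda>_. 0) \<le> L2_dist ?Q (tw T v' \<theta>' a) (tw T v \<theta> a) + L2_dist ?Q (tw T v \<theta> a) (\<lambda>_. 0)"
      by (rule L2_dist_triangle[OF twL[OF T(1)] twL[OF T(1)] zL])
    have 4: "L2_dist ?Q (tw T v \<theta> a) (\<lambda>_. 0) \<le> L2_dist ?Q (tw T v \<theta> a) (tw T0 v \<theta> a) + r"
      unfolding r_def by (rule L2_dist_triangle[OF twL[OF T(1)] twL[OF T0] zL])
    have "L2_dist ?Q (tw T v' \<theta>' a) (\<lambda>_. 0) < sqrt \<epsilon>"
      using 1 2 3 4 \<eta> unfolding \<eta>_def by argo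
    then have "(\<integral>y. (cmod (tw T v' \<theta>' a y))\<^sup>2 \<partial>?Q) < \<epsilon>" by (simp add: L2_dist_def)
    then show ?thesis unfolding small_average_def tw_def by blast
  qed
  ultimately show ?thesis by (rule that[OF _ _ \<rho>])
qed

text \<open>A tube lemma: finitely many of the product neighbourhoods cover the compact set of directions
and bounded frequencies.\<close>
lemma openin_small_averages:
  fixes B :: "(real ^ 'd::finite) set"
  assumes prob: "prob_space M" and A: "A \<in> sets M"
  shows "openin (weak_topology M) {C \<in> action_space M. \<forall>T\<in>C. \<forall>v \<theta>. norm v = 1 \<longrightarrow> \<bar>\<theta>\<bar> \<le> K \<longrightarrow> small_average M A k B v \<theta> \<epsilon> T}"
    (is "openin _ ?W")
proof (subst openin_subopen, intro ballI)
  fix C0 assume C0: "C0 \<in> ?W"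
  then obtain T0 where T0: "T0 \<in> C0" using action_class_nonempty by blast
  have C0A: "C0 \<in> action_space M" using C0 by simp
  note T0' = action_class_rep[OF C0A T0]
  let ?S = "sphere (0::real^'d) 1 \<times> {- K..K}"
  let ?good = "\<lambda>p X. openin (weak_topology M) (fst X) \<and> C0 \<in> fst X \<and> snd X > (0::real) \<and>
      (\<forall>C T v' \<theta>'. C \<in> fst X \<longrightarrow> T \<in> C \<longrightarrow> dist (fst p) v' < snd X \<longrightarrow> dist (snd p) \<theta>' < snd X \<longrightarrow> small_average M A k B v' \<theta>' \<epsilon> T)"
  have "\<exists>X. ?good p X" if p: "p \<in> ?S" for p
  proof -
    have "small_average M A k B (fst p) (snd p) \<epsilon> T0"
      using C0 T0 p by (auto simp: mem_Times_iff abs_le_iff)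
    from small_average_neighbourhood[OF prob A T0'(1) this] obtain O' \<rho> where
      O': "openin (weak_topology M) O'" "C0 \<in> O'" "\<rho> > 0"
      "\<And>C T v' \<theta>'. C \<in> O' \<Longrightarrow> T \<in> C \<Longrightarrow> dist (fst p) v' < \<rho> \<Longrightarrow> dist (snd p) \<theta>' < \<rho> \<Longrightarrow> small_average M A k B v' \<theta>' \<epsilon> T"
      unfolding T0'(2)[symmetric] by blast
    show ?thesis
      by (rule exI[of _ "(O', \<rho>)"], unfold fst_conv snd_conv, intro conjI allI impI) (fact O'(1), fact O'(2), fact O'(3), rule O'(4))
  qed
  then have "\<forall>p\<in>?S. \<exists>X. ?good p X" by (rule ballI)
  from bchoice[OF this] obtain X where X: "\<forall>p\<in>?S. ?good p (X p)" by (elim exE)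
  define O' where "O' p = fst (X p)" for p
  define \<rho> where "\<rho> p = snd (X p)" for p
  have O': "openin (weak_topology M) (O' p)" "C0 \<in> O' p" and \<rho>: "\<rho> p > 0"
    and sm: "C \<in> O' p \<Longrightarrow> T \<in> C \<Longrightarrow> dist (fst p) v' < \<rho> p \<Longrightarrow> dist (snd p) \<theta>' < \<rho> p \<Longrightarrow> small_average M A k B v' \<theta>' \<epsilon> T"
    if "p \<in> ?S" for p C T v' \<theta>'
    using bspec[OF X that] unfolding O'_def \<rho>_def by simp_all
  have "compact ?S" by (intro compact_Times compact_sphere compact_Icc)
  moreover have "open (ball (fst p) (\<rho> p) \<times> ball (snd p) (\<rho> p))" for p :: "(real^'d) \<times> real" by (intro open_Times open_ball)
  moreover have "?S \<subseteq> (\<Union>p\<in>?S. ball (fst p) (\<rho> p) \<times> ball (snd p) (\<rho> p))"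
    using \<rho> by (auto simp: mem_Times_iff intro!: bexI)
  ultimately obtain P where P: "P \<subseteq> ?S" "finite P" "?S \<subseteq> (\<Union>p\<in>P. ball (fst p) (\<rho> p) \<times> ball (snd p) (\<rho> p))"
    by (rule compactE_image)
  let ?O = "topspace (weak_topology M) \<inter> (\<Inter>p\<in>P. O' p)"
  have "openin (weak_topology M) ?O"
  proof -
    have "openin (weak_topology M) (O' p)" if "p \<in> P" for p using O'(1) P(1) that by blast
    from openin_INT[OF P(2) this] show ?thesis by (simp only: Int_commute)
  qed
  moreover have "C0 \<in> ?O" using O'(2) P(1) C0A by (auto simp: topspace_weak_topology)
  moreover have "?O \<subseteq> ?W"
  proof
    fix C assume C: "C \<in> ?O"
    have "small_average M A k B v \<theta> \<epsilon> T" if T: "T \<in> C" and v: "norm v = 1" and \<theta>: "\<bar>\<theta>\<bar> \<le> K" for T v \<theta>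
    proof -
      have "(v, \<theta>) \<in> ?S" using v \<theta> by auto
      then obtain p where p: "p \<in> P" "(v, \<theta>) \<in> ball (fst p) (\<rho> p) \<times> ball (snd p) (\<rho> p)" using P(3) by blast
      have "p \<in> ?S" "C \<in> O' p" using p(1) P(1) C by auto
      from sm[OF this T] p(2) show ?thesis by simp
    qed
    with C show "C \<in> ?W" by (simp add: topspace_weak_topology)
  qed
  ultimately show "\<exists>T. openin (weak_topology M) T \<and> C0 \<in> T \<and> T \<subseteq> ?W" by blast
qed

lemma small_average_mono: "small_average M A k B v \<theta> \<epsilon> T \<Longrightarrow> \<epsilon> \<le> \<epsilon>' \<Longrightarrow> small_average M A k B v \<theta> \<epsilon>' T"
  unfolding small_average_def by (meson less_le_trans)

text \<open>Bounding the frequency by an integer \<open>K\<close> and \<open>\<epsilon>\<close> below by \<open>1 / (m + 1)\<close> leaves countably many open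
conditions.\<close>
theorem gdelta_in_WA:
  fixes M :: "'a measure"
  assumes prob: "prob_space M"
    and \<A>: "countable \<A>" "Int_stable \<A>" "\<A> \<subseteq> sets M" "space M \<in> \<A>"
    and approx: "\<And>A. A \<in> sets M \<Longrightarrow> \<exists>A'\<in>sigma_sets (space M) \<A>. AE x in M. x \<in> A \<longleftrightarrow> x \<in> A'"
  shows "gdelta_in (weak_topology M) (WA M :: ('a, 'd::finite) zd_map set set)"
proof -
  obtain \<B> :: "(real^'d) set set" where \<B>: "countable \<B>" "Int_stable \<B>" "UNIV \<in> \<B>" "\<And>U. U \<in> \<B> \<Longrightarrow> open U"
    "sets borel = sigma_sets UNIV \<B>"
    using countable_open_generator by blast
  define W :: "'a set \<times> (real^'d) set \<times> nat \<times> nat \<times> nat \<Rightarrow> ('a, 'd) zd_map set set" where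
    "W = (\<lambda>(A, B, k, K, m). {C \<in> action_space M. \<forall>T\<in>C. \<forall>v \<theta>. norm v = 1 \<longrightarrow> \<bar>\<theta>\<bar> \<le> real K \<longrightarrow> small_average M A k B v \<theta> (1 / real (Suc m)) T})"
  let ?I = "\<A> \<times> \<B> \<times> (UNIV :: nat set) \<times> (UNIV :: nat set) \<times> (UNIV :: nat set)"
  have iff: "(weak_mixing M T \<and> (\<forall>e\<in>{1..CARD('d)}. \<forall>L\<in>directions e. directional_weak_mixing M T L))
    \<longleftrightarrow> (\<forall>A\<in>\<A>. \<forall>B\<in>\<B>. \<forall>k v \<theta> \<epsilon>. norm v = 1 \<longrightarrow> \<epsilon> > 0 \<longrightarrow> small_average M A k B v \<theta> \<epsilon> T)"
    if "T \<in> mp_actions M" for T :: "('a, 'd) zd_map"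
    by (rule WA_conditions_iff_small_averages[OF prob that \<A>(2,3,4) approx \<B>(2,3,4,5)])
  have "WA M = (\<Inter>i\<in>?I. W i)"
  proof (intro equalityI subsetI)
    fix C :: "('a, 'd) zd_map set" assume C: "C \<in> WA M"
    have CA: "C \<in> action_space M" using C by (simp add: WA_def)
    have "small_average M A k B v \<theta> \<epsilon> T" if "A \<in> \<A>" "B \<in> \<B>" "T \<in> C" "norm v = 1" "\<epsilon> > 0" for A B k v \<theta> \<epsilon> T
    proof -
      have "weak_mixing M T \<and> (\<forall>e\<in>{1..CARD('d)}. \<forall>L\<in>directions e. directional_weak_mixing M T L)"
        using C that(3) by (simp add: WA_def)
      then show ?thesis using iff[OF action_class_rep(1)[OF CA that(3)]] that by blast
    qed
    then show "C \<in> (\<Inter>i\<in>?I. W i)" using CA by (auto simp: W_def)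
  next
    fix C :: "('a, 'd) zd_map set" assume C: "C \<in> (\<Inter>i\<in>?I. W i)"
    have CW: "C \<in> W (A, B, k, K, m)" if "A \<in> \<A>" "B \<in> \<B>" for A B k K m using C that by blast
    have CA: "C \<in> action_space M" using CW[OF \<A>(4) \<B>(3), of 0 0 0] by (simp add: W_def)
    have "small_average M A k B v \<theta> \<epsilon> T" if h: "A \<in> \<A>" "B \<in> \<B>" "T \<in> C" "norm v = 1" "\<epsilon> > 0" for A B k v \<theta> \<epsilon> T
    proof -
      obtain m where m: "1 / real (Suc m) < \<epsilon>" using reals_Archimedean[OF h(5)] by (auto simp: inverse_eq_divide)
      obtain K where K: "\<bar>\<theta>\<bar> \<le> real K" using real_arch_simple by blast
      have "small_average M A k B v \<theta> (1 / real (Suc m)) T" using CW[OF h(1,2), of k K m] h(3,4) K by (simp add: W_def)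
      then show ?thesis by (rule small_average_mono) (use m in simp)
    qed
    then have "weak_mixing M T \<and> (\<forall>e\<in>{1..CARD('d)}. \<forall>L\<in>directions e. directional_weak_mixing M T L)" if "T \<in> C" for T
      using iff[OF action_class_rep(1)[OF CA that]] that by blast
    then show "C \<in> WA M" using CA by (simp add: WA_def)
  qed
  moreover have "gdelta_in (weak_topology M) (\<Inter>(W ` ?I))"
  proof (rule gdelta_in_Inter)
    show "countable (W ` ?I)" by (intro countable_image countable_SIGMA \<A>(1) \<B>(1)) auto
    show "W ` ?I \<noteq> {}" using \<A>(4) \<B>(3) by auto
    fix S assume "S \<in> W ` ?I"
    then obtain A B k K m where "A \<in> \<A>" and S: "S = W (A, B, k, K, m)" by auto
    then have "openin (weak_topology M) S"
      unfolding S W_def prod.case using \<A>(3) by (intro openin_small_averages[OF prob]) auto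
    then show "gdelta_in (weak_topology M) S" by (rule open_imp_gdelta_in)
  qed
  ultimately show ?thesis by simp
qed

section \<open>Mixing implies small averages in every direction\<close>

lemma unit_cube_norm_bound:
  obtains D where "\<And>r. r \<in> (unit_cube :: (real^'d::finite) set) \<Longrightarrow> norm r \<le> D"
proof -
  have "bounded (unit_cube :: (real^'d) set)"
    by (rule bounded_subset[OF bounded_cbox unit_cube_sandwich(2)])
  then show ?thesis using that by (auto simp: bounded_iff)
qed

text \<open>Moving far along \<open>v\<close> takes every point of the cube to a distant tile.\<close>
lemma floor_vec_leaves_finite_sets:
  fixes v :: "real ^ 'd::finite"
  assumes "finite J" "norm v = 1"
  obtains R where "\<And>s r. s \<ge> R \<Longrightarrow> r \<in> unit_cube \<Longrightarrow> floor_vec (s *\<^sub>R v + r) \<notin> J"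
proof -
  obtain D where D: "\<And>r. r \<in> (unit_cube :: (real^'d) set) \<Longrightarrow> norm r \<le> D" using unit_cube_norm_bound by blast
  obtain b where b: "\<And>n. n \<in> J \<Longrightarrow> norm (int_vec n) \<le> b"
  proof -
    have "bounded (int_vec ` J)" using assms(1) by (intro finite_imp_bounded finite_imageI)
    then show ?thesis using that by (auto simp: bounded_iff)
  qed
  have "floor_vec (s *\<^sub>R v + r) \<notin> J" if s: "s \<ge> b + 2 * D + 1" and r: "r \<in> unit_cube" for s r
  proof
    let ?n = "floor_vec (s *\<^sub>R v + r)"
    assume "?n \<in> J"
    have "s *\<^sub>R v = int_vec ?n + frac_vec (s *\<^sub>R v + r) - r" by (simp add: frac_vec_eq)
    then have "norm (s *\<^sub>R v) \<le> norm (int_vec ?n) + norm (frac_vec (s *\<^sub>R v + r)) + norm r"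
      using norm_triangle_ineq4[of "int_vec ?n + frac_vec (s *\<^sub>R v + r)" r]
        norm_triangle_ineq[of "int_vec ?n" "frac_vec (s *\<^sub>R v + r)"] by simp
    also have "\<dots> \<le> b + D + D" using b[OF \<open>?n \<in> J\<close>] D[OF frac_vec_in_unit_cube] D[OF r] by (intro add_mono)
    finally have "\<bar>s\<bar> \<le> b + 2 * D" using assms(2) by simp
    with s show False by linarith
  qed
  then show ?thesis by (rule that)
qed

lemma centred_correlation:
  assumes prob: "prob_space M" and A: "A \<in> sets M" and S: "S \<in> mp_actions M"
  shows "(\<integral>x. centred M A (S n x) * cnj (centred M A x) \<partial>M)
     = complex_of_real (measure M (S n -` A \<inter> space M \<inter> A) - measure M A * measure M A)"
proof -
  interpret M: prob_space M by (rule prob)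
  let ?a = "measure M A"
  have SA: "S n -` A \<inter> space M \<in> sets M" by (rule measurable_sets[OF mp_actionsD(1)[OF S] A])
  have mS: "measure M (S n -` A \<inter> space M) = ?a"
    using measure_distr[OF mp_actionsD(1)[OF S] A, of n] mp_actionsD(2)[OF S] by simp
  have "(\<integral>x. centred M A (S n x) * cnj (centred M A x) \<partial>M)
      = (\<integral>x. complex_of_real (indicator (S n -` A \<inter> space M \<inter> A) x - ?a * indicator (S n -` A \<inter> space M) x - ?a * indicator A x + ?a * ?a) \<partial>M)"
    by (intro Bochner_Integration.integral_cong refl) (auto simp: centred_def indicator_def algebra_simps)
  also have "\<dots> = complex_of_real (\<integral>x. indicator (S n -` A \<inter> space M \<inter> A) x - ?a * indicator (S n -` A \<inter> space M) x - ?a * indicator A x + ?a * ?a \<partial>M)"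
    by (rule integral_complex_of_real)
  also have "(\<integral>x. indicator (S n -` A \<inter> space M \<inter> A) x - ?a * indicator (S n -` A \<inter> space M) x - ?a * indicator A x + ?a * ?a \<partial>M)
     = measure M (S n -` A \<inter> space M \<inter> A) - ?a * measure M (S n -` A \<inter> space M) - ?a * ?a + ?a * ?a"
  proof -
    have i: "integrable M (indicator X :: 'a \<Rightarrow> real)" "(\<integral>x. indicator X x \<partial>M) = measure M X" if "X \<in> sets M" for X
      using that M.emeasure_eq_measure sets.sets_into_space[OF that] by (auto simp: Int_absorb2)
    have SAA: "S n -` A \<inter> space M \<inter> A \<in> sets M" using SA A by (rule sets.Int)
    show ?thesis
      using i[OF SA] i[OF A] i[OF SAA] by (simp add: M.prob_space)
  qed
  finally show ?thesis by (simp add: mS)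
qed

text \<open>At late times the flow carries every fibre along by one of finitely many maps \<open>S n\<close>, all with
\<open>n\<close> distant, so a test function and its delay become nearly orthogonal.\<close>
lemma small_average_of_mixing:
  fixes v :: "real ^ 'd::finite"
  assumes prob: "prob_space M" and A: "A \<in> sets M" and S: "S \<in> mp_actions M"
    and mix: "mixing_along M S A A" and v: "norm v = 1" and \<epsilon>: "\<epsilon> > 0"
  shows "small_average M A k B v \<theta> \<epsilon> S"
proof -
  let ?Q = "suspension_measure M :: ('a \<times> (real^'d)) measure"
  let ?F = "test_fun M A k (B \<inter> box 0 1)"
  interpret M: prob_space M by (rule prob)
  interpret C: prob_space "cube_measure :: (real^'d) measure" by (rule prob_space_cube_measure)
  interpret P: pair_prob_space M "cube_measure :: (real^'d) measure" ..
  interpret FS: mp_flow ?Q "\<lambda>t. suspension S (t *\<^sub>R v)" by (rule directional_flow[OF prob S])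
  have FL: "?F \<in> L2_fun ?Q" by (rule test_fun_L2[OF prob A])
  have "\<exists>R. \<forall>s\<ge>R. cmod (\<integral>y. ?F (suspension S (s *\<^sub>R v) y) * cnj (?F y) \<partial>?Q) \<le> e" if e: "e > 0" for e
  proof -
    let ?\<gamma> = "\<lambda>n. measure M (S n -` A \<inter> space M \<inter> A) - measure M A * measure M A"
    have "\<forall>\<^sub>F n in cofinite. dist (measure M (S n -` A \<inter> space M \<inter> A)) (measure M A * measure M A) < e"
      using mix e unfolding mixing_along_def by (rule tendstoD)
    then have fin: "finite {n. \<not> \<bar>?\<gamma> n\<bar> < e}" by (simp add: eventually_cofinite dist_real_def)
    obtain R where R: "\<And>s r. s \<ge> R \<Longrightarrow> r \<in> unit_cube \<Longrightarrow> floor_vec (s *\<^sub>R v + r) \<notin> {n. \<not> \<bar>?\<gamma> n\<bar> < e}"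
      by (rule floor_vec_leaves_finite_sets[OF fin v]) blast
    have "cmod (\<integral>y. ?F (suspension S (s *\<^sub>R v) y) * cnj (?F y) \<partial>?Q) \<le> e" if s: "s \<ge> R" for s
    proof -
      let ?G = "\<lambda>y. ?F (suspension S (s *\<^sub>R v) y) * cnj (?F y)"
      have i: "integrable ?Q ?G" by (rule L2_inner_integrable[OF FS.L2_fun_flow[OF FL] FL])
      then have i': "integrable (M \<Otimes>\<^sub>M cube_measure) (\<lambda>(x, r). ?G (x, r))"
        by (simp add: suspension_measure_def case_prod_unfold)
      have inner: "cmod (\<integral>x. ?G (x, r) \<partial>M) \<le> e" if r: "r \<in> unit_cube" for r
      proof -
        let ?n = "floor_vec (s *\<^sub>R v + r)" and ?b = "bump k (B \<inter> box 0 1)"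
        let ?h = "?b (frac_vec (s *\<^sub>R v + r)) * ?b r"
        have "?G (x, r) = complex_of_real ?h * (centred M A (S ?n x) * cnj (centred M A x))" for x
          by (simp add: suspension_eq test_fun_def)
        then have "(\<integral>x. ?G (x, r) \<partial>M) = complex_of_real ?h * complex_of_real (?\<gamma> ?n)"
          by (simp only: integral_mult_right_zero centred_correlation[OF prob A S])
        then have "cmod (\<integral>x. ?G (x, r) \<partial>M) = \<bar>?h\<bar> * \<bar>?\<gamma> ?n\<bar>" by (simp only: norm_mult norm_of_real)
        also have "\<dots> \<le> 1 * e"
        proof (intro mult_mono)
          show "\<bar>?h\<bar> \<le> 1" unfolding abs_mult
            using bump_bounds[of k "B \<inter> box 0 1"] by (intro mult_le_one) auto
          show "\<bar>?\<gamma> ?n\<bar> \<le> e" using R[OF s r] by simp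
        qed auto
        finally show ?thesis by simp
      qed
      have "(\<integral>y. ?G y \<partial>?Q) = (\<integral>r. (\<integral>x. ?G (x, r) \<partial>M) \<partial>cube_measure)"
        using P.integral_snd[OF i'] by (simp add: suspension_measure_def case_prod_unfold)
      also have "cmod \<dots> \<le> (\<integral>r. cmod (\<integral>x. ?G (x, r) \<partial>M) \<partial>cube_measure)" by (rule integral_norm_bound)
      also have "\<dots> \<le> (\<integral>r. e \<partial>(cube_measure :: (real^'d) measure))"
        by (intro integral_mono integrable_norm P.integrable_snd[OF i'] inner) (auto simp: space_cube_measure)
      also have "\<dots> = e" by (simp add: C.prob_space)
      finally show ?thesis .
    qed
    then show ?thesis by blast
  qed
  from FS.averages_small_of_decorrelation[OF FL this \<epsilon>] show ?thesis unfolding small_average_def .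
qed

section \<open>Density\<close>

lemma AE_completion_or_self:
  assumes "M = N \<or> M = completion N"
  shows "(AE x in M. P x) \<longleftrightarrow> (AE x in N. P x)"
  using assms by (auto simp: AE_completion_iff)

text \<open>For real functions this is the description of the completed measure; a Borel coding of the
target reduces the general case to it.\<close>
lemma borel_version:
  fixes f :: "'a \<Rightarrow> 'b::{complete_space, second_countable_topology}"
  assumes MN: "M = N \<or> M = completion N" and f: "f \<in> borel_measurable M"
  obtains f' where "f' \<in> borel_measurable N" "AE x in N. f x = f' x"
proof (cases "M = N")
  case True
  show ?thesis
  proof (rule that[of f])
    show "f \<in> borel_measurable N" using f True by simp
  qed simp
next
  case False
  then have M: "M = completion N" using MN by simp
  obtain j :: "'b \<Rightarrow> real" and r :: "real \<Rightarrow> 'b" where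
    jr: "j \<in> borel_measurable borel" "r \<in> borel_measurable borel" "\<And>x. r (j x) = x"
    "\<And>x. 0 \<le> j x" "\<And>x. j x \<le> 1" by (rule polish_borel_coding, rule that; assumption)
  have "(\<lambda>x. j (f x)) \<in> borel_measurable (completion N)"
    using measurable_compose[OF f jr(1)] unfolding M .
  from completion_ex_borel_measurable_real[OF this] obtain h where
    h: "h \<in> borel_measurable N" "AE x in N. j (f x) = h x" by blast
  show ?thesis
  proof (rule that[of "\<lambda>x. r (h x)"])
    show "(\<lambda>x. r (h x)) \<in> borel_measurable N" by (rule measurable_compose[OF h(1) jr(2)])
    show "AE x in N. f x = r (h x)" using h(2)
    proof eventually_elim
      case (elim x)
      show ?case by (simp only: elim[symmetric] jr(3))
    qed
  qed
qed

lemma measure_preserving_completion: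
  assumes "M = N \<or> M = completion N" "f \<in> N \<rightarrow>\<^sub>M N" "distr N N f = N"
  shows "f \<in> M \<rightarrow>\<^sub>M M" "distr M M f = M"
proof -
  have c: "f \<in> completion N \<rightarrow>\<^sub>M N" by (rule measurable_completion[OF assms(2)])
  have d: "distr (completion N) N f = N" using distr_completion[OF assms(2)] assms(3) by simp
  have n: "null_sets N = null_sets (distr (completion N) N f)" by (simp only: d)
  have "f \<in> completion N \<rightarrow>\<^sub>M completion N" by (rule completion.measurable_completion2[OF c]) (simp only: n)
  moreover have "distr (completion N) (completion N) f = completion N"
    using completion.completion_distr_eq[OF c n[symmetric]] by (simp only: d)
  ultimately have cc: "f \<in> completion N \<rightarrow>\<^sub>M completion N" "distr (completion N) (completion N) f = completion N"
    by blast+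
  show "f \<in> M \<rightarrow>\<^sub>M M" by (rule disjE[OF assms(1)]) (simp_all only: assms(2) cc)
  show "distr M M f = M" by (rule disjE[OF assms(1)]) (simp_all only: assms(3) cc)
qed

context
  fixes M N :: "'a::polish_space measure"
  assumes MN: "M = N \<or> M = completion N" and probN: "prob_space N" and setsN: "sets N = sets borel"
begin

interpretation N: prob_space N by (rule probN)

lemma spaceNM: "space N = UNIV" "space M = UNIV"
  using sets_eq_imp_space_eq[OF setsN] MN by auto

lemma sets_sub: "A \<in> sets N \<Longrightarrow> A \<in> sets M" and measure_sub: "A \<in> sets N \<Longrightarrow> measure M A = measure N A"
  and emeasure_sub: "A \<in> sets N \<Longrightarrow> emeasure M A = emeasure N A"
  using MN by auto

lemma prob_space_M: "prob_space M"
proof (rule prob_spaceI)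
  show "emeasure M (space M) = 1"
    using N.emeasure_space_1 emeasure_sub[OF sets.top] by (simp add: spaceNM)
qed

interpretation M: prob_space M by (rule prob_space_M)

lemma ident_measurable: "(\<lambda>x. x) \<in> M \<rightarrow>\<^sub>M N"
  by (rule measurableI) (auto simp: spaceNM sets_sub)

lemma measurable_sub: "f \<in> N \<rightarrow>\<^sub>M R \<Longrightarrow> f \<in> M \<rightarrow>\<^sub>M R"
  by (rule measurable_compose[OF ident_measurable])

lemma mp_actions_sub:
  assumes "S \<in> mp_actions N"
  shows "S \<in> mp_actions M"
  unfolding mp_actions_def measure_preserving_def
proof (intro CollectI conjI allI ballI)
  show "S n \<in> M \<rightarrow>\<^sub>M M" "distr M M (S n) = M" for n
    by (rule measure_preserving_completion[OF MN mp_actionsD(1,2)[OF assms]])+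
  show "S 0 x = x" "S (m + n) x = S m (S n x)" for x m n
    by (rule mp_actionsD(3,4)[OF assms], simp add: spaceNM)+
qed

lemma measurable_set_version:
  assumes "A \<in> sets M"
  shows "\<exists>A'\<in>sets N. AE x in M. x \<in> A \<longleftrightarrow> x \<in> A'"
proof -
  have "indicator A \<in> borel_measurable M" using assms by simp
  then obtain h :: "'a \<Rightarrow> real" where h: "h \<in> borel_measurable N" "AE x in N. indicator A x = h x"
    by (rule borel_version[OF MN])
  have "{x \<in> space N. h x = 1} \<in> sets N" using h(1) by measurable
  moreover have "AE x in M. x \<in> A \<longleftrightarrow> x \<in> {x \<in> space N. h x = 1}"
    unfolding AE_completion_or_self[OF MN] using h(2)
  proof eventually_elim
    case (elim x)
    then show ?case by (cases "x \<in> A") (auto simp: spaceNM)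
  qed
  ultimately show ?thesis by blast
qed

text \<open>Simple functions for the Borel structure suffice, which is what the index functions of the
Bernoulli approximation require.\<close>
lemma L2_simple_approximation:
  assumes f: "f \<in> L2_fun M" and \<epsilon>: "\<epsilon> > 0"
  obtains g where "simple_function N g" "g \<in> L2_fun M" "L2_dist M f g < \<epsilon>"
proof -
  obtain f' where f': "f' \<in> borel_measurable N" "AE x in N. f x = f' x"
    by (rule borel_version[OF MN L2_funD(1)[OF f]])
  obtain F where F: "\<And>i. simple_function N (F i)" "\<And>x. (\<lambda>i. F i x) \<longlonglongrightarrow> f' x"
    "\<And>i x. cmod (F i x) \<le> 2 * cmod (f' x)"
    using borel_measurable_implies_sequence_metric[OF f'(1), of 0] by (auto simp: spaceNM)
  have fm: "f \<in> borel_measurable M" by (rule L2_funD(1)[OF f])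
  have Fm: "F i \<in> borel_measurable M" for i
    by (rule measurable_sub[OF borel_measurable_simple_function[OF F(1)]])
  have ae: "AE x in M. f x = f' x" using f'(2) by (simp only: AE_completion_or_self[OF MN])
  have b9: "(cmod (a - b))\<^sup>2 \<le> 9 * (cmod a)\<^sup>2" if "cmod b \<le> 2 * cmod a" for a b
  proof -
    have "cmod (a - b) \<le> 3 * cmod a" using norm_triangle_ineq4[of a b] that by linarith
    then have "(cmod (a - b))\<^sup>2 \<le> (3 * cmod a)\<^sup>2" by (intro power_mono) auto
    then show ?thesis by (simp add: power_mult_distrib)
  qed
  have lim: "(\<lambda>i. \<integral>x. (cmod (f x - F i x))\<^sup>2 \<partial>M) \<longlonglongrightarrow> (\<integral>x. 0 \<partial>M)"
  proof (rule integral_dominated_convergence[where w = "\<lambda>x. 9 * (cmod (f x))\<^sup>2"])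
    show "integrable M (\<lambda>x. 9 * (cmod (f x))\<^sup>2)" using L2_funD(2)[OF f] by simp
    show "AE x in M. (\<lambda>i. (cmod (f x - F i x))\<^sup>2) \<longlonglongrightarrow> 0" using ae
    proof eventually_elim
      case (elim x)
      have "(\<lambda>i. (cmod (f x - F i x))\<^sup>2) \<longlonglongrightarrow> (cmod (f x - f x))\<^sup>2"
        using F(2)[of x] elim by (intro tendsto_intros) simp
      then show ?case by simp
    qed
    show "AE x in M. norm ((cmod (f x - F i x))\<^sup>2) \<le> 9 * (cmod (f x))\<^sup>2" for i using ae
    proof eventually_elim
      case (elim x)
      then show ?case using b9[of "F i x" "f x"] F(3)[of i x] by simp
    qed
  qed (use fm Fm in measurable)
  then have "\<forall>\<^sub>F i in sequentially. (\<integral>x. (cmod (f x - F i x))\<^sup>2 \<partial>M) < \<epsilon>\<^sup>2"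
    using \<epsilon> by (intro order_tendstoD(2)) auto
  then obtain i where i: "(\<integral>x. (cmod (f x - F i x))\<^sup>2 \<partial>M) < \<epsilon>\<^sup>2"
    using eventually_happens'[OF sequentially_bot] by blast
  have FiL: "F i \<in> L2_fun M"
  proof -
    have fin: "finite (range (F i))" using simple_functionD(1)[OF F(1)[of i]] by (simp add: spaceNM)
    have "cmod (F i x) \<le> Max (cmod ` range (F i))" for x using fin by (intro Max_ge) auto
    then show ?thesis by (rule M.L2_fun_bounded[OF Fm])
  qed
  have "L2_dist M f (F i) < \<epsilon>"
    using i \<epsilon> unfolding L2_dist_def by (metis less_eq_real_def real_sqrt_less_iff real_sqrt_unique)
  then show ?thesis by (rule that[OF F(1) FiL])
qed

lemma common_index:
  fixes \<S> :: "('a \<Rightarrow> complex) set"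
  assumes "finite \<S>" "\<And>s. s \<in> \<S> \<Longrightarrow> s \<in> N \<rightarrow>\<^sub>M count_space UNIV \<and> finite (range s)"
  shows "\<exists>k::'a \<Rightarrow> nat. k \<in> N \<rightarrow>\<^sub>M count_space UNIV \<and> (\<forall>s\<in>\<S>. \<forall>x y. k x = k y \<longrightarrow> s x = s y)"
  using assms
proof (induction \<S>)
  case empty
  then show ?case by (intro exI[of _ "\<lambda>_. 0"]) simp
next
  case (insert s \<S>)
  then obtain k :: "'a \<Rightarrow> nat" where k: "k \<in> N \<rightarrow>\<^sub>M count_space UNIV" "\<forall>s\<in>\<S>. \<forall>x y. k x = k y \<longrightarrow> s x = s y" by auto
  have s: "s \<in> N \<rightarrow>\<^sub>M count_space UNIV" "finite (range s)" using insert.prems by auto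
  let ?i = "\<lambda>x. to_nat_on (range s) (s x)"
  have im: "?i \<in> N \<rightarrow>\<^sub>M count_space UNIV" by (rule measurable_compose[OF s(1)]) simp
  have inj: "s x = s y" if "?i x = ?i y" for x y
    using that countable_finite[OF s(2)] by simp
  have "(\<lambda>x. prod_encode (?i x, k x)) \<in> N \<rightarrow>\<^sub>M count_space UNIV"
    using im k(1) by measurable
  then show ?case
    using k(2) inj by (intro exI[of _ "\<lambda>x. prod_encode (?i x, k x)"]) (auto simp: prod_encode_eq)
qed

text \<open>Each function is replaced by a simple function \<open>g\<close>, and the index is chosen to determine
the values of \<open>g\<close> and of \<open>g \<circ> T n\<close>. Off a set of small measure, \<open>g \<circ> S n\<close> and \<open>g \<circ> T n\<close> then agree, and on that
set they are bounded.\<close>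
lemma mixing_approximation:
  fixes T :: "('a, 'd::finite) zd_map"
  assumes points: "\<And>x. emeasure N {x} = 0" and T: "T \<in> mp_actions M"
    and P: "finite P" "fst ` P \<subseteq> L2_fun M" and \<epsilon>: "\<epsilon> > 0"
  obtains S :: "('a, 'd) zd_map" where "S \<in> mp_actions M"
    "\<And>A. A \<in> sets N \<Longrightarrow> mixing_along M S A A"
    "\<And>f n. (f, n) \<in> P \<Longrightarrow> L2_dist M (f \<circ> S n) (f \<circ> T n) < \<epsilon>"
proof -
  note Tm = mp_actionsD(1)[OF T] and Td = mp_actionsD(2)[OF T]
  note AEM = AE_completion_or_self[OF MN]
  have "\<exists>T'. T' \<in> N \<rightarrow>\<^sub>M N \<and> (AE x in M. T n x = T' x)" for n
  proof -
    have "T n \<in> borel_measurable M"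
      using measurable_compose[OF Tm[of n] ident_measurable] by (simp add: measurable_cong_sets[OF refl setsN])
    then obtain T' where "T' \<in> borel_measurable N" "AE x in N. T n x = T' x" by (rule borel_version[OF MN])
    then show ?thesis by (auto simp: AEM measurable_cong_sets[OF refl setsN])
  qed
  then obtain T' where T'm: "\<And>n. T' n \<in> N \<rightarrow>\<^sub>M N" and T'eq: "\<And>n. AE x in M. T n x = T' n x" by metis
  have T'd: "distr N N (T' n) = N" for n
  proof (rule measure_eqI)
    fix A assume "A \<in> sets (distr N N (T' n))"
    then have A: "A \<in> sets N" by simp
    have A': "T' n -` A \<inter> space N \<in> sets N" using T'm A by (rule measurable_sets)
    have TA: "T n -` A \<inter> space M \<in> sets M" using Tm sets_sub[OF A] by (rule measurable_sets)
    have "emeasure N (T' n -` A \<inter> space N) = emeasure M (T n -` A \<inter> space M)"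
      unfolding emeasure_sub[OF A', symmetric]
    proof (rule emeasure_eq_AE)
      show "AE x in M. x \<in> T' n -` A \<inter> space N \<longleftrightarrow> x \<in> T n -` A \<inter> space M"
        using T'eq[of n] by eventually_elim (simp add: spaceNM)
    qed (use sets_sub[OF A'] TA in auto)
    also have "\<dots> = emeasure M A" using emeasure_distr[OF Tm[of n] sets_sub[OF A]] Td by simp
    finally show "emeasure (distr N N (T' n)) A = emeasure N A"
      using emeasure_distr[OF T'm A] emeasure_sub[OF A] by simp
  qed simp
  have T'add: "AE x in N. T' m (T' n x) = T' (m + n) x" for m n
  proof -
    have "AE x in M. T m (T n x) = T' m (T n x)"
      by (rule AE_distrD[OF Tm[of n]]) (unfold Td, rule T'eq)
    then have "AE x in M. T' m (T' n x) = T' (m + n) x"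
      using T'eq[of n] T'eq[of "m + n"] AE_space
    proof eventually_elim
      case (elim x)
      then show ?case using mp_actionsD(4)[OF T, of x m n] by simp
    qed
    then show ?thesis by (simp only: AEM)
  qed
  have "\<forall>f\<in>fst ` P. \<exists>g. simple_function N g \<and> g \<in> L2_fun M \<and> L2_dist M f g < \<epsilon> / 3"
  proof
    fix f assume "f \<in> fst ` P"
    then have "f \<in> L2_fun M" using P(2) by auto
    then show "\<exists>g. simple_function N g \<and> g \<in> L2_fun M \<and> L2_dist M f g < \<epsilon> / 3"
      using L2_simple_approximation[of f "\<epsilon> / 3"] \<epsilon> by (metis divide_pos_pos zero_less_numeral)
  qed
  from bchoice[OF this] obtain G where G: "\<forall>f\<in>fst ` P. simple_function N (G f) \<and> G f \<in> L2_fun M \<and> L2_dist M f (G f) < \<epsilon> / 3"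
    by (elim exE)
  have GP: "simple_function N (G f)" "G f \<in> L2_fun M" "L2_dist M f (G f) < \<epsilon> / 3" if "(f, n) \<in> P" for f n
    using bspec[OF G, of f] that by force+
  have Gc: "G f \<in> N \<rightarrow>\<^sub>M count_space UNIV" and Gfin: "finite (range (G f))" if "(f, n) \<in> P" for f n
    using measurable_simple_function[OF GP(1)[OF that]] simple_functionD(1)[OF GP(1)[OF that]] by (auto simp: spaceNM)
  let ?\<S> = "(\<lambda>(f, n). G f) ` P \<union> (\<lambda>(f, n) x. G f (T' n x)) ` P"
  have "\<exists>k::'a \<Rightarrow> nat. k \<in> N \<rightarrow>\<^sub>M count_space UNIV \<and> (\<forall>s\<in>?\<S>. \<forall>x y. k x = k y \<longrightarrow> s x = s y)"
  proof (rule common_index)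
    show "finite ?\<S>" using P(1) by simp
    fix s assume "s \<in> ?\<S>"
    then show "s \<in> N \<rightarrow>\<^sub>M count_space UNIV \<and> finite (range s)"
    proof
      assume "s \<in> (\<lambda>(f, n). G f) ` P"
      then show ?thesis using Gc Gfin by auto
    next
      assume "s \<in> (\<lambda>(f, n) x. G f (T' n x)) ` P"
      then obtain f n where fn: "(f, n) \<in> P" and s: "s = (\<lambda>x. G f (T' n x))" by auto
      have "range s \<subseteq> range (G f)" by (auto simp: s)
      then show ?thesis
        using measurable_compose[OF T'm Gc[OF fn]] finite_subset[OF _ Gfin[OF fn]] by (simp add: s)
    qed
  qed
  then obtain k :: "'a \<Rightarrow> nat" where km: "k \<in> N \<rightarrow>\<^sub>M count_space UNIV"
    and k: "\<forall>s\<in>?\<S>. \<forall>x y. k x = k y \<longrightarrow> s x = s y" by (elim exE conjE)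
  have k1: "G f x = G f y" and k2: "G f (T' n x) = G f (T' n y)" if "(f, n) \<in> P" "k x = k y" for f n x y
  proof -
    have 1: "G f \<in> ?\<S>" by (rule UnI1, rule image_eqI[OF _ that(1)]) simp
    have 2: "(\<lambda>x. G f (T' n x)) \<in> ?\<S>" by (rule UnI2, rule image_eqI[OF _ that(1)]) simp
    show "G f x = G f y" by (rule k[rule_format, OF 1 that(2)])
    show "G f (T' n x) = G f (T' n y)" by (rule k[rule_format, OF 2 that(2)])
  qed
  have "bounded (\<Union>f\<in>fst ` P. range (G f))"
    using P(1) Gfin by (intro finite_imp_bounded finite_UN_I) auto
  then obtain K where K0: "\<And>z. z \<in> (\<Union>f\<in>fst ` P. range (G f)) \<Longrightarrow> cmod z \<le> K" by (auto simp: bounded_iff)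
  define K' where "K' = max K 1"
  have K: "cmod (G f x) \<le> K'" if "(f, n) \<in> P" for f n x
    using K0[of "G f x"] that unfolding K'_def by force
  have K': "K' > 0" by (simp add: K'_def)
  \<comment> \<open>Two functions bounded by \<open>K'\<close> that differ on a set of measure below \<open>\<delta>\<close> have distance below \<open>\<epsilon> / 3\<close>.\<close>
  define \<delta> where "\<delta> = (\<epsilon> / 3)\<^sup>2 / (2 * K')\<^sup>2"
  have \<delta>: "\<delta> > 0" using \<epsilon> K' by (simp add: \<delta>_def)
  obtain S :: "('a, 'd) zd_map" where S: "S \<in> mp_actions N"
    and mix: "\<And>A B. A \<in> sets N \<Longrightarrow> B \<in> sets N \<Longrightarrow> mixing_along N S A B"
    and close: "\<And>n. n \<in> snd ` P \<Longrightarrow> \<exists>B\<in>sets N. measure N B < \<delta> \<and>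
        (AE x in N. x \<notin> B \<longrightarrow> (\<exists>y. k y = k x \<and> k (S n x) = k (T' n y)))"
    by (rule bernoulli_approximation[OF probN setsN T'm T'd T'add points km finite_imageI[OF P(1), of snd] \<delta>],
        rule that; assumption)
  have SM: "S \<in> mp_actions M" by (rule mp_actions_sub[OF S])
  show ?thesis
  proof (rule that[OF SM])
    fix A assume A: "A \<in> sets N"
    have "S n -` A \<inter> space N \<inter> A \<in> sets N" for n
      using measurable_sets[OF mp_actionsD(1)[OF S] A] A by auto
    then show "mixing_along M S A A"
      using mix[OF A A] A by (simp add: mixing_along_def measure_sub spaceNM)
  next
    fix f n assume fn: "(f, n) \<in> P"
    have fL: "f \<in> L2_fun M" using P(2) fn by force
    note gL = GP(2)[OF fn]
    let ?g = "G f"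
    obtain B where B: "B \<in> sets N" "measure N B < \<delta>"
      and Bk: "AE x in N. x \<notin> B \<longrightarrow> (\<exists>y. k y = k x \<and> k (S n x) = k (T' n y))"
      using close[of n] fn by force
    have BM: "B \<in> sets M" by (rule sets_sub[OF B(1)])
    have pw: "AE x in M. (cmod (?g (S n x) - ?g (T n x)))\<^sup>2 \<le> (2 * K')\<^sup>2 * indicator B x"
      using Bk[folded AEM] T'eq[of n]
    proof eventually_elim
      case (elim x)
      show ?case
      proof (cases "x \<in> B")
        case True
        have "cmod (?g (S n x) - ?g (T n x)) \<le> 2 * K'"
          using norm_triangle_ineq4[of "?g (S n x)" "?g (T n x)"] K[OF fn, of "S n x"] K[OF fn, of "T n x"] by linarith
        then have "(cmod (?g (S n x) - ?g (T n x)))\<^sup>2 \<le> (2 * K')\<^sup>2" by (intro power_mono) auto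
        then show ?thesis using True by simp
      next
        case False
        then obtain y where y: "k y = k x" "k (S n x) = k (T' n y)" using elim by blast
        have "?g (S n x) = ?g (T' n y)" by (rule k1[OF fn y(2)])
        also have "\<dots> = ?g (T' n x)" by (rule k2[OF fn y(1)])
        finally show ?thesis using elim False by simp
      qed
    qed
    have gS: "?g \<circ> S n \<in> L2_fun M" and gT: "?g \<circ> T n \<in> L2_fun M" and fS: "f \<circ> S n \<in> L2_fun M" and fT: "f \<circ> T n \<in> L2_fun M"
      using L2_fun_comp gL fL SM T by auto
    have "(\<integral>x. (cmod ((?g \<circ> S n) x - (?g \<circ> T n) x))\<^sup>2 \<partial>M) \<le> (\<integral>x. (2 * K')\<^sup>2 * indicator B x \<partial>M)"
      using pw BM M.emeasure_eq_measure by (intro integral_mono_AE L2_fun_diff_integrable gS gT) auto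
    also have "\<dots> = (2 * K')\<^sup>2 * measure N B" using BM measure_sub[OF B(1)] spaceNM by simp
    also have "\<dots> < (2 * K')\<^sup>2 * \<delta>" using B(2) K' by (intro mult_strict_left_mono) auto
    also have "\<dots> = (\<epsilon> / 3)\<^sup>2" using K' by (simp add: \<delta>_def)
    finally have "(L2_dist M (?g \<circ> S n) (?g \<circ> T n))\<^sup>2 < (\<epsilon> / 3)\<^sup>2" by (simp add: L2_dist_def)
    then have 2: "L2_dist M (?g \<circ> S n) (?g \<circ> T n) < \<epsilon> / 3" by (rule power2_less_imp_less) (use \<epsilon> in simp)
    have inv: "L2_dist M (u \<circ> R n) (w \<circ> R n) = L2_dist M u w" if "R \<in> mp_actions M" "u \<in> L2_fun M" "w \<in> L2_fun M" for R :: "('a, 'd) zd_map" and u w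
    proof -
      have "(\<integral>x. (cmod (u (R n x) - w (R n x)))\<^sup>2 \<partial>M) = (\<integral>x. (cmod (u x - w x))\<^sup>2 \<partial>distr M M (R n))"
        using mp_actionsD(1)[OF that(1)] L2_funD(1)[OF that(2)] L2_funD(1)[OF that(3)]
        by (intro integral_distr[symmetric]) auto
      then show ?thesis using mp_actionsD(2)[OF that(1)] by (simp add: L2_dist_def)
    qed
    have 1: "L2_dist M (f \<circ> S n) (?g \<circ> S n) < \<epsilon> / 3" using inv[OF SM fL gL] GP(3)[OF fn] by simp
    have 3: "L2_dist M (?g \<circ> T n) (f \<circ> T n) < \<epsilon> / 3"
      using inv[OF T gL fL] GP(3)[OF fn] by (simp add: L2_dist_def norm_minus_commute)
    have "L2_dist M (f \<circ> S n) (f \<circ> T n) \<le> L2_dist M (f \<circ> S n) (?g \<circ> S n) + L2_dist M (?g \<circ> S n) (f \<circ> T n)"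
      by (rule L2_dist_triangle[OF fS gS fT])
    moreover have "L2_dist M (?g \<circ> S n) (f \<circ> T n) \<le> L2_dist M (?g \<circ> S n) (?g \<circ> T n) + L2_dist M (?g \<circ> T n) (f \<circ> T n)"
      by (rule L2_dist_triangle[OF gS gT fT])
    ultimately show "L2_dist M (f \<circ> S n) (f \<circ> T n) < \<epsilon>" using 1 2 3 by linarith
  qed
qed

end

lemma weak_topology_basic_neighbourhood:
  fixes T :: "('a, 'd::finite) zd_map"
  assumes T: "T \<in> mp_actions M" and U: "openin (weak_topology M) U" "ae_equal M `` {T} \<in> U"
  shows "\<exists>P \<epsilon>. finite P \<and> (\<forall>(f, n)\<in>P. f \<in> L2_fun M) \<and> \<epsilon> > 0 \<and>
    (\<forall>S\<in>mp_actions M. (\<forall>(f, n)\<in>P. L2_dist M (f \<circ> S n) (f \<circ> T n) < \<epsilon>) \<longrightarrow> ae_equal M `` {S} \<in> U)"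
proof -
  have "generate_topology_on
     {{C \<in> action_space M. \<exists>T\<in>C. L2_dist M (f \<circ> T n) (f \<circ> R n) < \<epsilon>} | f R n \<epsilon>.
        f \<in> L2_fun M \<and> R \<in> mp_actions M \<and> \<epsilon> > 0} U"
    using U(1) by (simp add: weak_topology_def openin_topology_generated_by_iff)
  then show ?thesis using U(2)
  proof (induction rule: generate_topology_on.induct)
    case Empty
    then show ?case by simp
  next
    case (Int a b)
    have e: "ae_equal M `` {T} \<in> a" "ae_equal M `` {T} \<in> b" using Int.prems by simp_all
    from Int.IH(1)[OF e(1)] obtain P1 \<epsilon>1 where 1: "finite P1" "\<forall>(f, n)\<in>P1. f \<in> L2_fun M" "\<epsilon>1 > 0"
      "\<forall>S\<in>mp_actions M. (\<forall>(f, n)\<in>P1. L2_dist M (f \<circ> S n) (f \<circ> T n) < \<epsilon>1) \<longrightarrow> ae_equal M `` {S} \<in> a" by (elim exE conjE)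
    from Int.IH(2)[OF e(2)] obtain P2 \<epsilon>2 where 2: "finite P2" "\<forall>(f, n)\<in>P2. f \<in> L2_fun M" "\<epsilon>2 > 0"
      "\<forall>S\<in>mp_actions M. (\<forall>(f, n)\<in>P2. L2_dist M (f \<circ> S n) (f \<circ> T n) < \<epsilon>2) \<longrightarrow> ae_equal M `` {S} \<in> b" by (elim exE conjE)
    show ?case
    proof (intro exI[of _ "P1 \<union> P2"] exI[of _ "min \<epsilon>1 \<epsilon>2"] conjI ballI impI)
      show "finite (P1 \<union> P2)" "min \<epsilon>1 \<epsilon>2 > 0" using 1 2 by auto
      show "case p of (f, n) \<Rightarrow> f \<in> L2_fun M" if "p \<in> P1 \<union> P2" for p using that 1(2) 2(2) by auto
      fix S assume S: "S \<in> mp_actions M" and c: "\<forall>(f, n)\<in>P1 \<union> P2. L2_dist M (f \<circ> S n) (f \<circ> T n) < min \<epsilon>1 \<epsilon>2"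
      have "\<forall>(f, n)\<in>P1. L2_dist M (f \<circ> S n) (f \<circ> T n) < \<epsilon>1" "\<forall>(f, n)\<in>P2. L2_dist M (f \<circ> S n) (f \<circ> T n) < \<epsilon>2"
        using c by auto
      then show "ae_equal M `` {S} \<in> a \<inter> b" using 1(4) 2(4) S by blast
    qed
  next
    case (UN K)
    then obtain k where k: "k \<in> K" "ae_equal M `` {T} \<in> k" by blast
    from UN.IH[OF k] obtain P \<epsilon> where P: "finite P" "\<forall>(f, n)\<in>P. f \<in> L2_fun M" "\<epsilon> > 0"
      "\<forall>S\<in>mp_actions M. (\<forall>(f, n)\<in>P. L2_dist M (f \<circ> S n) (f \<circ> T n) < \<epsilon>) \<longrightarrow> ae_equal M `` {S} \<in> k" by (elim exE conjE)
    show ?case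
    proof (rule exI[of _ P], rule exI[of _ \<epsilon>], intro conjI ballI impI)
      fix S assume "S \<in> mp_actions M" "\<forall>(f, n)\<in>P. L2_dist M (f \<circ> S n) (f \<circ> T n) < \<epsilon>"
      then have "ae_equal M `` {S} \<in> k" using P(4) by blast
      then show "ae_equal M `` {S} \<in> \<Union>K" using k(1) by blast
    qed (use P(1,2,3) in blast)+
  next
    case (Basis U)
    then obtain f R n \<epsilon> where U: "U = {C \<in> action_space M.
        \<exists>T\<in>C. L2_dist M (f \<circ> T n) (f \<circ> R n) < \<epsilon>}"
      and f: "f \<in> L2_fun M" and R: "R \<in> mp_actions M" by blast
    let ?d = "L2_dist M (f \<circ> T n) (f \<circ> R n)"
    have d: "?d < \<epsilon>" using Basis.prems L2_dist_class[OF f T R, of n \<epsilon>] unfolding U by simp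
    show ?case
    proof (intro exI[of _ "{(f, n)}"] exI[of _ "\<epsilon> - ?d"] conjI ballI impI)
      fix S assume S: "S \<in> mp_actions M" and c: "\<forall>(f, n)\<in>{(f, n)}. L2_dist M (f \<circ> S n) (f \<circ> T n) < \<epsilon> - ?d"
      have "L2_dist M (f \<circ> S n) (f \<circ> R n) \<le> L2_dist M (f \<circ> S n) (f \<circ> T n) + ?d"
        by (intro L2_dist_triangle L2_fun_comp f S T R)
      with c have "L2_dist M (f \<circ> S n) (f \<circ> R n) < \<epsilon>" by simp
      then show "ae_equal M `` {S} \<in> U"
        unfolding U using L2_dist_class[OF f S R, of n \<epsilon>] action_class_in[OF S] by simp
    qed (use f d in auto)
  qed
qed

lemma mixing_along_ae_equal:
  assumes "(S, T) \<in> ae_equal M" "A \<in> sets M" "mixing_along M S A A"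
  shows "mixing_along M T A A"
proof -
  have ST: "S \<in> mp_actions M" "T \<in> mp_actions M" "\<And>n. AE x in M. S n x = T n x" using assms(1) by (auto simp: ae_equal_def)
  have "measure M (T n -` A \<inter> space M \<inter> A) = measure M (S n -` A \<inter> space M \<inter> A)" for n
  proof (rule measure_eq_AE)
    show "AE x in M. x \<in> T n -` A \<inter> space M \<inter> A \<longleftrightarrow> x \<in> S n -` A \<inter> space M \<inter> A"
      using ST(3)[of n] by eventually_elim auto
  qed (use measurable_sets[OF mp_actionsD(1)[OF ST(1)] assms(2)] measurable_sets[OF mp_actionsD(1)[OF ST(2)] assms(2)] assms(2) in auto)
  then show ?thesis using assms(3) by (simp add: mixing_along_def)
qed

text \<open>For density, let a nonempty weakly open set be given. A basic neighbourhood of one of its points only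
tests finitely many functions, so it contains a mixing action, and all representatives of the
class of that action satisfy the conditions on averages. The points of \<open>N\<close> are null because the space
is nonatomic.\<close>
theorem theorem6p14:
  fixes M :: "'a::polish_space measure"
  assumes "lebesgue_probability_space M"
  shows "gdelta_in (weak_topology M) (WA M :: ('a, 'd::finite) zd_map set set) \<and>
         (weak_topology M) closure_of (WA M :: ('a, 'd) zd_map set set) = action_space M"
proof -
  obtain N where prob: "prob_space M" and na: "nonatomic M" and sN: "sets N = sets borel" and MN: "M = N \<or> M = completion N"
    using assms by (auto simp: lebesgue_probability_space_def)
  interpret M: prob_space M by (rule prob)
  have spN: "space N = UNIV" "space M = UNIV" using sets_eq_imp_space_eq[OF sN] MN by auto
  have probN: "prob_space N"
  proof (rule prob_spaceI)
    have "emeasure M (space N) = emeasure N (space N)" using MN by auto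
    then show "emeasure N (space N) = 1" using M.emeasure_space_1 spN by simp
  qed
  note subs = sets_sub[OF MN probN sN] emeasure_sub[OF MN probN sN]
  have points: "emeasure N {x} = 0" for x
  proof -
    have x: "{x} \<in> sets N" by (simp add: sN)
    have "\<not> 0 < measure M {x}"
    proof
      assume "0 < measure M {x}"
      with na subs(1)[OF x] obtain B where "B \<subseteq> {x}" "0 < measure M B" "measure M B < measure M {x}"
        unfolding nonatomic_def by blast
      then show False by (metis measure_empty order_less_irrefl subset_singletonD)
    qed
    then have "measure M {x} = 0" using measure_nonneg[of M "{x}"] by linarith
    then show ?thesis using M.emeasure_eq_measure[of "{x}"] subs(2)[OF x] by simp
  qed
  obtain \<A> :: "'a set set" where \<A>: "countable \<A>" "Int_stable \<A>" "UNIV \<in> \<A>" "\<And>U. U \<in> \<A> \<Longrightarrow> open U"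
    "sets borel = sigma_sets UNIV \<A>"
    using countable_open_generator by blast
  have \<A>N: "A \<in> sets N" if "A \<in> \<A>" for A using \<A>(4)[OF that] by (simp add: sN)
  have \<A>M: "\<A> \<subseteq> sets M" using \<A>N subs(1) by blast
  have top: "space M \<in> \<A>" using \<A>(3) by (simp add: spN)
  have approx: "\<exists>A'\<in>sigma_sets (space M) \<A>. AE x in M. x \<in> A \<longleftrightarrow> x \<in> A'" if "A \<in> sets M" for A
    using measurable_set_version[OF MN probN sN that] sN \<A>(5) by (simp add: spN)
  obtain \<B> :: "(real^'d) set set" where \<B>: "countable \<B>" "Int_stable \<B>" "UNIV \<in> \<B>" "\<And>U. U \<in> \<B> \<Longrightarrow> open U"
    "sets borel = sigma_sets UNIV \<B>"
    using countable_open_generator by blast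
  have "C \<in> (weak_topology M) closure_of (WA M :: ('a, 'd) zd_map set set)" if C: "C \<in> action_space M" for C
    unfolding in_closure_of
  proof (intro conjI allI impI)
    show "C \<in> topspace (weak_topology M)" using C by (simp add: topspace_weak_topology)
    fix U assume U: "C \<in> U \<and> openin (weak_topology M) U"
    obtain T where T: "T \<in> mp_actions M" "C = ae_equal M `` {T}" using C by (rule action_space_cases)
    from weak_topology_basic_neighbourhood[OF T(1), of U] U T(2) obtain P \<epsilon> where
      P: "finite P" "\<forall>(f, n)\<in>P. f \<in> L2_fun M" and \<epsilon>: "\<epsilon> > 0" and
      nb: "\<forall>S\<in>mp_actions M. (\<forall>(f, n)\<in>P. L2_dist M (f \<circ> S n) (f \<circ> T n) < \<epsilon>) \<longrightarrow> ae_equal M `` {S} \<in> U" by auto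
    have PL: "fst ` P \<subseteq> L2_fun M" using P(2) by auto
    obtain S :: "('a, 'd) zd_map" where S: "S \<in> mp_actions M" and mix: "\<And>A. A \<in> sets N \<Longrightarrow> mixing_along M S A A"
      and close: "\<And>f n. (f, n) \<in> P \<Longrightarrow> L2_dist M (f \<circ> S n) (f \<circ> T n) < \<epsilon>"
      by (rule mixing_approximation[OF MN probN sN points T(1) P(1) PL \<epsilon>], rule that; assumption)
    have "ae_equal M `` {S} \<in> WA M"
      unfolding WA_def
    proof (intro CollectI conjI[OF action_class_in[OF S]] ballI)
      fix R assume R: "R \<in> ae_equal M `` {S}"
      then have RS: "(S, R) \<in> ae_equal M" by simp
      have Rm: "R \<in> mp_actions M" using RS by (auto simp: ae_equal_def)
      have iff: "(weak_mixing M R \<and> (\<forall>e\<in>{1..CARD('d)}. \<forall>L\<in>directions e. directional_weak_mixing M R L))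
        \<longleftrightarrow> (\<forall>A\<in>\<A>. \<forall>B\<in>\<B>. \<forall>k v \<theta> \<epsilon>. norm v = 1 \<longrightarrow> \<epsilon> > 0 \<longrightarrow> small_average M A k B v \<theta> \<epsilon> R)"
        by (rule WA_conditions_iff_small_averages[OF prob Rm \<A>(2) \<A>M top approx \<B>(2,3,4,5)])
      show "weak_mixing M R \<and> (\<forall>e\<in>{1..CARD('d)}. \<forall>L\<in>directions e. directional_weak_mixing M R L)"
        unfolding iff
      proof (intro ballI allI impI)
        fix A B k \<theta> and v :: "real^'d" and e :: real
        assume A: "A \<in> \<A>" and v: "norm v = 1" and e: "e > 0"
        have "mixing_along M R A A"
          by (rule mixing_along_ae_equal[OF RS subs(1)[OF \<A>N[OF A]] mix[OF \<A>N[OF A]]])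
        then show "small_average M A k B v \<theta> e R"
          by (rule small_average_of_mixing[OF prob subs(1)[OF \<A>N[OF A]] Rm _ v e])
      qed
    qed
    moreover have "ae_equal M `` {S} \<in> U" using nb S close by blast
    ultimately show "\<exists>y. y \<in> WA M \<and> y \<in> U" by blast
  qed
  moreover have "(weak_topology M) closure_of (WA M :: ('a, 'd) zd_map set set) \<subseteq> action_space M"
    using closure_of_subset_topspace[of "weak_topology M"] by (simp add: topspace_weak_topology)
  ultimately show ?thesis
    using gdelta_in_WA[OF prob \<A>(1,2) \<A>M top approx] by blast
qed

end
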